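(* Suppose $P_1$ and $P_2$ are disjoint and non-parallel planes in $\mathbb{H}^3$, and $B_3$ and $B_4$ are horoballs respectively defined by positive light-like vectors $\mathbf{x}_3$ and $\mathbf{x}_4$ with $[\mathbf{x}_3]\neq[\mathbf{x}_4]$, neither in the ideal boundary of either $P_i$, such that for each $i\in\{1,2\}$, a single half-space $H_i$ bounded by $P_i$ contains $P_{3-i}$ and, in its ideal boundary, each of $\mathbf{x}_3$ and $\mathbf{x}_4$. Let $\tilde\lambda_{12}$ be the geodesic intersecting $P_1$ and $P_2$ at right angles; for $i\in\{1,2\}$ and $j\in\{3,4\}$ let $\tilde\lambda_{ij}$ be the perpendicular geodesic to $P_i$ in the direction of $\mathbf{x}_j$; and let $\tilde\lambda_{34}$ be the geodesic with ideal endpoints at $\mathbf{x}_3$ and $\mathbf{x}_4$. Fix parametrizations $\tilde\lambda_{12}(s)$ and $\tilde\lambda_{34}(t)$ by arclength. Then: \begin{enumerate} \item the function $D(s,t)$ that records the hyperbolic cosine of the distance from $\tilde\lambda_{12}(s)$ to $\tilde\lambda_{34}(t)$ has a unique critical point $(s_0,t_0)$ in $\mathbb{R}^2$, at which it attains an absolute minimum; \item the absolute minimum value $D(s_0,t_0)$ depends only on the distance $\ell_{12}$ between $P_1$ and $P_2$, the signed distances $h_{ij}$ from the $P_i$ ($i\in\{1,2\}$) to the $B_j$ ($j\in\{3,4\}$), and the signed distance $d_{34}$ from $B_3$ to $B_4$; \item the points $\tilde\lambda_{12}(s_0)$ and $\tilde\lambda_{34}(t_0)$ lie in the partially truncated tetrahedron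 $\Delta$ determined by the $P_i$ and $B_j$, so $D(s_0,t_0)$ is the hyperbolic cosine of a transversal length of $\Delta$; and \item written as $T_2^{cb}(x,y;a,b;c,d)$, where $x=\cosh\ell_{12}$, $y=e^{d_{34}}$, $a=e^{h_{13}}$, $b=e^{h_{14}}$, $c=e^{h_{23}}$, and $d=e^{h_{24}}$, this transversal length is increasing in each of $a$, $b$, $c$, $d$ individually and invariant under any product of two disjoint transpositions of $\{a,b,c,d\}$. \end{enumerate} Given explicitly, $\cosh T_2^{cb}(x,y;a,b;c,d)$ equals \[ \frac{1}{2\sqrt{y}}\left[\sqrt{\left(\frac{xa+c}{\sqrt{x^2-1}}-a\right)\left(\frac{xb+d}{\sqrt{x^2-1}}+b\right)}+\sqrt{\left(\frac{xa+c}{\sqrt{x^2-1}}+a\right)\left(\frac{xb+d}{\sqrt{x^2-1}}-b\right)}\right]. \]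
   Context: Hyperboloid model. On $\mathbb{R}^{4}$ put $\mathbf{x}\circ\mathbf{y}=-x_1y_1+x_2y_2+x_3y_3+x_4y_4$. A nonzero vector $\mathbf{x}$ is light-like if $\mathbf{x}\circ\mathbf{x}=0$, and time-like if $\mathbf{x}\circ\mathbf{x}<0$; such a vector is positive if its first entry is positive. $\mathbb{H}^3$ is the set of positive $\mathbf{x}$ with $\mathbf{x}\circ\mathbf{x}=-1$, with $\cosh d_H(\mathbf{u},\mathbf{v})=-\mathbf{u}\circ\mathbf{v}$. Ideal points of $\mathbb{H}^3$ are projective classes $[\mathbf{x}]$ of positive light-like vectors. A positive light-like $\mathbf{x}$ determines the horosphere $S=\{\mathbf{v}\in\mathbb{H}^3: \mathbf{v}\circ\mathbf{x}=-1\}$ and the horoball $B=\{\mathbf{v}\in\mathbb{H}^3:\mathbf{v}\circ\mathbf{x}\ge -1\}$, with ideal point $[\mathbf{x}]$. A plane is $P=V\cap\mathbb{H}^3$ for a 3-dimensional subspace $V$ containing a time-like vector; a half-space is the closure of a component of $\mathbb{H}^3-P$. The ideal boundary of $P$ (resp. of a half-space $H$ bounded by $P$) is the intersection of the set of positive light-like vectors with $V$ (resp. with the closure of the component of $\mathbb{R}^4-V$ containing the interior of $H$). Two disjoint planes are parallel if their ideal boundaries intersect. The geodesic perpendicular to $P$ in the direction of $\mathbf{x}$ is the geodesic meeting $P$ at a right angle and having $[\mathbf{x}]$ as an ideal endpoint. The signed distance from a point to a horoball $B$ is the distance to $\partial B$, positive outside $B$ and negative inside. The signed distance from a plane to $B$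 is the minimum over points of the plane of the signed distance to $B$. The signed distance between two horoballs with distinct ideal points is the minimum of the signed distance to one over points of the boundary of the other (negative if they overlap). Partially truncated tetrahedron (two planes, two horoballs). With the data of the claim, for each $i\in\{1,2,3,4\}$ there is a unique plane $\widehat P_i$ meeting $P_j$ at right angles for each $j\le 2$, $j\ne i$, and having $\mathbf{x}_j$ in its ideal boundary for each $j\in\{3,4\}$, $j\neq i$. If $\widehat P_1$ does not meet $P_1$ orthogonally, then $\Delta=H_1\cap H_2\cap\left(\bigcap_{i=1}^4\widehat H_i\right)$, where $\widehat H_i$ is the half-space bounded by $\widehat P_i$ that contains: for $i\le 2$, the shortest arc from $P_{3-i}$ to $P_i$ and the geodesic rays from $P_i$, perpendicular to $P_i$, in the directions of $\mathbf{x}_3$ and $\mathbf{x}_4$; for $i\in\{3,4\}$, the geodesics perpendicular to $P_1$ and to $P_2$ in the direction of $\mathbf{x}_i$, and the geodesic joining $\mathbf{x}_3$ to $\mathbf{x}_4$. If $\widehat P_1$ meets $P_1$ orthogonally, all $\widehat P_i$ equal a single plane $\widehat P$; after renumbering so that the line in $\widehat P$ joining the objects numbered $1$ and $3$ separates the objects numbered $2$ and $4$ (the objects being the lines $P_i\cap\widehat P$ and the ideal points $[\mathbf{x}_j]$, and the line joining two objects being the common perpendicular, the perpendicular in the direction of the ideal point, or the geodesic with the two given ideal endpoints, as appropriate), the (degenerate) $\Delta$ is $\widehat P\cap H_1\cap H_2\cap h_{12}\cap h_{23}\cap h_{34}\cap h_{14}$ (with $H_1,H_2$ the half-spaces of the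 two planes), where $h_{pq}$ is the half-plane of $\widehat P$ bounded by the line joining objects $p$ and $q$ and containing the other two objects (in its ideal boundary, for ideal points). Edges: $\lambda_{12}$ is the shortest arc joining $P_1$ to $P_2$; for $i\le2<j$, $\lambda_{ij}$ is the geodesic ray from $P_i$, perpendicular to $P_i$, in the direction of $\mathbf{x}_j$; $\lambda_{34}$ is the geodesic joining $\mathbf{x}_3$ to $\mathbf{x}_4$. The edge opposite $\lambda_{12}$ is $\lambda_{34}$. The transversal of $\Delta$ joining an edge to its opposite is the shortest geodesic arc with one endpoint on each edge, or their point of intersection if they intersect (length $0$); here the transversal length in question is that joining $\lambda_{12}$ to $\lambda_{34}$. *)

theory Defs
  imports "HOL-Analysis.Analysis"
begin

type_synonym vec4 = "real ^ 4"

section \<open>The hyperboloid model\<close>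

definition lorentz :: "vec4 \<Rightarrow> vec4 \<Rightarrow> real" (infixl "\<circ>\<^sub>L" 70) where
  "x \<circ>\<^sub>L y = - x $ 1 * y $ 1 + x $ 2 * y $ 2 + x $ 3 * y $ 3 + x $ 4 * y $ 4"

definition timelike :: "vec4 \<Rightarrow> bool" where
  "timelike x \<longleftrightarrow> x \<noteq> 0 \<and> x \<circ>\<^sub>L x < 0"

definition positive_lightlike :: "vec4 \<Rightarrow> bool" where
  "positive_lightlike x \<longleftrightarrow> x \<noteq> 0 \<and> x \<circ>\<^sub>L x = 0 \<and> x $ 1 > 0"

definition H3 :: "vec4 set" where
  "H3 = {x. x $ 1 > 0 \<and> x \<circ>\<^sub>L x = - 1}"

definition dH :: "vec4 \<Rightarrow> vec4 \<Rightarrow> real" where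
  "dH u v = arcosh (- (u \<circ>\<^sub>L v))"

definition ideal_point :: "vec4 \<Rightarrow> vec4 set" where
  "ideal_point x = {y. \<exists>c. c \<noteq> 0 \<and> y = c *\<^sub>R x}"


section \<open>Planes, geodesics, half-spaces and half-planes\<close>

text \<open>\<open>flat k V F\<close>: the set \<open>F\<close> is the \<open>k\<close>-dimensional totally geodesic subspace cut out by
  the linear subspace \<open>V\<close>. Planes are the case \<open>k = 2\<close>, geodesics \<open>k = 1\<close>, and
  \<open>H3\<close> itself is the case \<open>k = 3\<close>, \<open>V = UNIV\<close>. The set \<open>F\<close> determines
  \<open>V\<close> and \<open>k\<close>, so the existential quantifiers over these below pick out unique objects.\<close>

definition flat :: "nat \<Rightarrow> vec4 set \<Rightarrow> vec4 set \<Rightarrow> bool" where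
  "flat k V F \<longleftrightarrow> subspace V \<and> dim V = k + 1 \<and> (\<exists>v\<in>V. timelike v) \<and> F = V \<inter> H3"

definition is_plane :: "vec4 set \<Rightarrow> bool" where
  "is_plane P \<longleftrightarrow> (\<exists>V. flat 2 V P)"

definition is_geodesic :: "vec4 set \<Rightarrow> bool" where
  "is_geodesic L \<longleftrightarrow> (\<exists>V. flat 1 V L)"

text \<open>Ideal boundaries are sets of positive light-like vectors, closed under positive scaling.\<close>

definition ideal_boundary :: "vec4 set \<Rightarrow> vec4 set" where
  "ideal_boundary F = {x. positive_lightlike x \<and> (\<exists>k V. flat k V F \<and> x \<in> V)}"

definition parallel_planes :: "vec4 set \<Rightarrow> vec4 set \<Rightarrow> bool" where
  "parallel_planes P Q \<longleftrightarrow> P \<inter> Q = {} \<and> ideal_boundary P \<inter> ideal_boundary Q \<noteq> {}"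

text \<open>\<open>half_of F G h\<close>: \<open>h\<close> is a half of \<open>F\<close> bounded by \<open>G\<close>. It is a half-space for
  \<open>F = H3\<close> and \<open>G\<close> a plane, and a half-plane for \<open>F\<close> a plane and \<open>G\<close> a geodesic in \<open>F\<close>.
  Since \<open>F\<close> is closed in the ambient space, the closure may be taken there.\<close>

definition half_of :: "vec4 set \<Rightarrow> vec4 set \<Rightarrow> vec4 set \<Rightarrow> bool" where
  "half_of F G h \<longleftrightarrow> (\<exists>C\<in>components (F - G). h = closure C)"

definition half_ideal_boundary :: "vec4 set \<Rightarrow> vec4 set \<Rightarrow> vec4 set \<Rightarrow> vec4 set" where
  "half_ideal_boundary F G h =
     {x. positive_lightlike x \<and>
         (\<exists>k U m V W. flat k U F \<and> flat m V G \<and> W \<in> components (U - V) \<and>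
            (top_of_set F) interior_of h \<subseteq> W \<and> x \<in> closure W)}"

text \<open>The tangent space at \<open>p\<close> of the flat cut out by \<open>V\<close> is
  the set of \<open>v \<in> V\<close> with \<open>v \<circ>\<^sub>L p = 0\<close>.\<close>

definition perp_to_plane :: "vec4 set \<Rightarrow> vec4 set \<Rightarrow> bool" where
  "perp_to_plane L P \<longleftrightarrow>
     (\<exists>V W p. flat 1 V L \<and> flat 2 W P \<and> p \<in> L \<inter> P \<and>
        (\<forall>v\<in>V. \<forall>w\<in>W. v \<circ>\<^sub>L p = 0 \<and> w \<circ>\<^sub>L p = 0 \<longrightarrow> v \<circ>\<^sub>L w = 0))"

text \<open>Two planes meet at right angles if they intersect and their normals are orthogonal; a vector
  Lorentz-orthogonal to \<open>V\<close> is tangent to \<open>H3\<close> at each point of the plane cut out by \<open>V\<close>,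
  and normal to this plane there.\<close>

definition orthogonal_planes :: "vec4 set \<Rightarrow> vec4 set \<Rightarrow> bool" where
  "orthogonal_planes P Q \<longleftrightarrow>
     (\<exists>V W. flat 2 V P \<and> flat 2 W Q \<and> P \<inter> Q \<noteq> {} \<and>
        (\<forall>n m. (\<forall>v\<in>V. n \<circ>\<^sub>L v = 0) \<and> (\<forall>w\<in>W. m \<circ>\<^sub>L w = 0) \<longrightarrow> n \<circ>\<^sub>L m = 0))"

definition common_perp :: "vec4 set \<Rightarrow> vec4 set \<Rightarrow> vec4 set" where
  "common_perp P Q = (THE L. is_geodesic L \<and> perp_to_plane L P \<and> perp_to_plane L Q)"

definition perp_toward :: "vec4 set \<Rightarrow> vec4 \<Rightarrow> vec4 set" where
  "perp_toward P x = (THE L. is_geodesic L \<and> perp_to_plane L P \<and> x \<in> ideal_boundary L)"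

definition geodesic_joining :: "vec4 \<Rightarrow> vec4 \<Rightarrow> vec4 set" where
  "geodesic_joining x y = (THE L. is_geodesic L \<and> x \<in> ideal_boundary L \<and> y \<in> ideal_boundary L)"

text \<open>Geodesic from \<open>p\<close> to \<open>q\<close>: an arc if \<open>q\<close> lies in \<open>H3\<close>,
  a ray if \<open>q\<close> is positive light-like.\<close>

definition geodesic_to :: "vec4 \<Rightarrow> vec4 \<Rightarrow> vec4 set" where
  "geodesic_to p q = {v \<in> H3. \<exists>\<alpha> \<beta>. \<alpha> \<ge> 0 \<and> \<beta> \<ge> 0 \<and> v = \<alpha> *\<^sub>R p + \<beta> *\<^sub>R q}"

definition arclength_param :: "vec4 set \<Rightarrow> (real \<Rightarrow> vec4) \<Rightarrow> bool" where
  "arclength_param L \<gamma> \<longleftrightarrow> range \<gamma> = L \<and> (\<forall>s t. dH (\<gamma> s) (\<gamma> t) = \<bar>s - t\<bar>)"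


section \<open>Distances\<close>

definition plane_dist :: "vec4 set \<Rightarrow> vec4 set \<Rightarrow> real" where
  "plane_dist P Q = (INF (u, v) \<in> P \<times> Q. dH u v)"

definition horosphere :: "vec4 \<Rightarrow> vec4 set" where
  "horosphere x = {v \<in> H3. v \<circ>\<^sub>L x = - 1}"

definition horoball :: "vec4 \<Rightarrow> vec4 set" where
  "horoball x = {v \<in> H3. v \<circ>\<^sub>L x \<ge> - 1}"

text \<open>The horoball is represented by its light-like vector, and its boundary is
  \<open>horosphere x\<close>. In the cases of interest the infima below are attained.\<close>

definition point_horoball_dist :: "vec4 \<Rightarrow> vec4 \<Rightarrow> real" where
  "point_horoball_dist v x =
     (if v \<in> horoball x then - (INF w \<in> horosphere x. dH v w) else (INF w \<in> horosphere x. dH v w))"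

definition plane_horoball_dist :: "vec4 set \<Rightarrow> vec4 \<Rightarrow> real" where
  "plane_horoball_dist P x = (INF v \<in> P. point_horoball_dist v x)"

definition horoball_dist :: "vec4 \<Rightarrow> vec4 \<Rightarrow> real" where
  "horoball_dist x y = (INF v \<in> horosphere x. point_horoball_dist v y)"


section \<open>The partially truncated tetrahedron with two planes and two horoballs\<close>

text \<open>Throughout, \<open>P\<close> and \<open>H\<close> are used only at the indices \<open>1, 2\<close> and \<open>x\<close> only
  at \<open>3, 4\<close>.\<close>

definition tet_data :: "(nat \<Rightarrow> vec4 set) \<Rightarrow> (nat \<Rightarrow> vec4 set) \<Rightarrow> (nat \<Rightarrow> vec4) \<Rightarrow> bool" where
  "tet_data P H x \<longleftrightarrow>
     is_plane (P 1) \<and> is_plane (P 2) \<and> P 1 \<inter> P 2 = {} \<and> \<not> parallel_planes (P 1) (P 2) \<and>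
     positive_lightlike (x 3) \<and> positive_lightlike (x 4) \<and> ideal_point (x 3) \<noteq> ideal_point (x 4) \<and>
     (\<forall>i\<in>{1, 2}. \<forall>j\<in>{3, 4}. x j \<notin> ideal_boundary (P i)) \<and>
     (\<forall>i\<in>{1, 2}. half_of H3 (P i) (H i) \<and> P (3 - i) \<subseteq> H i \<and>
        (\<forall>j\<in>{3, 4}. x j \<in> half_ideal_boundary H3 (P i) (H i)))"

definition shortest_arc :: "vec4 set \<Rightarrow> vec4 set \<Rightarrow> vec4 set" where
  "shortest_arc P Q = \<Union> {geodesic_to p q | p q. p \<in> P \<and> q \<in> Q \<and> dH p q = plane_dist P Q}"

definition perp_ray :: "vec4 set \<Rightarrow> vec4 \<Rightarrow> vec4 set" where
  "perp_ray P x = \<Union> {geodesic_to p x | p. p \<in> P \<inter> perp_toward P x}"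

definition side_plane :: "(nat \<Rightarrow> vec4 set) \<Rightarrow> (nat \<Rightarrow> vec4) \<Rightarrow> nat \<Rightarrow> vec4 set" where
  "side_plane P x i =
     (THE Q. is_plane Q \<and> (\<forall>j\<in>{1, 2} - {i}. orthogonal_planes Q (P j)) \<and>
        (\<forall>j\<in>{3, 4} - {i}. x j \<in> ideal_boundary Q))"

definition opposite_edges :: "(nat \<Rightarrow> vec4 set) \<Rightarrow> (nat \<Rightarrow> vec4) \<Rightarrow> nat \<Rightarrow> vec4 set" where
  "opposite_edges P x i =
     (if i \<le> 2 then shortest_arc (P (3 - i)) (P i) \<union> perp_ray (P i) (x 3) \<union> perp_ray (P i) (x 4)
      else perp_toward (P 1) (x i) \<union> perp_toward (P 2) (x i) \<union> geodesic_joining (x 3) (x 4))"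

definition side_half_space :: "(nat \<Rightarrow> vec4 set) \<Rightarrow> (nat \<Rightarrow> vec4) \<Rightarrow> nat \<Rightarrow> vec4 set" where
  "side_half_space P x i =
     (THE K. half_of H3 (side_plane P x i) K \<and> opposite_edges P x i \<subseteq> K)"

text \<open>The degenerate case, inside the plane \<open>Q\<close> that all side planes coincide with. Object
  \<open>p\<close> is the line \<open>P p \<inter> Q\<close> if \<open>p \<le> 2\<close>, and the ideal point of \<open>x p\<close>
  otherwise. Since \<open>Q\<close> is orthogonal to the \<open>P p\<close>, perpendiculars in \<open>Q\<close> to
  \<open>P p \<inter> Q\<close> are perpendiculars to \<open>P p\<close>.\<close>

definition joining_line :: "(nat \<Rightarrow> vec4 set) \<Rightarrow> (nat \<Rightarrow> vec4) \<Rightarrow> nat \<Rightarrow> nat \<Rightarrow> vec4 set" where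
  "joining_line P x p q =
     (if p \<le> 2 \<and> q \<le> 2 then common_perp (P p) (P q)
      else if p \<le> 2 then perp_toward (P p) (x q)
      else if q \<le> 2 then perp_toward (P q) (x p)
      else geodesic_joining (x p) (x q))"

definition object_in_half ::
  "(nat \<Rightarrow> vec4 set) \<Rightarrow> (nat \<Rightarrow> vec4) \<Rightarrow> vec4 set \<Rightarrow> vec4 set \<Rightarrow> vec4 set \<Rightarrow> nat \<Rightarrow> bool" where
  "object_in_half P x Q L h p \<longleftrightarrow>
     half_of Q L h \<and> (if p \<le> 2 then P p \<inter> Q \<subseteq> h else x p \<in> half_ideal_boundary Q L h)"

definition separates ::
  "(nat \<Rightarrow> vec4 set) \<Rightarrow> (nat \<Rightarrow> vec4) \<Rightarrow> vec4 set \<Rightarrow> vec4 set \<Rightarrow> nat \<Rightarrow> nat \<Rightarrow> bool" where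
  "separates P x Q L p q \<longleftrightarrow>
     (\<exists>h h'. h \<noteq> h' \<and> object_in_half P x Q L h p \<and> object_in_half P x Q L h' q)"

text \<open>\<open>\<sigma> k\<close> is the original index of the object that receives the new number \<open>k\<close>.\<close>

definition good_numbering ::
  "(nat \<Rightarrow> vec4 set) \<Rightarrow> (nat \<Rightarrow> vec4) \<Rightarrow> vec4 set \<Rightarrow> (nat \<Rightarrow> nat) \<Rightarrow> bool" where
  "good_numbering P x Q \<sigma> \<longleftrightarrow>
     bij_betw \<sigma> {1, 2, 3, 4} {1, 2, 3, 4} \<and>
     separates P x Q (joining_line P x (\<sigma> 1) (\<sigma> 3)) (\<sigma> 2) (\<sigma> 4)"

definition edge_half_plane ::
  "(nat \<Rightarrow> vec4 set) \<Rightarrow> (nat \<Rightarrow> vec4) \<Rightarrow> vec4 set \<Rightarrow> nat \<Rightarrow> nat \<Rightarrow> vec4 set" where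
  "edge_half_plane P x Q p q =
     (THE h. \<forall>r\<in>{1, 2, 3, 4} - {p, q}. object_in_half P x Q (joining_line P x p q) h r)"

definition trunc_tet ::
  "(nat \<Rightarrow> vec4 set) \<Rightarrow> (nat \<Rightarrow> vec4 set) \<Rightarrow> (nat \<Rightarrow> vec4) \<Rightarrow> vec4 set" where
  "trunc_tet P H x =
     (if \<not> orthogonal_planes (side_plane P x 1) (P 1)
      then H 1 \<inter> H 2 \<inter> (\<Inter>i\<in>{1, 2, 3, 4}. side_half_space P x i)
      else (let Q = side_plane P x 1;
                \<sigma> = (SOME \<sigma>. good_numbering P x Q \<sigma>);
                h = (\<lambda>p q. edge_half_plane P x Q (\<sigma> p) (\<sigma> q))
            in Q \<inter> H 1 \<inter> H 2 \<inter> h 1 2 \<inter> h 2 3 \<inter> h 3 4 \<inter> h 1 4))"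

text \<open>The geodesic arc from \<open>u\<close> to \<open>v\<close> is a transversal joining the edges \<open>A\<close> and \<open>B\<close>;
  the case \<open>u = v\<close> covers intersecting edges.\<close>

definition is_transversal :: "vec4 set \<Rightarrow> vec4 set \<Rightarrow> vec4 \<Rightarrow> vec4 \<Rightarrow> bool" where
  "is_transversal A B u v \<longleftrightarrow>
     u \<in> A \<and> v \<in> B \<and> (\<forall>u'\<in>A. \<forall>v'\<in>B. dH u v \<le> dH u' v')"

definition critical_point :: "(real \<times> real \<Rightarrow> real) \<Rightarrow> real \<times> real \<Rightarrow> bool" where
  "critical_point f p \<longleftrightarrow> (f has_derivative (\<lambda>_. 0)) (at p)"

text \<open>The parameter tuples \<open>(x, y, a, b, c, d)\<close> realized by some configuration, that is, the
  domain of the transversal length as a function of these parameters.\<close>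

definition tet_params ::
  "(nat \<Rightarrow> vec4 set) \<Rightarrow> (nat \<Rightarrow> vec4) \<Rightarrow> real \<times> real \<times> real \<times> real \<times> real \<times> real" where
  "tet_params P x =
     (cosh (plane_dist (P 1) (P 2)), exp (horoball_dist (x 3) (x 4)),
      exp (plane_horoball_dist (P 1) (x 3)), exp (plane_horoball_dist (P 1) (x 4)),
      exp (plane_horoball_dist (P 2) (x 3)), exp (plane_horoball_dist (P 2) (x 4)))"

definition realized_params :: "(real \<times> real \<times> real \<times> real \<times> real \<times> real) set" where
  "realized_params = {tet_params P x | P H x. tet_data P H x}"

end

theory Submission
  imports Defs
begin

text \<open>Let \<open>u 1\<close>, \<open>u 2\<close> be the outward unit normals of the two planes and \<open>u 3\<close>, \<open>u 4\<close> the
  light-like vectors of the horoballs. Distinct vectors \<open>u p\<close>, \<open>u q\<close> have a negative product whose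
  square exceeds the product of their squares, so each pair spans a Lorentzian plane, cutting out
  the line that joins the objects \<open>p\<close> and \<open>q\<close>, and a point of this line is a positive combination
  of \<open>u p\<close> and \<open>u q\<close>.

  The side plane \<open>i\<close> is normal to the vector \<open>m\<close> orthogonal to all \<open>u j\<close> with \<open>j \<noteq> i\<close>; if the
  sign of \<open>m\<close> is such that \<open>m \<circ>\<^sub>L u i > 0\<close>, the side half-space is where \<open>m\<close> is nonnegative, so
  it contains all six lines. In the degenerate case the four vectors lie in a three-dimensional
  space and satisfy one linear relation, with two positive and two negative coefficients. The line
  joining \<open>p\<close> and \<open>q\<close> separates the other two objects iff their coefficients have equal signs, and
  again the half-planes of the definition contain the points of all six lines.

  With arc-length parameters \<open>s\<close>, \<open>t\<close>, the hyperbolic cosine of the distance is proportional to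
  \<open>\<alpha> * exp t * cosh (s - s3) + \<beta> * exp (- t) * cosh (s - s4)\<close>, where \<open>s3\<close> and \<open>s4\<close> locate the
  projections of the ideal points to the common perpendicular. Its only critical point has
  \<open>s = (s3 + s4) / 2\<close>, between the feet of the common perpendicular.\<close>

section \<open>Lorentz geometry\<close>

text \<open>Side planes, half-spaces and half-planes are defined through \<open>THE\<close>,
  \<open>SOME\<close>, components and closures. Each of these objects is therefore first identified
  with the sign of a Lorentz product with a normal vector; what remains is sign bookkeeping in the
  Gram matrix of the vectors \<open>u i\<close>, since a linear test on a positive combination
  reduces to tests on the \<open>u i\<close>.

  The degenerate case is the awkward one: \<open>SOME\<close> gives no control over the numbering,
  so only the separation property may be used. It pins down the sign classes of the linear relation,
  and these determine all four half-planes.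

  That the critical point lies on the edge, and not merely on the line carrying it, comes from the
  two halves of the sign hypothesis: negative products of the light-like vectors with
  \<open>u 1\<close> put \<open>s3\<close> and \<open>s4\<close> behind the first foot, and negative
  products with \<open>u 2\<close> put them before the second.

  The explicit expression is known to be at least 1 because it is the hyperbolic cosine of a
  distance in a realizing configuration; this is why symmetry and monotonicity are proved on
  \<open>realized_params\<close>.\<close>

lemma lorentz_commute: "x \<circ>\<^sub>L y = y \<circ>\<^sub>L x"
  by (simp add: lorentz_def algebra_simps)

lemma lorentz_add_left: "(x + y) \<circ>\<^sub>L z = x \<circ>\<^sub>L z + y \<circ>\<^sub>L z"
  and lorentz_add_right: "z \<circ>\<^sub>L (x + y) = z \<circ>\<^sub>L x + z \<circ>\<^sub>L y"
  and lorentz_diff_left: "(x - y) \<circ>\<^sub>L z = x \<circ>\<^sub>L z - y \<circ>\<^sub>L z"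
  and lorentz_diff_right: "z \<circ>\<^sub>L (x - y) = z \<circ>\<^sub>L x - z \<circ>\<^sub>L y"
  and lorentz_minus_left: "(- x) \<circ>\<^sub>L z = - (x \<circ>\<^sub>L z)"
  and lorentz_minus_right: "z \<circ>\<^sub>L (- x) = - (z \<circ>\<^sub>L x)"
  and lorentz_scaleR_left: "(r *\<^sub>R x) \<circ>\<^sub>L z = r * (x \<circ>\<^sub>L z)"
  and lorentz_scaleR_right: "z \<circ>\<^sub>L (r *\<^sub>R x) = r * (z \<circ>\<^sub>L x)"
  and lorentz_zero_left: "0 \<circ>\<^sub>L z = 0"
  and lorentz_zero_right: "z \<circ>\<^sub>L 0 = 0"
  by (simp_all add: lorentz_def algebra_simps)

lemmas lorentz_simps = lorentz_add_left lorentz_add_right lorentz_diff_left lorentz_diff_right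
  lorentz_minus_left lorentz_minus_right lorentz_scaleR_left lorentz_scaleR_right
  lorentz_zero_left lorentz_zero_right

lemma vec4_eq_iff: "(x :: vec4) = y \<longleftrightarrow> x $ 1 = y $ 1 \<and> x $ 2 = y $ 2 \<and> x $ 3 = y $ 3 \<and> x $ 4 = y $ 4"
  by (simp add: vec_eq_iff forall_4)

lemma inner_vec4: "(x :: vec4) \<bullet> y = x $ 1 * y $ 1 + x $ 2 * y $ 2 + x $ 3 * y $ 3 + x $ 4 * y $ 4"
  by (simp add: inner_vec_def sum_4)

definition time_reflect :: "vec4 \<Rightarrow> vec4" where
  "time_reflect x = (\<chi> i. if i = 1 then - x $ 1 else x $ i)"

lemma time_reflect_nth [simp]:
  "time_reflect x $ 1 = - x $ 1" "time_reflect x $ 2 = x $ 2"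
  "time_reflect x $ 3 = x $ 3" "time_reflect x $ 4 = x $ 4"
  by (simp_all add: time_reflect_def)

lemma lorentz_eq_inner: "x \<circ>\<^sub>L y = time_reflect x \<bullet> y"
  by (simp add: lorentz_def inner_vec4)

lemma inner_eq_lorentz: "x \<bullet> y = time_reflect x \<circ>\<^sub>L y"
  by (simp add: lorentz_def inner_vec4)

lemma time_reflect_eq_0_iff [simp]: "time_reflect x = 0 \<longleftrightarrow> x = 0"
  by (simp add: vec4_eq_iff)

lemma continuous_lorentz [continuous_intros]:
  "continuous_on S f \<Longrightarrow> continuous_on S g \<Longrightarrow> continuous_on S (\<lambda>x. f x \<circ>\<^sub>L g x)"
  unfolding lorentz_def by (intro continuous_intros)

section \<open>Causal character of vectors\<close>

lemma cauchy_schwarz_3: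
  fixes a b c d e f :: real
  shows "(a * d + b * e + c * f)\<^sup>2 \<le> (a\<^sup>2 + b\<^sup>2 + c\<^sup>2) * (d\<^sup>2 + e\<^sup>2 + f\<^sup>2)"
proof -
  \<comment> \<open>Lagrange's identity: the defect is the sum of the squares of the 2 by 2
    minors.\<close>
  have "(a\<^sup>2 + b\<^sup>2 + c\<^sup>2) * (d\<^sup>2 + e\<^sup>2 + f\<^sup>2) - (a * d + b * e + c * f)\<^sup>2
      = (a * e - b * d)\<^sup>2 + (a * f - c * d)\<^sup>2 + (b * f - c * e)\<^sup>2"
    by (simp add: power2_eq_square algebra_simps)
  moreover have "\<dots> \<ge> 0" by simp
  ultimately show ?thesis by linarith
qed

definition space_sq :: "vec4 \<Rightarrow> real" where
  "space_sq x = (x $ 2)\<^sup>2 + (x $ 3)\<^sup>2 + (x $ 4)\<^sup>2"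

lemma lorentz_self: "x \<circ>\<^sub>L x = space_sq x - (x $ 1)\<^sup>2"
  by (simp add: lorentz_def space_sq_def power2_eq_square)

lemma space_sq_nonneg [simp]: "space_sq x \<ge> 0"
  by (simp add: space_sq_def)

lemma space_sq_eq_0_iff: "space_sq x = 0 \<longleftrightarrow> x $ 2 = 0 \<and> x $ 3 = 0 \<and> x $ 4 = 0"
  by (simp add: space_sq_def add_nonneg_eq_0_iff)

lemma space_cauchy_schwarz: "(x \<circ>\<^sub>L y + x $ 1 * y $ 1)\<^sup>2 \<le> space_sq x * space_sq y"
  using cauchy_schwarz_3[of "x $ 2" "y $ 2" "x $ 3" "y $ 3" "x $ 4" "y $ 4"]
  by (simp add: lorentz_def space_sq_def add.assoc)

lemma causal_lorentz_nonpos: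
  assumes "x \<circ>\<^sub>L x \<le> 0" "y \<circ>\<^sub>L y \<le> 0" "x $ 1 > 0" "y $ 1 > 0"
  shows "x \<circ>\<^sub>L y \<le> 0"
proof -
  have "space_sq x * space_sq y \<le> (x $ 1)\<^sup>2 * (y $ 1)\<^sup>2"
    using assms by (intro mult_mono) (auto simp: lorentz_self)
  then have "(x \<circ>\<^sub>L y + x $ 1 * y $ 1)\<^sup>2 \<le> (x $ 1 * y $ 1)\<^sup>2"
    using space_cauchy_schwarz[of x y] by (simp add: power_mult_distrib)
  then have "x \<circ>\<^sub>L y + x $ 1 * y $ 1 \<le> x $ 1 * y $ 1"
    using assms by (intro power2_le_imp_le[of "x \<circ>\<^sub>L y + x $ 1 * y $ 1"]) auto
  then show ?thesis by simp
qed

text \<open>Orthogonality makes \<open>v $ 1 * y $ 1\<close> equal to the spatial product. The time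
  entry of \<open>v\<close> dominates its spatial part, so Cauchy-Schwarz forces the spatial part of
  \<open>y\<close> to dominate. Most distance inequalities below come from this
  definiteness.\<close>

lemma orthogonal_to_timelike:
  assumes "v \<circ>\<^sub>L v < 0" "v \<circ>\<^sub>L y = 0" "y \<noteq> 0"
  shows "y \<circ>\<^sub>L y > 0"
proof -
  have v1: "(v $ 1)\<^sup>2 > space_sq v" using assms(1) by (simp add: lorentz_self)
  then have v1p: "(v $ 1)\<^sup>2 > 0" using space_sq_nonneg[of v] by linarith
  have cs: "(v $ 1)\<^sup>2 * (y $ 1)\<^sup>2 \<le> space_sq v * space_sq y"
    using space_cauchy_schwarz[of v y] assms(2) by (simp add: power_mult_distrib)
  have "space_sq y \<noteq> 0"
  proof
    assume 0: "space_sq y = 0"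
    then have "(y $ 1)\<^sup>2 = 0"
      using cs v1p by (simp add: mult_le_0_iff)
    then show False using 0 assms(3) by (simp add: space_sq_eq_0_iff vec4_eq_iff)
  qed
  then have "space_sq y > 0" using space_sq_nonneg[of y] by linarith
  then have "space_sq v * space_sq y < (v $ 1)\<^sup>2 * space_sq y"
    using v1 by simp
  then have "(v $ 1)\<^sup>2 * (y $ 1)\<^sup>2 < (v $ 1)\<^sup>2 * space_sq y" using cs by linarith
  then show ?thesis using v1p by (simp add: lorentz_self)
qed

lemma orthogonal_to_lightlike:
  assumes "positive_lightlike x" "x \<circ>\<^sub>L y = 0"
  shows "y \<circ>\<^sub>L y \<ge> 0"
proof -
  have x1: "(x $ 1)\<^sup>2 = space_sq x" "(x $ 1)\<^sup>2 > 0"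
    using assms(1) by (auto simp: lorentz_self positive_lightlike_def)
  have "(x $ 1)\<^sup>2 * (y $ 1)\<^sup>2 \<le> (x $ 1)\<^sup>2 * space_sq y"
    using space_cauchy_schwarz[of x y] assms(2) x1(1) by (simp add: power_mult_distrib)
  then show ?thesis using x1(2) by (simp add: lorentz_self)
qed

lemma H3_sq: "v \<in> H3 \<Longrightarrow> v \<circ>\<^sub>L v = -1" and H3_pos: "v \<in> H3 \<Longrightarrow> v $ 1 > 0"
  by (simp_all add: H3_def)

lemma timelike_iff: "timelike v \<longleftrightarrow> v \<circ>\<^sub>L v < 0"
  by (auto simp: timelike_def lorentz_zero_left)

lemma timelike_causal_neg:
  assumes "v \<circ>\<^sub>L v < 0" "v $ 1 > 0" "y \<circ>\<^sub>L y \<le> 0" "y $ 1 > 0"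
  shows "v \<circ>\<^sub>L y < 0"
proof -
  have "v \<circ>\<^sub>L y \<le> 0" by (rule causal_lorentz_nonpos) (use assms in linarith)+
  moreover have "y \<noteq> 0" using assms(4) by auto
  then have "v \<circ>\<^sub>L y \<noteq> 0" using orthogonal_to_timelike[OF assms(1), of y] assms(3) by linarith
  ultimately show ?thesis by linarith
qed

text \<open>Places constructed vectors in the future cone without looking at coordinates: otherwise
  \<open>- z\<close> would be a future vector and would pair negatively with
  \<open>y\<close>.\<close>

lemma timelike_future:
  assumes "z \<circ>\<^sub>L z < 0" "z \<circ>\<^sub>L y < 0" "y \<circ>\<^sub>L y \<le> 0" "y $ 1 > 0"
  shows "z $ 1 > 0"
proof (rule ccontr)
  assume neg: "\<not> z $ 1 > 0"
  have "z $ 1 \<noteq> 0"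
  proof
    assume "z $ 1 = 0"
    then have "z \<circ>\<^sub>L z = space_sq z" by (simp add: lorentz_self)
    then show False using assms(1) space_sq_nonneg[of z] by linarith
  qed
  then have pos: "(- z) $ 1 > 0" using neg by simp
  have sq: "(- z) \<circ>\<^sub>L (- z) < 0" using assms(1) by (simp add: lorentz_simps)
  have "(- z) \<circ>\<^sub>L y < 0" by (rule timelike_causal_neg[OF sq pos assms(3,4)])
  then show False using assms(2) by (simp add: lorentz_simps)
qed

lemma H3_lightlike_neg: "v \<in> H3 \<Longrightarrow> positive_lightlike x \<Longrightarrow> v \<circ>\<^sub>L x < 0"
  by (rule timelike_causal_neg) (auto simp: H3_def positive_lightlike_def)

lemma H3_neg: "v \<in> H3 \<Longrightarrow> w \<in> H3 \<Longrightarrow> v \<circ>\<^sub>L w < 0"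
  by (rule timelike_causal_neg) (auto simp: H3_def)

text \<open>The reversed Cauchy-Schwarz inequality. The component of \<open>w\<close> orthogonal to
  \<open>v\<close> has square \<open>(v \<circ>\<^sub>L w)^2 - 1\<close>, which is nonnegative and
  vanishes only with the component itself.\<close>

lemma H3_le:
  assumes "v \<in> H3" "w \<in> H3"
  shows "v \<circ>\<^sub>L w \<le> -1" and "v \<circ>\<^sub>L w = -1 \<Longrightarrow> v = w"
proof -
  define y where "y = w + (v \<circ>\<^sub>L w) *\<^sub>R v"
  have o: "v \<circ>\<^sub>L y = 0" using assms
    by (simp add: y_def lorentz_simps H3_sq)
  have yy: "y \<circ>\<^sub>L y = (v \<circ>\<^sub>L w)\<^sup>2 - 1" using assms
    by (simp add: y_def lorentz_simps H3_sq lorentz_commute[of w v] power2_eq_square algebra_simps)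
  have "y \<circ>\<^sub>L y \<ge> 0"
    using orthogonal_to_timelike[OF _ o] assms
    by (cases "y = 0") (simp_all add: H3_sq lorentz_zero_left less_imp_le)
  then have "\<bar>v \<circ>\<^sub>L w\<bar> \<ge> 1" 
    using abs_le_square_iff[of 1 "v \<circ>\<^sub>L w"] by (simp add: yy)
  then show "v \<circ>\<^sub>L w \<le> -1" using H3_neg[OF assms] by linarith
  assume eq: "v \<circ>\<^sub>L w = -1"
  then have "y \<circ>\<^sub>L y = 0" using yy by simp
  then have "y = 0" using orthogonal_to_timelike[OF _ o] assms
    by (metis H3_sq less_irrefl less_minus_one_simps(1))
  then show "v = w" using eq by (simp add: y_def)
qed

lemma lightlike_neg:
  assumes "positive_lightlike x" "positive_lightlike y" "ideal_point x \<noteq> ideal_point y"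
  shows "x \<circ>\<^sub>L y < 0"
proof -
  have le: "x \<circ>\<^sub>L y \<le> 0"
    by (rule causal_lorentz_nonpos) (use assms in \<open>auto simp: positive_lightlike_def\<close>)
  moreover have "x \<circ>\<^sub>L y \<noteq> 0"
  proof
    assume 0: "x \<circ>\<^sub>L y = 0"
    define c where "c = y $ 1 / x $ 1"
    have c: "c > 0" using assms by (simp add: c_def positive_lightlike_def)
    \<comment> \<open>The factor \<open>c\<close> equalizes the first entries, so \<open>z\<close>
      is a null vector without time entry, hence zero.\<close>
    define z where "z = y - c *\<^sub>R x"
    have "z \<circ>\<^sub>L z = 0" using assms 0
      by (simp add: z_def lorentz_simps lorentz_commute[of y x] positive_lightlike_def)
    moreover have "z $ 1 = 0" using assms by (simp add: z_def c_def positive_lightlike_def)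
    ultimately have "z = 0" by (simp add: lorentz_self space_sq_eq_0_iff vec4_eq_iff)
    then have y: "y = c *\<^sub>R x" by (simp add: z_def)
    have "ideal_point x = ideal_point y"
    proof (intro set_eqI iffI)
      fix w assume "w \<in> ideal_point x"
      then obtain d where "d \<noteq> 0" "w = d *\<^sub>R x" by (auto simp: ideal_point_def)
      then show "w \<in> ideal_point y" using c y
        by (auto simp: ideal_point_def intro!: exI[of _ "d / c"])
    next
      fix w assume "w \<in> ideal_point y"
      then obtain d where "d \<noteq> 0" "w = d *\<^sub>R y" by (auto simp: ideal_point_def)
      then show "w \<in> ideal_point x" using c y
        by (auto simp: ideal_point_def intro!: exI[of _ "d * c"])
    qed
    then show False using assms by simp
  qed
  ultimately show ?thesis by linarith
qed

lemma normalize_in_H3: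
  assumes "v \<circ>\<^sub>L v < 0" "v $ 1 > 0"
  shows "(1 / sqrt (- (v \<circ>\<^sub>L v))) *\<^sub>R v \<in> H3"
proof -
  have "v \<circ>\<^sub>L v / (sqrt (- (v \<circ>\<^sub>L v)) * sqrt (- (v \<circ>\<^sub>L v))) = -1"
    using assms by (simp add: real_sqrt_mult_self[of "- (v \<circ>\<^sub>L v)", simplified])
  then show ?thesis using assms
    by (simp add: H3_def lorentz_simps field_simps)
qed

lemma timelike_scaled_in_H3:
  assumes "v \<circ>\<^sub>L v < 0"
  obtains c where "c \<noteq> 0" "c *\<^sub>R v \<in> H3"
proof (cases "v $ 1 > 0")
  case True
  have "1 / sqrt (- (v \<circ>\<^sub>L v)) \<noteq> 0" using assms by simp
  then show ?thesis using normalize_in_H3[OF assms True] that by blast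
next
  case False
  have "v $ 1 \<noteq> 0"
  proof
    assume "v $ 1 = 0"
    then have "v \<circ>\<^sub>L v = space_sq v" by (simp add: lorentz_self)
    then show False using assms space_sq_nonneg[of v] by linarith
  qed
  then have pos: "(- v) $ 1 > 0" using False by simp
  have neg: "(- v) \<circ>\<^sub>L (- v) < 0" using assms by (simp add: lorentz_simps)
  have "(- (1 / sqrt (- (v \<circ>\<^sub>L v)))) *\<^sub>R v \<in> H3"
    using normalize_in_H3[OF neg pos] by (simp add: lorentz_simps)
  moreover have "- (1 / sqrt (- (v \<circ>\<^sub>L v))) \<noteq> 0" using assms by simp
  ultimately show ?thesis using that by blast
qed

lemma timelike_future_convex:
  assumes "v \<circ>\<^sub>L v < 0" "v $ 1 > 0" "w \<circ>\<^sub>L w < 0" "w $ 1 > 0" "0 \<le> a" "0 \<le> b" "a + b > 0"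
  shows "(a *\<^sub>R v + b *\<^sub>R w) \<circ>\<^sub>L (a *\<^sub>R v + b *\<^sub>R w) < 0" "(a *\<^sub>R v + b *\<^sub>R w) $ 1 > 0"
proof -
  have vw: "v \<circ>\<^sub>L w < 0" by (rule timelike_causal_neg) (use assms in linarith)+
  have "(a *\<^sub>R v + b *\<^sub>R w) \<circ>\<^sub>L (a *\<^sub>R v + b *\<^sub>R w)
      = a\<^sup>2 * (v \<circ>\<^sub>L v) + 2 * (a * b) * (v \<circ>\<^sub>L w) + b\<^sup>2 * (w \<circ>\<^sub>L w)"
    by (simp add: lorentz_simps lorentz_commute[of w v] power2_eq_square algebra_simps)
  moreover have "a > 0 \<or> b > 0" using assms by linarith
  moreover have "a\<^sup>2 * (v \<circ>\<^sub>L v) \<le> 0" "b\<^sup>2 * (w \<circ>\<^sub>L w) \<le> 0" "(a * b) * (v \<circ>\<^sub>L w) \<le> 0"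
    "a > 0 \<Longrightarrow> a\<^sup>2 * (v \<circ>\<^sub>L v) < 0" "b > 0 \<Longrightarrow> b\<^sup>2 * (w \<circ>\<^sub>L w) < 0"
    using assms vw by (simp_all add: mult_nonneg_nonpos mult_pos_neg)
  ultimately show "(a *\<^sub>R v + b *\<^sub>R w) \<circ>\<^sub>L (a *\<^sub>R v + b *\<^sub>R w) < 0" by linarith
  show "(a *\<^sub>R v + b *\<^sub>R w) $ 1 > 0"
    using assms by (cases "a = 0") (simp_all add: add_pos_nonneg)
qed

lemma spacelike_normalize:
  assumes "n \<circ>\<^sub>L n > 0"
  obtains c where "c > 0" "(c *\<^sub>R n) \<circ>\<^sub>L (c *\<^sub>R n) = 1"
proof
  show "1 / sqrt (n \<circ>\<^sub>L n) > 0" using assms by simp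
  show "((1 / sqrt (n \<circ>\<^sub>L n)) *\<^sub>R n) \<circ>\<^sub>L ((1 / sqrt (n \<circ>\<^sub>L n)) *\<^sub>R n) = 1"
    using assms by (simp add: lorentz_simps)
qed

section \<open>Nondegeneracy and linear dependence\<close>

lemma lorentz_nondegenerate:
  assumes "\<And>y. x \<circ>\<^sub>L y = 0" shows "x = 0"
  using assms[of "time_reflect x"] by (simp add: lorentz_commute[of x] flip: inner_eq_lorentz)

lemma singular_kernel:
  fixes M :: "real^4^4"
  shows "det M = 0 \<longleftrightarrow> (\<exists>x. x \<noteq> 0 \<and> M *v x = 0)"
  using invertible_det_nz[of M] invertible_left_inverse[of M] matrix_left_invertible_ker[of M] by auto

text \<open>The matrix with these four rows annihilates the time reflection of \<open>m\<close>, so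
  its transpose is singular as well; a kernel vector of the transpose lists the coefficients of a
  relation.\<close>

lemma orthogonal_dependent:
  assumes "m \<noteq> 0" "a \<circ>\<^sub>L m = 0" "b \<circ>\<^sub>L m = 0" "c \<circ>\<^sub>L m = 0" "d \<circ>\<^sub>L m = 0"
  obtains p q r s :: real where "p *\<^sub>R a + q *\<^sub>R b + r *\<^sub>R c + s *\<^sub>R d = 0"
    "p \<noteq> 0 \<or> q \<noteq> 0 \<or> r \<noteq> 0 \<or> s \<noteq> 0"
proof -
  define M :: "real^4^4" where
    "M = (\<chi> i. if i = 1 then a else if i = 2 then b else if i = 3 then c else d)"
  have rows: "M $ 1 = a" "M $ 2 = b" "M $ 3 = c" "M $ 4 = d" by (simp_all add: M_def)
  have "M *v time_reflect m = 0"
    using assms by (simp add: vec4_eq_iff matrix_vector_mult_def sum_4 rows lorentz_def)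
  then have "det M = 0"
    using assms(1) singular_kernel time_reflect_eq_0_iff by blast
  then have "det (transpose M) = 0" by simp
  then obtain k where k: "transpose M *v k = 0" "k \<noteq> 0"
    using singular_kernel by blast
  have "k $ 1 *\<^sub>R a + k $ 2 *\<^sub>R b + k $ 3 *\<^sub>R c + k $ 4 *\<^sub>R d = 0"
    using k(1) by (simp add: vec4_eq_iff matrix_vector_mult_def transpose_def sum_4 rows algebra_simps)
  with k(2) that show ?thesis by (auto simp: vec4_eq_iff)
qed

text \<open>Completing the three rows by a zero row makes the matrix singular; a kernel vector,
  reflected in time, is Lorentz-orthogonal to all three.\<close>

lemma common_normal_exists:
  obtains m where "m \<noteq> 0" "a \<circ>\<^sub>L m = 0" "b \<circ>\<^sub>L m = 0" "c \<circ>\<^sub>L m = 0"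
proof -
  define M :: "real^4^4" where
    "M = (\<chi> i. if i = 1 then a else if i = 2 then b else if i = 3 then c else 0)"
  have rows: "M $ 1 = a" "M $ 2 = b" "M $ 3 = c" "M $ 4 = 0" by (simp_all add: M_def)
  have "det M = 0" by (rule det_zero_row(1)[of 4]) (simp add: rows row_def vec_eq_iff)
  then obtain k where k: "M *v k = 0" "k \<noteq> 0"
    using singular_kernel by blast
  show ?thesis
    using k by (intro that[of "time_reflect k"])
      (auto simp: vec4_eq_iff matrix_vector_mult_def sum_4 rows lorentz_def)
qed

section \<open>Flats\<close>

lemma flatD:
  assumes "flat k V F"
  shows "subspace V" "F = V \<inter> H3" "dim V = k + 1"
  using assms by (auto simp: flat_def)

lemma flat_has_point:
  assumes "flat k V F" obtains v where "v \<in> V" "v \<in> H3"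
proof -
  obtain v where "v \<in> V" "v \<circ>\<^sub>L v < 0" using assms by (auto simp: flat_def timelike_iff)
  then show ?thesis using timelike_scaled_in_H3[of v] that flatD(1)[OF assms] subspace_scale by metis
qed

lemma open_future: "open {v :: vec4. v \<circ>\<^sub>L v < 0 \<and> v $ 1 > 0}"
  unfolding Collect_conj_eq
  by (intro open_Int open_Collect_less continuous_intros)

lemma open_small_step:
  fixes v u :: vec4
  assumes "open S" "v \<in> S"
  obtains e where "e > 0" "v + e *\<^sub>R u \<in> S"
proof -
  have "((\<lambda>e. v + e *\<^sub>R u) \<longlongrightarrow> v + 0 *\<^sub>R u) (at_right 0)"
    by (intro tendsto_intros)
  then have "eventually (\<lambda>e. v + e *\<^sub>R u \<in> S) (at_right 0)"
    using assms by (auto simp: tendsto_def)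
  then have "eventually (\<lambda>e. e > 0 \<and> v + e *\<^sub>R u \<in> S) (at_right (0 :: real))"
    by (intro eventually_conj eventually_at_right_less) auto
  then show ?thesis using that eventually_happens[of _ "at_right (0::real)"] by auto
qed

text \<open>Every direction \<open>u\<close> of \<open>V\<close> is reached from points of
  \<open>F\<close>: for a point \<open>v\<close> of \<open>F\<close> and small \<open>e\<close>, the
  vector \<open>v + e *\<^sub>R u\<close> is still time-like and rescales into \<open>H3\<close>.
  Hence the witnesses of the existential quantifiers in the definitions are unique.\<close>

lemma flat_eq_span:
  assumes "flat k V F" shows "V = span F"
proof
  note V = flatD[OF assms]
  obtain v where v: "v \<in> V" "v \<in> H3" using flat_has_point[OF assms] .
  show "V \<subseteq> span F"
  proof
    fix u assume u: "u \<in> V"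
    obtain e where e: "e > 0" "v + e *\<^sub>R u \<in> {v. v \<circ>\<^sub>L v < 0 \<and> v $ 1 > 0}"
      using open_small_step[OF open_future, of v u] v(2) by (auto simp: H3_def)
    then obtain c where c: "c \<noteq> 0" "c *\<^sub>R (v + e *\<^sub>R u) \<in> H3"
      using timelike_scaled_in_H3 by blast
    have "c *\<^sub>R (v + e *\<^sub>R u) \<in> V"
      using V(1) u v(1) by (intro subspace_scale subspace_add)
    then have "c *\<^sub>R (v + e *\<^sub>R u) \<in> span F" using c(2) V(2) by (auto intro: span_base)
    then have "(1 / c) *\<^sub>R (c *\<^sub>R (v + e *\<^sub>R u)) \<in> span F" by (rule span_scale)
    then have 1: "v + e *\<^sub>R u \<in> span F" using c(1) by simp
    have "v \<in> span F" using v V(2) by (auto intro: span_base)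
    then have "(1 / e) *\<^sub>R ((v + e *\<^sub>R u) - v) \<in> span F" using 1 by (intro span_scale span_diff)
    then show "u \<in> span F" using e(1) by simp
  qed
  show "span F \<subseteq> V" using V by (intro span_minimal) auto
qed

lemma flat_unique:
  assumes "flat k V F" "flat k' V' F" shows "V' = V"
  using assms flat_eq_span by metis

lemma ideal_boundary_flat:
  assumes "flat k V F"
  shows "ideal_boundary F = {x. positive_lightlike x \<and> x \<in> V}"
  unfolding ideal_boundary_def using assms flat_unique[OF assms] by blast

section \<open>Hyperplanes and their Lorentz normals\<close>

definition perp :: "vec4 \<Rightarrow> vec4 set" where
  "perp n = {v. n \<circ>\<^sub>L v = 0}"

abbreviation plane :: "vec4 \<Rightarrow> vec4 set" where
  "plane n \<equiv> perp n \<inter> H3"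

lemma subspace_perp [simp]: "subspace (perp n)"
  by (auto simp: subspace_def perp_def lorentz_simps)

lemma flatI:
  assumes "subspace V" "dim V = k + 1" "v \<in> V" "v \<circ>\<^sub>L v < 0"
  shows "flat k V (V \<inter> H3)"
  using assms by (auto simp: flat_def timelike_iff)

text \<open>Projection along a space-like \<open>n\<close> subtracts
  \<open>(n \<circ>\<^sub>L v)^2 / (n \<circ>\<^sub>L n)\<close> from the square, so a time-like
  vector stays time-like.\<close>

lemma timelike_project:
  assumes "n \<circ>\<^sub>L n > 0" "v \<circ>\<^sub>L v < 0" "z = v - ((n \<circ>\<^sub>L v) / (n \<circ>\<^sub>L n)) *\<^sub>R n"
  shows "n \<circ>\<^sub>L z = 0" "z \<circ>\<^sub>L z < 0"
proof -
  show "n \<circ>\<^sub>L z = 0" using assms(1) by (simp add: assms(3) lorentz_simps)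
  have "z \<circ>\<^sub>L z = v \<circ>\<^sub>L v - (n \<circ>\<^sub>L v)\<^sup>2 / (n \<circ>\<^sub>L n)"
    using assms(1) by (simp add: assms(3) lorentz_simps lorentz_commute[of v n] power2_eq_square field_simps)
  moreover have "(n \<circ>\<^sub>L v)\<^sup>2 / (n \<circ>\<^sub>L n) \<ge> 0" using assms(1) by simp
  ultimately show "z \<circ>\<^sub>L z < 0" using assms(2) by linarith
qed

lemma Lorentzian_point_on_hyperplane:
  assumes "flat k V F" "n \<in> V" "n \<circ>\<^sub>L n > 0"
  obtains v where "v \<in> V" "v \<in> H3" "n \<circ>\<^sub>L v = 0"
proof -
  obtain v where v: "v \<in> V" "v \<circ>\<^sub>L v < 0" using assms by (auto simp: flat_def timelike_iff)
  define z where "z = v - ((n \<circ>\<^sub>L v) / (n \<circ>\<^sub>L n)) *\<^sub>R n"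
  have z: "n \<circ>\<^sub>L z = 0" "z \<circ>\<^sub>L z < 0" using timelike_project[OF assms(3) v(2) z_def] .
  obtain c where "c *\<^sub>R z \<in> H3" using timelike_scaled_in_H3[OF z(2)] by blast
  moreover have "c *\<^sub>R z \<in> V"
    unfolding z_def using flatD(1)[OF assms(1)] v(1) assms(2) by (intro subspace_scale subspace_diff)
  ultimately show ?thesis using that z(1) by (simp add: lorentz_simps)
qed

lemma axis1_timelike: "axis 1 1 \<circ>\<^sub>L axis 1 (1 :: real) < 0"
  by (simp add: lorentz_def axis_def)

lemma flat_perp:
  assumes "n \<circ>\<^sub>L n > 0"
  shows "flat 2 (perp n) (plane n)"
proof -
  have "time_reflect n \<noteq> 0" using assms by (auto simp: lorentz_zero_left)
  then have "dim {x. time_reflect n \<bullet> x = 0} = DIM(vec4) - 1" by (rule dim_hyperplane)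
  then have "dim (perp n) = 2 + 1" by (simp add: perp_def lorentz_eq_inner)
  moreover obtain v where "n \<circ>\<^sub>L v = 0" "v \<circ>\<^sub>L v < 0"
    using timelike_project[OF assms axis1_timelike] by blast
  then have "v \<in> perp n" "v \<circ>\<^sub>L v < 0" by (simp_all add: perp_def)
  ultimately show ?thesis by (intro flatI) auto
qed

text \<open>The Euclidean normal of the hyperplane, reflected in time, is a Lorentz normal. It is
  space-like because it is orthogonal to a time-like vector of \<open>W\<close>, and can thus be
  normalized.\<close>

lemma plane_normal:
  assumes "flat 2 W P"
  obtains n where "n \<circ>\<^sub>L n = 1" "W = perp n"
proof -
  have "dim W = DIM(vec4) - 1" using flatD(3)[OF assms] by simp
  then obtain a where a: "a \<noteq> 0" "span W = {x. a \<bullet> x = 0}" using dim_eq_hyperplane by blast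
  define m where "m = time_reflect a"
  have W: "W = perp m"
    using a(2) span_eq_iff[of W] flatD(1)[OF assms] by (simp add: m_def perp_def inner_eq_lorentz)
  have "m \<noteq> 0" using a(1) by (simp add: m_def)
  obtain v where "v \<in> W" "v \<circ>\<^sub>L v < 0" using assms by (auto simp: flat_def timelike_iff)
  then have "m \<circ>\<^sub>L m > 0"
    using orthogonal_to_timelike[of v m] \<open>m \<noteq> 0\<close> W by (simp add: perp_def lorentz_commute[of v m])
  then obtain c where c: "c > 0" "(c *\<^sub>R m) \<circ>\<^sub>L (c *\<^sub>R m) = 1" by (rule spacelike_normalize)
  moreover have "W = perp (c *\<^sub>R m)" using c(1) W by (auto simp: perp_def lorentz_simps)
  ultimately show ?thesis using that by blast
qed

lemma is_plane_iff: "is_plane P \<longleftrightarrow> (\<exists>n. n \<circ>\<^sub>L n = 1 \<and> P = plane n)"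
proof
  assume "is_plane P"
  then obtain W where W: "flat 2 W P" by (auto simp: is_plane_def)
  then show "\<exists>n. n \<circ>\<^sub>L n = 1 \<and> P = plane n" using plane_normal[OF W] flatD(2)[OF W] by metis
next
  assume "\<exists>n. n \<circ>\<^sub>L n = 1 \<and> P = plane n"
  then show "is_plane P" using flat_perp by (force simp: is_plane_def)
qed

lemma ideal_boundary_plane:
  "n \<circ>\<^sub>L n > 0 \<Longrightarrow> ideal_boundary (plane n) = {x. positive_lightlike x \<and> n \<circ>\<^sub>L x = 0}"
  using ideal_boundary_flat[OF flat_perp] by (auto simp: perp_def)

text \<open>The double complement of a non-isotropic line is the line: the residue \<open>z\<close>
  is orthogonal both to \<open>n\<close> and to the complement of \<open>n\<close>, which together
  span everything.\<close>

lemma perp_perp: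
  assumes "n \<circ>\<^sub>L n \<noteq> 0" "\<And>v. n \<circ>\<^sub>L v = 0 \<Longrightarrow> u \<circ>\<^sub>L v = 0"
  shows "u = ((u \<circ>\<^sub>L n) / (n \<circ>\<^sub>L n)) *\<^sub>R n"
proof -
  define z where "z = u - ((u \<circ>\<^sub>L n) / (n \<circ>\<^sub>L n)) *\<^sub>R n"
  have zn: "z \<circ>\<^sub>L n = 0" using assms(1) by (simp add: z_def lorentz_simps)
  have "z \<circ>\<^sub>L y = 0" for y
  proof -
    define y' where "y' = y - ((n \<circ>\<^sub>L y) / (n \<circ>\<^sub>L n)) *\<^sub>R n"
    have "n \<circ>\<^sub>L y' = 0" using assms(1) by (simp add: y'_def lorentz_simps)
    then have "z \<circ>\<^sub>L y' = 0" using assms(2)[of y'] by (simp add: z_def lorentz_simps)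
    then show ?thesis using zn by (simp add: y'_def lorentz_simps)
  qed
  then have "z = 0" by (rule lorentz_nondegenerate)
  then show ?thesis by (simp add: z_def)
qed

lemma timelike_orthogonal_to_two:
  assumes "n \<circ>\<^sub>L n = 1" "m \<circ>\<^sub>L m = 1" "\<bar>n \<circ>\<^sub>L m\<bar> < 1"
  obtains v where "v \<in> H3" "n \<circ>\<^sub>L v = 0" "m \<circ>\<^sub>L v = 0"
proof -
  \<comment> \<open>Gram-Schmidt. The bound on \<open>n \<circ>\<^sub>L m\<close> makes
    \<open>k\<close> space-like, so a time-like vector survives the projections along
    \<open>n\<close> and then along \<open>k\<close>.\<close>
  define k where "k = m - (n \<circ>\<^sub>L m) *\<^sub>R n"
  have nk: "n \<circ>\<^sub>L k = 0" by (simp add: k_def lorentz_simps assms(1))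
  have "k \<circ>\<^sub>L k = 1 - (n \<circ>\<^sub>L m)\<^sup>2"
    by (simp add: k_def lorentz_simps assms(1,2) lorentz_commute[of m n] power2_eq_square)
  then have kk: "k \<circ>\<^sub>L k > 0" using assms(3) by (simp add: abs_square_less_1)
  obtain w where w: "n \<circ>\<^sub>L w = 0" "w \<circ>\<^sub>L w < 0"
    using timelike_project[OF _ axis1_timelike refl, of n] assms(1) zero_less_one by metis
  define v where "v = w - ((k \<circ>\<^sub>L w) / (k \<circ>\<^sub>L k)) *\<^sub>R k"
  have v: "k \<circ>\<^sub>L v = 0" "v \<circ>\<^sub>L v < 0" using timelike_project[OF kk w(2) v_def] .
  have nv: "n \<circ>\<^sub>L v = 0" by (simp add: v_def lorentz_simps w nk)
  then have mv: "m \<circ>\<^sub>L v = 0" using v(1) by (simp add: k_def lorentz_simps)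
  obtain c where "c *\<^sub>R v \<in> H3" using timelike_scaled_in_H3[OF v(2)] by blast
  then show ?thesis using nv mv that[of "c *\<^sub>R v"] by (simp add: lorentz_simps)
qed

lemma orthogonal_planes_iff:
  assumes n: "n \<circ>\<^sub>L n = 1" and m: "m \<circ>\<^sub>L m = 1"
  shows "orthogonal_planes (plane n) (plane m) \<longleftrightarrow> n \<circ>\<^sub>L m = 0"
proof
  have fl: "flat 2 (perp n) (plane n)" "flat 2 (perp m) (plane m)"
    using assms by (auto intro!: flat_perp)
  {
    assume "orthogonal_planes (plane n) (plane m)"
    then obtain V W where VW: "flat 2 V (plane n)" "flat 2 W (plane m)"
      "\<forall>n m. (\<forall>v\<in>V. n \<circ>\<^sub>L v = 0) \<and> (\<forall>w\<in>W. m \<circ>\<^sub>L w = 0) \<longrightarrow> n \<circ>\<^sub>L m = 0"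
      unfolding orthogonal_planes_def by blast
    have "V = perp n" "W = perp m"
      using flat_unique[OF fl(1) VW(1)] flat_unique[OF fl(2) VW(2)] by simp_all
    then show "n \<circ>\<^sub>L m = 0" using VW(3)[rule_format, of n m] by (simp add: perp_def)
  next
    assume 0: "n \<circ>\<^sub>L m = 0"
    obtain v where "v \<in> H3" "n \<circ>\<^sub>L v = 0" "m \<circ>\<^sub>L v = 0"
      using timelike_orthogonal_to_two[OF assms] 0 by auto
    then have ne: "plane n \<inter> (plane m) \<noteq> {}" by (auto simp: perp_def)
    have "n' \<circ>\<^sub>L m' = 0" if "\<forall>v\<in>perp n. n' \<circ>\<^sub>L v = 0" "\<forall>w\<in>perp m. m' \<circ>\<^sub>L w = 0" for n' m'
    proof -
      have "\<exists>c. n' = c *\<^sub>R n"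
        by (rule exI, rule perp_perp) (use that n in \<open>auto simp: perp_def\<close>)
      moreover have "\<exists>d. m' = d *\<^sub>R m"
        by (rule exI, rule perp_perp) (use that m in \<open>auto simp: perp_def\<close>)
      ultimately show ?thesis using 0 by (auto simp: lorentz_simps)
    qed
    then show "orthogonal_planes (plane n) (plane m)"
      unfolding orthogonal_planes_def using fl ne by blast
  }
qed

section \<open>Geodesics as Lorentzian planes spanned by two vectors\<close>

lemma span_2: "span {a, b} = {x. \<exists>\<alpha> \<beta>. x = \<alpha> *\<^sub>R a + \<beta> *\<^sub>R (b :: vec4)}"
  by (auto simp: span_insert span_singleton algebra_simps)

text \<open>The hypothesis says that the Gram matrix of \<open>a\<close> and \<open>b\<close> is indefinite, so that they span
  a Lorentzian plane.\<close>

lemma flat_span_2: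
  assumes "(a \<circ>\<^sub>L a) * (b \<circ>\<^sub>L b) < (a \<circ>\<^sub>L b)\<^sup>2"
  shows "flat 1 (span {a, b}) (span {a, b} \<inter> H3)"
    and "flat 1 V L \<Longrightarrow> a \<in> V \<Longrightarrow> b \<in> V \<Longrightarrow> L = span {a, b} \<inter> H3"
proof -
  have "a \<notin> span {b}"
  proof
    assume "a \<in> span {b}"
    then obtain k where "a = k *\<^sub>R b" by (auto simp: span_singleton)
    then show False using assms by (simp add: lorentz_simps power2_eq_square)
  qed
  moreover have "b \<noteq> 0" using assms by (auto simp: lorentz_simps)
  ultimately have "independent {a, b}" "a \<noteq> b"
    by (auto simp: independent_insert span_base)
  then have dim: "dim (span {a, b}) = 1 + 1"
    by (simp add: dim_span dim_eq_card_independent)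
  have "\<exists>v\<in>span {a, b}. v \<circ>\<^sub>L v < 0"
  proof (cases "a \<circ>\<^sub>L a" "0 :: real" rule: linorder_cases)
    case less
    then show ?thesis by (auto intro: span_base)
  next
    case equal
    then have ab: "a \<circ>\<^sub>L b \<noteq> 0" using assms by auto
    \<comment> \<open>With \<open>a\<close> isotropic the square of \<open>t *\<^sub>R a + b\<close>
      is linear in \<open>t\<close>; this \<open>t\<close> makes it equal to -1.\<close>
    define t where "t = - (b \<circ>\<^sub>L b + 1) / (2 * (a \<circ>\<^sub>L b))"
    have "(t *\<^sub>R a + 1 *\<^sub>R b) \<circ>\<^sub>L (t *\<^sub>R a + 1 *\<^sub>R b) = 2 * t * (a \<circ>\<^sub>L b) + b \<circ>\<^sub>L b"
      using equal by (simp add: lorentz_simps lorentz_commute[of b a])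
    also have "\<dots> = - 1" using ab by (simp add: t_def field_simps)
    finally have "(t *\<^sub>R a + 1 *\<^sub>R b) \<circ>\<^sub>L (t *\<^sub>R a + 1 *\<^sub>R b) < 0" by simp
    then show ?thesis using span_2 by blast
  next
    case greater
    \<comment> \<open>This gives the component of \<open>b\<close> orthogonal to \<open>a\<close>;
      its square times \<open>a \<circ>\<^sub>L a\<close> is the Gram determinant.\<close>
    define t where "t = - (a \<circ>\<^sub>L b) / (a \<circ>\<^sub>L a)"
    have "(a \<circ>\<^sub>L a) * ((t *\<^sub>R a + 1 *\<^sub>R b) \<circ>\<^sub>L (t *\<^sub>R a + 1 *\<^sub>R b)) = (a \<circ>\<^sub>L a) * (b \<circ>\<^sub>L b) - (a \<circ>\<^sub>L b)\<^sup>2"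
      using greater by (simp add: lorentz_simps lorentz_commute[of b a] t_def power2_eq_square field_simps)
    also have "\<dots> < 0" using assms by simp
    finally have "(t *\<^sub>R a + 1 *\<^sub>R b) \<circ>\<^sub>L (t *\<^sub>R a + 1 *\<^sub>R b) < 0" using greater by (simp add: mult_less_0_iff)
    then show ?thesis using span_2 by blast
  qed
  then show "flat 1 (span {a, b}) (span {a, b} \<inter> H3)" using dim by (auto intro: flatI)
  assume V: "flat 1 V L" "a \<in> V" "b \<in> V"
  have "span {a, b} = V"
  proof (rule subspace_dim_equal)
    show "span {a, b} \<subseteq> V" using V flatD(1)[OF V(1)] by (intro span_minimal) auto
    show "dim V \<le> dim (span {a, b})" using flatD(3)[OF V(1)] dim by simp
  qed (use flatD(1)[OF V(1)] in auto)
  then show "L = span {a, b} \<inter> H3" using flatD(2)[OF V(1)] by simp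
qed

text \<open>The tangent direction of the line at the meeting point \<open>p\<close> is orthogonal to
  the tangent plane and to \<open>p\<close>, hence to all of \<open>perp n\<close>, hence
  proportional to \<open>n\<close>. Conversely \<open>n\<close> and a foot point span
  \<open>V\<close>. Perpendicularity thus takes the same form as having an ideal endpoint: a given
  vector lies in \<open>V\<close>.\<close>

lemma perp_to_plane_iff:
  assumes n: "n \<circ>\<^sub>L n = 1" and V: "flat 1 V L"
  shows "perp_to_plane L (plane n) \<longleftrightarrow> n \<in> V"
proof
  note sV = flatD[OF V]
  have fl: "flat 2 (perp n) (plane n)" using n by (intro flat_perp) simp
  assume "perp_to_plane L (plane n)"
  then obtain V' W p where VW: "flat 1 V' L" "flat 2 W (plane n)" "p \<in> L \<inter> (plane n)"
    "\<forall>v\<in>V'. \<forall>w\<in>W. v \<circ>\<^sub>L p = 0 \<and> w \<circ>\<^sub>L p = 0 \<longrightarrow> v \<circ>\<^sub>L w = 0"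
    unfolding perp_to_plane_def by blast
  then have eq: "V' = V" "W = perp n"
    using flat_unique[OF V VW(1)] flat_unique[OF fl VW(2)] by simp_all
  have p: "p \<in> V" "p \<circ>\<^sub>L p = -1" "n \<circ>\<^sub>L p = 0"
    using VW(3) sV(2) by (auto simp: H3_sq perp_def)
  have "\<not> V \<subseteq> span {p}"
  proof
    assume "V \<subseteq> span {p}"
    then have "dim V \<le> card {p}" using dim_le_card[of V "{p}"] by simp
    then show False using sV(3) by simp
  qed
  then obtain v where v: "v \<in> V" "v \<notin> span {p}" by blast
  \<comment> \<open>The part of \<open>v\<close> tangent at \<open>p\<close>; the sign is a plus
    because \<open>p \<circ>\<^sub>L p = -1\<close>.\<close>
  define u where "u = v + (v \<circ>\<^sub>L p) *\<^sub>R p"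
  have up: "u \<circ>\<^sub>L p = 0" using p by (simp add: u_def lorentz_simps)
  have uV: "u \<in> V" unfolding u_def using v p sV(1) by (intro subspace_add subspace_scale)
  have "u \<noteq> 0"
  proof
    assume "u = 0"
    then have "v = (- (v \<circ>\<^sub>L p)) *\<^sub>R p" by (simp add: u_def eq_neg_iff_add_eq_0)
    then show False using v(2) by (metis span_base span_scale singletonI)
  qed
  have "u \<circ>\<^sub>L w = 0" if "n \<circ>\<^sub>L w = 0" for w
  proof -
    define w' where "w' = w + (w \<circ>\<^sub>L p) *\<^sub>R p"
    have "w' \<circ>\<^sub>L p = 0" "w' \<in> perp n" using p that by (auto simp: w'_def lorentz_simps perp_def)
    then have "u \<circ>\<^sub>L w' = 0" using VW(4) eq uV up by blast
    then show ?thesis using up by (simp add: w'_def lorentz_simps)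
  qed
  then have "u = ((u \<circ>\<^sub>L n) / (n \<circ>\<^sub>L n)) *\<^sub>R n" by (intro perp_perp) (use n in auto)
  then obtain c where un: "u = c *\<^sub>R n" by blast
  then have "c \<noteq> 0" using \<open>u \<noteq> 0\<close> by auto
  moreover have "(1 / c) *\<^sub>R u \<in> V" using uV sV(1) by (intro subspace_scale)
  ultimately show "n \<in> V" by (simp add: un)
next
  note sV = flatD[OF V]
  have fl: "flat 2 (perp n) (plane n)" using n by (intro flat_perp) simp
  assume nV: "n \<in> V"
  obtain p where p': "p \<in> V" "p \<in> H3" "n \<circ>\<^sub>L p = 0"
    by (rule Lorentzian_point_on_hyperplane[OF V nV]) (use n in auto)
  note pV = p'(1) and p = p'(2,3) H3_sq[OF p'(2)]
  have "L = span {p, n} \<inter> H3"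
    by (rule flat_span_2(2)[OF _ V pV nV]) (use p n in \<open>auto simp: lorentz_commute\<close>)
  moreover have "flat 1 (span {p, n}) (span {p, n} \<inter> H3)"
    by (rule flat_span_2(1)) (use p n in \<open>auto simp: lorentz_commute\<close>)
  ultimately have Vs: "V = span {p, n}" using flat_unique V by metis
  have "v \<circ>\<^sub>L w = 0" if vw: "v \<in> V" "w \<in> perp n" "v \<circ>\<^sub>L p = 0" for v w
  proof -
    obtain \<alpha> \<beta> where "v = \<alpha> *\<^sub>R p + \<beta> *\<^sub>R n" using vw(1) by (auto simp: Vs span_2)
    then show ?thesis using vw p by (simp add: lorentz_simps perp_def)
  qed
  moreover have "p \<in> L \<inter> (plane n)" using p pV sV(2) by (auto simp: perp_def)
  ultimately show "perp_to_plane L (plane n)"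
    unfolding perp_to_plane_def using V fl by blast
qed

text \<open>Two independent vectors in a two-dimensional \<open>V\<close> determine it. The
  predicates \<open>A\<close> and \<open>B\<close> stand for perpendicularity to a plane or for an
  ideal endpoint, so that one proof serves the three kinds of joining lines.\<close>

lemma geodesic_through_two:
  assumes "(a \<circ>\<^sub>L a) * (b \<circ>\<^sub>L b) < (a \<circ>\<^sub>L b)\<^sup>2"
    and "\<And>V L. flat 1 V L \<Longrightarrow> A L \<longleftrightarrow> a \<in> V" "\<And>V L. flat 1 V L \<Longrightarrow> B L \<longleftrightarrow> b \<in> V"
  shows "(THE L. is_geodesic L \<and> A L \<and> B L) = span {a, b} \<inter> H3"
proof (rule the_equality)
  have "a \<in> span {a, b}" "b \<in> span {a, b}" by (auto intro: span_base)
  then show "is_geodesic (span {a, b} \<inter> H3) \<and> A (span {a, b} \<inter> H3) \<and> B (span {a, b} \<inter> H3)"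
    using flat_span_2(1)[OF assms(1)] assms(2,3) unfolding is_geodesic_def by blast
  fix L assume L: "is_geodesic L \<and> A L \<and> B L"
  then obtain V where V: "flat 1 V L" by (auto simp: is_geodesic_def)
  then show "L = span {a, b} \<inter> H3" using flat_span_2(2)[OF assms(1) V] assms(2,3)[OF V] L by blast
qed

lemma common_perp_eq:
  assumes "n \<circ>\<^sub>L n = 1" "m \<circ>\<^sub>L m = 1" "1 < (n \<circ>\<^sub>L m)\<^sup>2"
  shows "common_perp (plane n) (plane m) = span {n, m} \<inter> H3"
  unfolding common_perp_def
  by (rule geodesic_through_two) (use assms perp_to_plane_iff in auto)

lemma perp_toward_eq:
  assumes "n \<circ>\<^sub>L n = 1" "positive_lightlike x" "n \<circ>\<^sub>L x \<noteq> 0"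
  shows "perp_toward (plane n) x = span {n, x} \<inter> H3"
  unfolding perp_toward_def
  by (rule geodesic_through_two)
    (use assms perp_to_plane_iff ideal_boundary_flat in \<open>auto simp: positive_lightlike_def\<close>)

lemma geodesic_joining_eq:
  assumes "positive_lightlike x" "positive_lightlike y" "x \<circ>\<^sub>L y \<noteq> 0"
  shows "geodesic_joining x y = span {x, y} \<inter> H3"
  unfolding geodesic_joining_def
  by (rule geodesic_through_two)
    (use assms ideal_boundary_flat in \<open>auto simp: positive_lightlike_def\<close>)

section \<open>Half-spaces and half-planes\<close>

lemma connected_same_sign:
  fixes f :: "'a::topological_space \<Rightarrow> real"
  assumes "connected D" "continuous_on UNIV f" "\<And>x. x \<in> D \<Longrightarrow> f x \<noteq> 0" "x \<in> D" "f x > 0" "y \<in> D"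
  shows "f y > 0"
proof (rule ccontr)
  assume "\<not> f y > 0"
  then have "f y < 0" using assms(3)[OF assms(6)] by linarith
  moreover have "open {x. f x > 0}" "open {x. f x < 0}"
    using assms(2) by (auto intro!: open_Collect_less continuous_on_const)
  moreover have "D \<subseteq> {x. f x > 0} \<union> {x. f x < 0}" using assms(3) by force
  ultimately show False
    using connectedD[OF assms(1), of "{x. f x > 0}" "{x. f x < 0}"] assms(4,5,6) by force
qed

text \<open>A connected set avoiding the zeros of \<open>f\<close> lies on one side, so the two
  sides, being connected, are maximal.\<close>

lemma components_cut:
  fixes f :: "'a::topological_space \<Rightarrow> real" and S :: "'a set"
  defines "A \<equiv> {x \<in> S. f x > 0}" and "B \<equiv> {x \<in> S. f x < 0}"
  assumes "connected A" "connected B" "A \<noteq> {}" "B \<noteq> {}" "continuous_on UNIV f"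
  shows "components {x \<in> S. f x \<noteq> 0} = {A, B}"
proof -
  have sub: "D \<subseteq> A \<or> D \<subseteq> B" if D: "connected D" "D \<subseteq> {x \<in> S. f x \<noteq> 0}" for D
  proof (cases "\<exists>x\<in>D. f x > 0")
    case True
    then show ?thesis using connected_same_sign[OF D(1) assms(7)] D(2) unfolding A_def by blast
  next
    case False
    then show ?thesis using D(2) unfolding B_def by force
  qed
  have AB: "A \<subseteq> {x \<in> S. f x \<noteq> 0}" "B \<subseteq> {x \<in> S. f x \<noteq> 0}" "A \<inter> B = {}"
    by (auto simp: A_def B_def)
  have A: "A \<in> components {x \<in> S. f x \<noteq> 0}"
    unfolding in_components_maximal
  proof (intro conjI allI impI)
    fix D assume D: "D \<noteq> {} \<and> A \<subseteq> D \<and> D \<subseteq> {x \<in> S. f x \<noteq> 0} \<and> connected D"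
    have "\<not> D \<subseteq> B" using D AB(3) assms(5) by blast
    then have "D \<subseteq> A" using sub[of D] D by blast
    then show "D = A" using D by blast
  qed (use AB assms in auto)
  have B: "B \<in> components {x \<in> S. f x \<noteq> 0}"
    unfolding in_components_maximal
  proof (intro conjI allI impI)
    fix D assume D: "D \<noteq> {} \<and> B \<subseteq> D \<and> D \<subseteq> {x \<in> S. f x \<noteq> 0} \<and> connected D"
    have "\<not> D \<subseteq> A" using D AB(3) assms(6) by blast
    then have "D \<subseteq> B" using sub[of D] D by blast
    then show "D = B" using D by blast
  qed (use AB assms in auto)
  have "C = A \<or> C = B" if C: "C \<in> components {x \<in> S. f x \<noteq> 0}" for C
  proof -
    have "C \<subseteq> A \<or> C \<subseteq> B" "C \<noteq> {}"
      using sub[of C] C by (auto simp: in_components_maximal)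
    then have "C \<inter> A \<noteq> {} \<or> C \<inter> B \<noteq> {}" by blast
    then show ?thesis using components_eq[OF C A] components_eq[OF C B] by blast
  qed
  with A B show ?thesis by blast
qed

lemma H3_first_ge_1: "v \<in> H3 \<Longrightarrow> v $ 1 \<ge> 1"
proof -
  assume v: "v \<in> H3"
  then have "space_sq v - (v $ 1)\<^sup>2 = -1" by (simp add: H3_def lorentz_self)
  then have "(v $ 1)\<^sup>2 \<ge> 1\<^sup>2" using space_sq_nonneg[of v] unfolding one_power2 by linarith
  then show ?thesis using H3_pos[OF v] by (intro power2_le_imp_le[of 1]) auto
qed

lemma closed_H3: "closed H3"
proof -
  have eq: "H3 = {v. v $ 1 \<ge> 1} \<inter> {v. v \<circ>\<^sub>L v = -1}"
  proof (intro set_eqI iffI)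
    fix v assume "v \<in> H3"
    then show "v \<in> {v. v $ 1 \<ge> 1} \<inter> {v. v \<circ>\<^sub>L v = -1}" using H3_first_ge_1[of v] H3_sq[of v] by simp
  qed (simp add: H3_def)
  show ?thesis
    unfolding eq by (intro closed_Int closed_Collect_le closed_Collect_eq continuous_intros)
qed

abbreviation open_half :: "vec4 set \<Rightarrow> vec4 \<Rightarrow> vec4 set" where
  "open_half V n \<equiv> {v \<in> V \<inter> H3. 0 < n \<circ>\<^sub>L v}"

text \<open>The time-like cone over this set is convex, and radial normalization maps it
  continuously onto the set.\<close>

lemma connected_cone_section:
  assumes "subspace V"
  shows "connected (open_half V n)"
proof -
  define C where "C = {v \<in> V. v \<circ>\<^sub>L v < 0 \<and> v $ 1 > 0 \<and> n \<circ>\<^sub>L v > 0}"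
  define g :: "vec4 \<Rightarrow> vec4" where "g = (\<lambda>v. (1 / sqrt (- (v \<circ>\<^sub>L v))) *\<^sub>R v)"
  have "convex C"
  proof (rule convexI)
    fix v w :: vec4 and a b :: real
    assume vw: "v \<in> C" "w \<in> C" and ab: "0 \<le> a" "0 \<le> b" "a + b = 1"
    have "a *\<^sub>R v + b *\<^sub>R w \<in> V"
      using vw assms by (auto simp: C_def intro!: subspace_add subspace_scale)
    moreover have "n \<circ>\<^sub>L (a *\<^sub>R v + b *\<^sub>R w) > 0"
    proof (cases "a = 0")
      case True then show ?thesis using vw ab by (simp add: C_def lorentz_simps)
    next
      case False
      then show ?thesis using vw ab by (simp add: C_def lorentz_simps add_pos_nonneg)
    qed
    ultimately show "a *\<^sub>R v + b *\<^sub>R w \<in> C"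
      using timelike_future_convex[of v w a b] vw ab by (simp add: C_def)
  qed
  then have "connected C" by (rule convex_connected)
  moreover have "continuous_on C g"
    unfolding g_def by (intro continuous_intros) (auto simp: C_def)
  ultimately have "connected (g ` C)" by (rule connected_continuous_image[rotated])
  moreover have "g ` C = open_half V n"
  proof
    show "g ` C \<subseteq> open_half V n"
    proof safe
      fix v assume v: "v \<in> C"
      then show "g v \<in> V" "g v \<in> H3" "n \<circ>\<^sub>L g v > 0"
        using normalize_in_H3[of v] assms by (auto simp: g_def C_def lorentz_simps intro: subspace_scale)
    qed
    show "open_half V n \<subseteq> g ` C"
    proof
      fix v assume v: "v \<in> open_half V n"
      then have "v = g v" "v \<in> C" by (auto simp: g_def C_def H3_def)
      then show "v \<in> g ` C" by blast
    qed
  qed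
  ultimately show ?thesis by simp
qed

text \<open>Points of the geodesic leaving the hyperplane \<open>perp n\<close> orthogonally at \<open>v\<close>.\<close>

definition push :: "vec4 \<Rightarrow> vec4 \<Rightarrow> real \<Rightarrow> vec4" where
  "push n v t = sqrt (1 + t\<^sup>2 * (n \<circ>\<^sub>L n)) *\<^sub>R v + t *\<^sub>R n"

lemma push:
  assumes "v \<in> H3" "n \<circ>\<^sub>L v = 0" "n \<circ>\<^sub>L n > 0"
  shows "push n v t \<in> H3" "n \<circ>\<^sub>L push n v t = t * (n \<circ>\<^sub>L n)"
    and "subspace V \<Longrightarrow> v \<in> V \<Longrightarrow> n \<in> V \<Longrightarrow> push n v t \<in> V"
    and "(push n v \<longlongrightarrow> v) (at 0 within T)"
proof -
  define r where "r = sqrt (1 + t\<^sup>2 * (n \<circ>\<^sub>L n))"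
  define w where "w = push n v t"
  have w: "w = r *\<^sub>R v + t *\<^sub>R n" by (simp add: w_def push_def r_def)
  have pos: "1 + t\<^sup>2 * (n \<circ>\<^sub>L n) > 0" using assms(3) by (simp add: add_pos_nonneg)
  have r: "r > 0" "r * r = 1 + t\<^sup>2 * (n \<circ>\<^sub>L n)" using pos by (simp_all add: r_def)
  have vn: "v \<circ>\<^sub>L n = 0" using assms(2) by (simp add: lorentz_commute)
  have "w \<circ>\<^sub>L w = - (r * r) + t\<^sup>2 * (n \<circ>\<^sub>L n)"
    unfolding w by (simp add: lorentz_simps assms(2) vn H3_sq[OF assms(1)] power2_eq_square)
  then have ww: "w \<circ>\<^sub>L w = -1" using r by simp
  have wv: "w \<circ>\<^sub>L v = - r"
    unfolding w by (simp add: lorentz_simps assms(2) H3_sq[OF assms(1)])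
  have "w $ 1 > 0"
    by (rule timelike_future[of w v]) (use ww wv r assms(1) in \<open>auto simp: H3_def\<close>)
  then show "push n v t \<in> H3" using ww by (simp add: H3_def flip: w_def)
  show "n \<circ>\<^sub>L push n v t = t * (n \<circ>\<^sub>L n)" by (simp add: push_def lorentz_simps assms(2))
  show "subspace V \<Longrightarrow> v \<in> V \<Longrightarrow> n \<in> V \<Longrightarrow> push n v t \<in> V"
    unfolding push_def by (intro subspace_add subspace_scale)
  have "(push n v \<longlongrightarrow> sqrt (1 + 0\<^sup>2 * (n \<circ>\<^sub>L n)) *\<^sub>R v + 0 *\<^sub>R n) (at 0 within T)"
    unfolding push_def by (intro tendsto_intros)
  then show "(push n v \<longlongrightarrow> v) (at 0 within T)" by simp
qed

definition half :: "vec4 set \<Rightarrow> vec4 \<Rightarrow> vec4 set" where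
  "half V n = {v \<in> V \<inter> H3. 0 \<le> n \<circ>\<^sub>L v}"

lemma in_closure_of_path:
  fixes g :: "real \<Rightarrow> 'a::metric_space"
  assumes "(g \<longlongrightarrow> v) (at_right 0)" "\<And>t. t > 0 \<Longrightarrow> g t \<in> A"
  shows "v \<in> closure A"
proof (rule Lim_in_closed_set[OF closed_closure _ _ assms(1)])
  show "eventually (\<lambda>t. g t \<in> closure A) (at_right 0)"
    using assms(2) closure_subset by (intro eventually_at_right_less[THEN eventually_mono]) auto
qed simp

lemma closure_open_half:
  assumes "subspace V" "n \<in> V" "n \<circ>\<^sub>L n > 0"
  shows "closure (open_half V n) = half V n"
proof
  have eq: "half V n = V \<inter> H3 \<inter> {v. 0 \<le> n \<circ>\<^sub>L v}" by (auto simp: half_def)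
  have "closed (half V n)"
    unfolding eq
    by (intro closed_Int closed_subspace[OF assms(1)] closed_H3 closed_Collect_le continuous_intros)
  then show "closure (open_half V n) \<subseteq> half V n"
    by (intro closure_minimal) (auto simp: half_def)
  show "half V n \<subseteq> closure (open_half V n)"
  proof
    fix v assume v: "v \<in> half V n"
    show "v \<in> closure (open_half V n)"
    proof (cases "n \<circ>\<^sub>L v = 0")
      case True
      have vV: "v \<in> V" "v \<in> H3" using v by (auto simp: half_def)
      \<comment> \<open>A boundary point is approached along the geodesic that leaves it
        perpendicularly.\<close>
      show ?thesis
      proof (rule in_closure_of_path)
        show "(push n v \<longlongrightarrow> v) (at_right 0)" by (rule push(4)[OF vV(2) True assms(3)])
        fix t :: real assume "t > 0"
        then show "push n v t \<in> open_half V n"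
          using push(1,2)[OF vV(2) True assms(3)] push(3)[OF vV(2) True assms(3,1) vV(1) assms(2)] assms(3)
          by simp
      qed
    next
      case False
      then have "v \<in> open_half V n" using v by (auto simp: half_def)
      then show ?thesis by (rule subsetD[OF closure_subset])
    qed
  qed
qed

text \<open>Replaces components and closures by the choice of a sign for the normal. The dimension
  \<open>k\<close> stays general so that the same facts serve half-spaces of \<open>H3\<close> and
  half-planes of a plane.\<close>

lemma half_of_iff:
  assumes F: "flat k V F" and n: "n \<in> V" "n \<circ>\<^sub>L n > 0"
    and G: "G = {v \<in> F. n \<circ>\<^sub>L v = 0}"
  shows "half_of F G h \<longleftrightarrow> h = half V n \<or> h = half V (- n)"
proof -
  note V = flatD[OF F]
  have m: "- n \<in> V" "(- n) \<circ>\<^sub>L (- n) > 0" using n V(1) by (auto simp: lorentz_simps subspace_neg)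
  obtain v where v: "v \<in> V" "v \<in> H3" "n \<circ>\<^sub>L v = 0"
    using Lorentzian_point_on_hyperplane[OF F n] .
  have neg: "{x \<in> V \<inter> H3. n \<circ>\<^sub>L x < 0} = open_half V (- n)"
    by (auto simp: lorentz_simps)
  have ne: "push n v 1 \<in> open_half V n" "push n v (- 1) \<in> {x \<in> V \<inter> H3. n \<circ>\<^sub>L x < 0}"
    using push(1,2)[OF v(2,3) n(2)] push(3)[OF v(2,3) n(2) V(1) v(1) n(1)] n(2) by auto
  have "F - G = {x \<in> V \<inter> H3. n \<circ>\<^sub>L x \<noteq> 0}" using V(2) G by auto
  also have "components \<dots> = {open_half V n, {x \<in> V \<inter> H3. n \<circ>\<^sub>L x < 0}}"
  proof (rule components_cut)
    show "connected (open_half V n)" by (rule connected_cone_section[OF V(1)])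
    show "connected {x \<in> V \<inter> H3. n \<circ>\<^sub>L x < 0}" unfolding neg by (rule connected_cone_section[OF V(1)])
    show "continuous_on UNIV (\<lambda>x. n \<circ>\<^sub>L x)" by (intro continuous_intros)
    show "open_half V n \<noteq> {}" using ne(1) by blast
    show "{x \<in> V \<inter> H3. n \<circ>\<^sub>L x < 0} \<noteq> {}" using ne(2) by blast
  qed
  finally have comp: "components (F - G) = {open_half V n, {x \<in> V \<inter> H3. n \<circ>\<^sub>L x < 0}}" .
  have "closure {x \<in> V \<inter> H3. n \<circ>\<^sub>L x < 0} = half V (- n)"
    unfolding neg by (rule closure_open_half[OF V(1) m])
  then show ?thesis
    unfolding half_of_def comp bex_simps closure_open_half[OF V(1) n] by auto
qed

text \<open>At a point of the bounding flat, pushing by a small negative parameter leaves the half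
  while staying in \<open>F\<close>, so no such point is interior.\<close>

lemma interior_of_half:
  assumes F: "flat k V F" and n: "n \<in> V" "n \<circ>\<^sub>L n > 0"
  shows "(top_of_set F) interior_of (half V n) = open_half V n"
proof
  note V = flatD[OF F]
  show "open_half V n \<subseteq> (top_of_set F) interior_of (half V n)"
  proof (rule interior_of_maximal)
    have "open {v. n \<circ>\<^sub>L v > 0}" by (intro open_Collect_less continuous_intros)
    moreover have "open_half V n = F \<inter> {v. n \<circ>\<^sub>L v > 0}" using V(2) by auto
    ultimately show "openin (top_of_set F) (open_half V n)" by (auto simp: openin_open)
  qed (auto simp: half_def)
  show "(top_of_set F) interior_of (half V n) \<subseteq> open_half V n"
  proof
    fix v assume "v \<in> (top_of_set F) interior_of (half V n)"
    then obtain T where "openin (top_of_set F) T" "T \<subseteq> half V n" "v \<in> T"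
      by (auto simp: interior_of_def)
    then obtain S where S: "open S" "F \<inter> S \<subseteq> half V n" "v \<in> F" "v \<in> S"
      by (auto simp: openin_open)
    have v: "v \<in> V" "v \<in> H3" "n \<circ>\<^sub>L v \<ge> 0" using S V(2) by (auto simp: half_def)
    have "n \<circ>\<^sub>L v \<noteq> 0"
    proof
      assume 0: "n \<circ>\<^sub>L v = 0"
      have step: "eventually (\<lambda>t. push n v t \<in> S) (at_left 0)"
        using push(4)[OF v(2) 0 n(2)] S(1,4) by (rule topological_tendstoD)
      have "eventually (\<lambda>t. t < 0 \<and> push n v t \<in> S) (at_left (0 :: real))"
        by (intro eventually_conj step) (simp add: eventually_at_filter)
      then obtain t where t: "t < 0" "push n v t \<in> S"
        using eventually_happens[of _ "at_left (0 :: real)"] by auto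
      have "push n v t \<in> F"
        using push(1)[OF v(2) 0 n(2)] push(3)[OF v(2) 0 n(2) V(1) v(1) n(1)] V(2) by blast
      then have "t * (n \<circ>\<^sub>L n) \<ge> 0"
        using S(2) t push(2)[OF v(2) 0 n(2)] by (auto simp: half_def)
      then show False using t n by (simp add: zero_le_mult_iff)
    qed
    then show "v \<in> open_half V n" using v by auto
  qed
qed

lemma half_ideal_boundary_eq:
  assumes F: "flat k V F" and n: "n \<in> V" "n \<circ>\<^sub>L n > 0"
    and G: "G = {v \<in> F. n \<circ>\<^sub>L v = 0}"
  shows "half_ideal_boundary F G (half V n) = {x. positive_lightlike x \<and> x \<in> V \<and> 0 \<le> n \<circ>\<^sub>L x}"
proof -
  note V = flatD[OF F]
  define V0 where "V0 = {v \<in> V. n \<circ>\<^sub>L v = 0}"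
  define A where "A = {v \<in> V. n \<circ>\<^sub>L v > 0}"
  define B where "B = {v \<in> V. n \<circ>\<^sub>L v < 0}"
  obtain v where v: "v \<in> V" "v \<in> H3" "n \<circ>\<^sub>L v = 0"
    using Lorentzian_point_on_hyperplane[OF F n] .
  have sV0: "subspace V0" using V(1) by (auto simp: V0_def subspace_def lorentz_simps)
  \<comment> \<open>The definition leaves the dimension \<open>m\<close> of the bounding flat open,
    so it is enough that \<open>dim V0\<close> is positive.\<close>
  have "V0 \<noteq> {}" "\<not> V0 \<subseteq> {0}" using v by (auto simp: V0_def H3_def)
  then have "dim V0 \<noteq> 0" by (simp add: dim_eq_0)
  then obtain m where m: "dim V0 = m + 1" by (metis Suc_eq_plus1 not0_implies_Suc)
  have "V0 \<inter> H3 = G" using V(2) G by (auto simp: V0_def)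
  then have flG: "flat m V0 G"
    using flatI[OF sV0 m, of v] v by (auto simp: V0_def H3_def)
  have comp: "components (V - V0) = {A, B}"
  proof -
    have "A = V \<inter> {v. time_reflect n \<bullet> v > 0}" "B = V \<inter> {v. time_reflect n \<bullet> v < 0}"
      by (auto simp: A_def B_def lorentz_eq_inner)
    then have "convex A" "convex B"
      using V(1) by (simp_all add: convex_Int subspace_imp_convex convex_halfspace_gt convex_halfspace_lt)
    then have conn: "connected A" "connected B" by (simp_all add: convex_connected)
    have eq: "V - V0 = {x \<in> V. n \<circ>\<^sub>L x \<noteq> 0}" by (auto simp: V0_def)
    have ne: "n \<in> A" "- n \<in> B" using n V(1) by (auto simp: A_def B_def lorentz_simps subspace_neg)
    show ?thesis
      unfolding eq A_def B_def
    proof (rule components_cut)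
      show "continuous_on UNIV (\<lambda>x. n \<circ>\<^sub>L x)" by (intro continuous_intros)
    qed (use conn ne in \<open>auto simp: A_def B_def\<close>)
  qed
  have clA: "closure A = {v \<in> V. 0 \<le> n \<circ>\<^sub>L v}"
  proof
    have "closed (V \<inter> {v. 0 \<le> n \<circ>\<^sub>L v})"
      by (intro closed_Int closed_subspace[OF V(1)] closed_Collect_le continuous_intros)
    then have "closure A \<subseteq> V \<inter> {v. 0 \<le> n \<circ>\<^sub>L v}"
      by (intro closure_minimal) (auto simp: A_def)
    then show "closure A \<subseteq> {v \<in> V. 0 \<le> n \<circ>\<^sub>L v}" by blast
    show "{v \<in> V. 0 \<le> n \<circ>\<^sub>L v} \<subseteq> closure A"
    proof
      fix v assume v: "v \<in> {v \<in> V. 0 \<le> n \<circ>\<^sub>L v}"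
      have "((\<lambda>t. v + t *\<^sub>R n) \<longlongrightarrow> v + 0 *\<^sub>R n) (at_right 0)" by (intro tendsto_intros)
      then have lim: "((\<lambda>t. v + t *\<^sub>R n) \<longlongrightarrow> v) (at_right 0)" by simp
      show "v \<in> closure A"
      proof (rule in_closure_of_path[OF lim])
        fix t :: real assume "t > 0"
        then show "v + t *\<^sub>R n \<in> A"
          using v n V(1) by (simp add: A_def lorentz_simps add_nonneg_pos subspace_add subspace_scale)
      qed
    qed
  qed
  have int: "(top_of_set F) interior_of (half V n) = open_half V n"
    by (rule interior_of_half[OF F n])
  \<comment> \<open>An interior point of the half, which singles out the component \<open>A\<close>
    against \<open>B\<close>.\<close>
  have p: "push n v 1 \<in> open_half V n" 
    using push(1,2)[OF v(2,3) n(2)] push(3)[OF v(2,3) n(2) V(1) v(1) n(1)] n(2) by auto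
  have W: "W \<in> components (V - V0) \<and> (top_of_set F) interior_of (half V n) \<subseteq> W \<longleftrightarrow> W = A" for W
    unfolding comp int using p by (auto simp: A_def B_def)
  show ?thesis (is "?L = ?R")
  proof
    show "?L \<subseteq> ?R"
    proof
      fix x assume "x \<in> ?L"
      then obtain k' U m' V' W where x: "positive_lightlike x" "flat k' U F" "flat m' V' G"
        "W \<in> components (U - V')" "(top_of_set F) interior_of (half V n) \<subseteq> W" "x \<in> closure W"
        unfolding half_ideal_boundary_def by blast
      have "U = V" "V' = V0" using flat_unique[OF F x(2)] flat_unique[OF flG x(3)] by simp_all
      then have "W = A" using W x(4,5) by blast
      then show "x \<in> ?R" using x(1,6) clA by auto
    qed
    show "?R \<subseteq> ?L"
    proof
      fix x assume "x \<in> ?R"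
      then have "positive_lightlike x" "x \<in> closure A" using clA by auto
      then show "x \<in> ?L" unfolding half_ideal_boundary_def using F flG W[of A] by blast
    qed
  qed
qed

section \<open>Distances\<close>

lemma cosh_dH: "u \<in> H3 \<Longrightarrow> v \<in> H3 \<Longrightarrow> cosh (dH u v) = - (u \<circ>\<^sub>L v)"
  using H3_le(1)[of u v] by (simp add: dH_def)

lemma dH_nonneg: "u \<in> H3 \<Longrightarrow> v \<in> H3 \<Longrightarrow> dH u v \<ge> 0"
  using H3_le(1)[of u v] by (simp add: dH_def)

lemma dH_eq_iff:
  assumes "u \<in> H3" "v \<in> H3" "0 \<le> d"
  shows "dH u v = d \<longleftrightarrow> - (u \<circ>\<^sub>L v) = cosh d"
proof
  assume "- (u \<circ>\<^sub>L v) = cosh d"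
  then show "dH u v = d" using assms(3) by (simp add: dH_def arcosh_cosh_real)
qed (use cosh_dH[OF assms(1,2)] in simp)

lemma dH_ge_iff:
  assumes "u \<in> H3" "v \<in> H3" "0 \<le> d"
  shows "d \<le> dH u v \<longleftrightarrow> cosh d \<le> - (u \<circ>\<^sub>L v)"
  using cosh_real_nonneg_le_iff[OF assms(3) dH_nonneg[OF assms(1,2)]] cosh_dH[OF assms(1,2)] by simp

lemma dH_commute: "dH u v = dH v u"
  by (simp add: dH_def lorentz_commute)

section \<open>Signed distances to horoballs as Lorentz products\<close>

lemma horosphere_cosh_bound:
  assumes v: "v \<in> H3" and w: "w \<in> horosphere x" and x: "positive_lightlike x"
  shows "cosh (ln (- (v \<circ>\<^sub>L x))) \<le> - (v \<circ>\<^sub>L w)"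
proof -
  define p where "p = - (v \<circ>\<^sub>L x)"
  have p: "p > 0" using H3_lightlike_neg[OF v x] by (simp add: p_def)
  have w': "w \<in> H3" "w \<circ>\<^sub>L x = -1" using w by (auto simp: horosphere_def)
  \<comment> \<open>The weight \<open>p\<close> makes \<open>y\<close> orthogonal to the light-like
    \<open>x\<close>, so its square is nonnegative; expanding that square is the bound.\<close>
  define y where "y = v - p *\<^sub>R w"
  have "x \<circ>\<^sub>L y = 0"
    using w'(2) by (simp add: y_def lorentz_simps lorentz_commute[of x] p_def)
  then have "y \<circ>\<^sub>L y \<ge> 0" by (rule orthogonal_to_lightlike[OF x])
  moreover have "y \<circ>\<^sub>L y = - 1 - p\<^sup>2 - 2 * p * (v \<circ>\<^sub>L w)"
    by (simp add: y_def lorentz_simps H3_sq[OF v] H3_sq[OF w'(1)] lorentz_commute[of w v]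
        power2_eq_square algebra_simps)
  ultimately have "1 + p\<^sup>2 \<le> 2 * p * (- (v \<circ>\<^sub>L w))" by simp
  then have "(p + inverse p) / 2 \<le> - (v \<circ>\<^sub>L w)"
    using p by (simp add: field_simps power2_eq_square)
  then show ?thesis using p by (simp add: cosh_ln_real flip: p_def)
qed

lemma horosphere_nearest:
  assumes v: "v \<in> H3" and x: "positive_lightlike x"
  obtains w where "w \<in> horosphere x" "- (v \<circ>\<^sub>L w) = cosh (ln (- (v \<circ>\<^sub>L x)))"
proof -
  define p where "p = - (v \<circ>\<^sub>L x)"
  have p: "p > 0" using H3_lightlike_neg[OF v x] by (simp add: p_def)
  have vx: "v \<circ>\<^sub>L x = - p" "x \<circ>\<^sub>L v = - p" by (simp_all add: p_def lorentz_commute)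
  have xx: "x \<circ>\<^sub>L x = 0" using x by (simp add: positive_lightlike_def)
  \<comment> \<open>The point where the geodesic through \<open>v\<close> with endpoint
    \<open>x\<close> crosses the horosphere: the two coefficients solve
    \<open>w \<circ>\<^sub>L x = -1\<close> and \<open>w \<circ>\<^sub>L w = -1\<close>.\<close>
  define w where "w = (1 / p) *\<^sub>R v + ((1 - 1 / p\<^sup>2) / 2) *\<^sub>R x"
  have wx: "w \<circ>\<^sub>L x = -1" using p by (simp add: w_def lorentz_simps vx xx)
  have ww: "w \<circ>\<^sub>L w = -1"
    using p by (simp add: w_def lorentz_simps vx xx H3_sq[OF v] field_simps power2_eq_square)
  have "w $ 1 > 0"
    by (rule timelike_future[of w x]) (use wx ww x in \<open>auto simp: positive_lightlike_def\<close>)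
  then have "w \<in> horosphere x" using wx ww by (simp add: horosphere_def H3_def)
  moreover have "- (v \<circ>\<^sub>L w) = (p + inverse p) / 2"
    using p by (simp add: w_def lorentz_simps vx H3_sq[OF v] field_simps power2_eq_square)
  ultimately show ?thesis using that p by (simp add: cosh_ln_real flip: p_def)
qed

text \<open>The unsigned distance is the absolute value of the logarithm, and \<open>v\<close> lies
  in the horoball exactly when the logarithm is nonpositive; the sign convention removes the
  absolute value.\<close>

lemma point_horoball_dist_eq:
  assumes v: "v \<in> H3" and x: "positive_lightlike x"
  shows "point_horoball_dist v x = ln (- (v \<circ>\<^sub>L x))"
proof -
  define p where "p = - (v \<circ>\<^sub>L x)"
  have p: "p > 0" using H3_lightlike_neg[OF v x] by (simp add: p_def)
  have inH: "w \<in> H3" if "w \<in> horosphere x" for w using that by (simp add: horosphere_def)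
  obtain w where w: "w \<in> horosphere x" "- (v \<circ>\<^sub>L w) = cosh (ln p)"
    using horosphere_nearest[OF v x] unfolding p_def by blast
  have "Inf (dH v ` horosphere x) = \<bar>ln p\<bar>"
  proof (rule cInf_eq_minimum)
    have "dH v w = \<bar>ln p\<bar>" using dH_eq_iff[OF v inH[OF w(1)], of "\<bar>ln p\<bar>"] w(2) by simp
    then show "\<bar>ln p\<bar> \<in> dH v ` horosphere x" using w(1) by (metis imageI)
    fix d assume "d \<in> dH v ` horosphere x"
    then obtain w' where w': "w' \<in> horosphere x" "d = dH v w'" by blast
    then show "\<bar>ln p\<bar> \<le> d"
      using dH_ge_iff[OF v inH[OF w'(1)], of "\<bar>ln p\<bar>"] horosphere_cosh_bound[OF v w'(1) x]
      by (simp add: p_def)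
  qed
  moreover have "v \<in> horoball x \<longleftrightarrow> ln p \<le> 0"
    using v p by (auto simp: horoball_def p_def)
  ultimately show ?thesis by (simp add: point_horoball_dist_def flip: p_def)
qed

text \<open>On the plane, pairing with \<open>x\<close> is \<open>a\<close> times pairing with the
  foot \<open>p\<close> of the perpendicular toward \<open>x\<close>, so the minimum is attained at
  \<open>p\<close> and equals \<open>ln a\<close>.\<close>

lemma exp_plane_horoball_dist:
  assumes n: "n \<circ>\<^sub>L n = 1" and x: "positive_lightlike x" and nx: "n \<circ>\<^sub>L x < 0"
  shows "exp (plane_horoball_dist (plane n) x) = - (n \<circ>\<^sub>L x)"
proof -
  define a where "a = - (n \<circ>\<^sub>L x)"
  have a: "a > 0" using nx by (simp add: a_def)
  have nx': "n \<circ>\<^sub>L x = - a" "x \<circ>\<^sub>L n = - a" by (simp_all add: a_def lorentz_commute)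
  have xx: "x \<circ>\<^sub>L x = 0" using x by (simp add: positive_lightlike_def)
  define p where "p = (1 / a) *\<^sub>R (x + a *\<^sub>R n)"
  have pp: "p \<circ>\<^sub>L p = -1" using a by (simp add: p_def lorentz_simps nx' xx n)
  have px: "p \<circ>\<^sub>L x = - a" using a by (simp add: p_def lorentz_simps nx' xx)
  have "p $ 1 > 0"
    by (rule timelike_future[of p x]) (use pp px a x in \<open>auto simp: positive_lightlike_def\<close>)
  then have pH: "p \<in> H3" using pp by (simp add: H3_def)
  have pn: "p \<in> perp n" using a n by (simp add: perp_def p_def lorentz_simps nx')
  have x_eq: "x = a *\<^sub>R p - a *\<^sub>R n" using a by (simp add: p_def)
  have "Inf ((\<lambda>v. point_horoball_dist v x) ` (plane n)) = ln a"
  proof (rule cInf_eq_minimum)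
    show "ln a \<in> (\<lambda>v. point_horoball_dist v x) ` (plane n)"
      using point_horoball_dist_eq[OF pH x] px pH pn by force
    fix d assume "d \<in> (\<lambda>v. point_horoball_dist v x) ` (plane n)"
    then obtain v where v: "v \<in> H3" "n \<circ>\<^sub>L v = 0" "d = point_horoball_dist v x"
      by (auto simp: perp_def)
    have "v \<circ>\<^sub>L x = a * (v \<circ>\<^sub>L p)"
      using v(2) by (subst x_eq) (simp add: lorentz_simps lorentz_commute[of v n])
    moreover have "a * 1 \<le> a * (- (v \<circ>\<^sub>L p))"
      using a H3_le(1)[OF v(1) pH] by (intro mult_left_mono) auto
    ultimately have "a \<le> - (v \<circ>\<^sub>L x)" by simp
    then show "ln a \<le> d" using v(3) point_horoball_dist_eq[OF v(1) x] a by simp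
  qed
  then show ?thesis using a by (simp add: plane_horoball_dist_def flip: a_def)
qed

lemma exp_horoball_dist:
  assumes x: "positive_lightlike x" and y: "positive_lightlike y" and xy: "x \<circ>\<^sub>L y < 0"
  shows "exp (horoball_dist x y) = - (x \<circ>\<^sub>L y) / 2"
proof -
  define m where "m = - (x \<circ>\<^sub>L y)"
  have m: "m > 0" using xy by (simp add: m_def)
  have xy': "x \<circ>\<^sub>L y = - m" "y \<circ>\<^sub>L x = - m" by (simp_all add: m_def lorentz_commute)
  have xx: "x \<circ>\<^sub>L x = 0" "y \<circ>\<^sub>L y = 0" using x y by (simp_all add: positive_lightlike_def)
  \<comment> \<open>The point where the geodesic joining the two ideal points crosses the horosphere
    of \<open>x\<close>.\<close>
  define v where "v = (1 / 2) *\<^sub>R x + (1 / m) *\<^sub>R y"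
  have vv: "v \<circ>\<^sub>L v = -1" using m by (simp add: v_def lorentz_simps xy' xx)
  have vx: "v \<circ>\<^sub>L x = -1" "v \<circ>\<^sub>L y = - m / 2" using m by (simp_all add: v_def lorentz_simps xy' xx)
  have "v $ 1 > 0"
    by (rule timelike_future[of v x]) (use vv vx x in \<open>auto simp: positive_lightlike_def\<close>)
  then have vH: "v \<in> H3" using vv by (simp add: H3_def)
  have "Inf ((\<lambda>v. point_horoball_dist v y) ` horosphere x) = ln (m / 2)"
  proof (rule cInf_eq_minimum)
    have "v \<in> horosphere x" using vH vx by (simp add: horosphere_def)
    moreover have "point_horoball_dist v y = ln (m / 2)"
      using point_horoball_dist_eq[OF vH y] vx by simp
    ultimately show "ln (m / 2) \<in> (\<lambda>v. point_horoball_dist v y) ` horosphere x" by (metis imageI)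
    fix d assume "d \<in> (\<lambda>v. point_horoball_dist v y) ` horosphere x"
    then obtain w where w: "w \<in> H3" "w \<circ>\<^sub>L x = -1" "d = point_horoball_dist w y"
      by (auto simp: horosphere_def)
    define q where "q = - (w \<circ>\<^sub>L y)"
    have q: "q > 0" "w \<circ>\<^sub>L y = - q" "y \<circ>\<^sub>L w = - q" "x \<circ>\<^sub>L w = -1"
      using H3_lightlike_neg[OF w(1) y] w(2) by (simp_all add: q_def lorentz_commute)
    \<comment> \<open>Both \<open>x\<close> and \<open>(1 / q) *\<^sub>R y\<close> pair with
      \<open>w\<close> to -1, so subtracting \<open>2 *\<^sub>R w\<close> leaves a vector orthogonal
      to \<open>w\<close>; its nonnegative square reads \<open>m / 2 \<le> q\<close>.\<close>
    define z where "z = x + (1 / q) *\<^sub>R y - 2 *\<^sub>R w"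
    have wz: "w \<circ>\<^sub>L z = 0" using q by (simp add: z_def lorentz_simps w(2) H3_sq[OF w(1)])
    have zz: "z \<circ>\<^sub>L z = 4 - 2 * (m / q)"
      using q by (simp add: z_def lorentz_simps w(2) H3_sq[OF w(1)] xx xy' field_simps)
    have "w \<circ>\<^sub>L w < 0" using H3_sq[OF w(1)] by simp
    then have "z \<circ>\<^sub>L z \<ge> 0"
      using orthogonal_to_timelike[OF _ wz] by (cases "z = 0") (simp_all add: lorentz_zero_left less_imp_le)
    then have "m / 2 \<le> - (w \<circ>\<^sub>L y)" using q(1) unfolding zz q(2) by (simp add: field_simps)
    then show "ln (m / 2) \<le> d" using w(3) point_horoball_dist_eq[OF w(1) y] m by simp
  qed
  then show ?thesis using m by (simp add: horoball_dist_def flip: m_def)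
qed

lemma plane_dist_commute: "plane_dist P Q = plane_dist Q P"
proof -
  have "(\<lambda>(u, v). dH u v) ` (P \<times> Q) = (\<lambda>(u, v). dH u v) ` (Q \<times> P)"
    using dH_commute by (auto simp: image_def; blast)
  then show ?thesis by (simp add: plane_dist_def)
qed

lemma geodesic_to_commute: "geodesic_to p q = geodesic_to q p"
  by (auto simp: geodesic_to_def) (metis add.commute)+

lemma shortest_arc_commute: "shortest_arc P Q = shortest_arc Q P"
  unfolding shortest_arc_def plane_dist_commute[of P]
  using dH_commute geodesic_to_commute by (auto; metis)

section \<open>The vector model of a tetrahedron\<close>

declare One_nat_def [simp del]

text \<open>The hypotheses of \<open>tet_data\<close> reduce to this sign pattern of the Gram
  matrix. The light-like vectors are not normalized, since their scale determines the
  horoballs.\<close>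

locale tet_frame =
  fixes u :: "nat \<Rightarrow> vec4"
  assumes unit: "u 1 \<circ>\<^sub>L u 1 = 1" "u 2 \<circ>\<^sub>L u 2 = 1"
    and light: "positive_lightlike (u 3)" "positive_lightlike (u 4)"
    and u12: "u 1 \<circ>\<^sub>L u 2 < -1"
    and u13: "u 1 \<circ>\<^sub>L u 3 < 0" and u14: "u 1 \<circ>\<^sub>L u 4 < 0"
    and u23: "u 2 \<circ>\<^sub>L u 3 < 0" and u24: "u 2 \<circ>\<^sub>L u 4 < 0" and u34: "u 3 \<circ>\<^sub>L u 4 < 0"

lemma flat_H3: "flat 3 UNIV H3"
  using flatI[of UNIV 3, OF _ _ UNIV_I axis1_timelike] by simp

text \<open>Normals are oriented away from the half-spaces. For \<open>e\<close>, the product of the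
  normals, intersecting planes would give absolute value below 1 and parallel or equal planes
  absolute value 1; the inclusions of each plane in the other half-space then exclude
  \<open>e > 1\<close>.\<close>

lemma tet_frame_exists:
  assumes "tet_data P H x"
  obtains u where "tet_frame u" "\<And>i. i \<in> {1, 2} \<Longrightarrow> P i = plane (u i)"
    "\<And>i. i \<in> {1, 2} \<Longrightarrow> H i = half UNIV (- u i)" "x 3 = u 3" "x 4 = u 4"
proof -
  note data = assms[unfolded tet_data_def]
  have "\<exists>n. n \<circ>\<^sub>L n = 1 \<and> P i = plane n \<and> H i = half UNIV (- n) \<and> n \<circ>\<^sub>L x 3 < 0 \<and> n \<circ>\<^sub>L x 4 < 0"
    if i: "i \<in> {1, 2}" for i
  proof -
    have "is_plane (P i)" using data i by auto
    then obtain n where n: "n \<circ>\<^sub>L n = 1" "P i = plane n" using is_plane_iff by blast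
    have "half_of H3 (P i) (H i)" using data i by blast
    moreover have "P i = {v \<in> H3. n \<circ>\<^sub>L v = 0}" using n(2) by (auto simp: perp_def)
    ultimately have "H i = half UNIV n \<or> H i = half UNIV (- n)"
      using half_of_iff[OF flat_H3, of n "P i" "H i"] n(1) by simp
    then obtain m where m: "m \<circ>\<^sub>L m = 1" "P i = plane m" "H i = half UNIV (- m)"
    proof
      assume "H i = half UNIV n"
      moreover have "perp (- n) = perp n" by (auto simp: perp_def lorentz_simps)
      ultimately show thesis using that[of "- n"] n by (simp add: lorentz_simps)
    qed (use that n in blast)
    have "m \<circ>\<^sub>L x j < 0" if j: "j \<in> {3, 4}" for j
    proof -
      have "x j \<in> half_ideal_boundary H3 (P i) (H i)" using data i j by blast
      moreover have "P i = {v \<in> H3. (- m) \<circ>\<^sub>L v = 0}" using m(2) by (auto simp: perp_def lorentz_simps)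
      ultimately have "positive_lightlike (x j)" "m \<circ>\<^sub>L x j \<le> 0"
        using half_ideal_boundary_eq[OF flat_H3, of "- m" "P i"] m by (auto simp: lorentz_simps)
      moreover have "x j \<notin> ideal_boundary (P i)" using data i j by blast
      ultimately show ?thesis using ideal_boundary_plane[of m] m(1,2) by auto
    qed
    then show ?thesis using m by blast
  qed
  then obtain n where n: "\<And>i. i \<in> {1, 2} \<Longrightarrow> n i \<circ>\<^sub>L n i = 1"
    "\<And>i. i \<in> {1, 2} \<Longrightarrow> P i = plane (n i)"
    "\<And>i. i \<in> {1, 2} \<Longrightarrow> H i = half UNIV (- n i)"
    "\<And>i. i \<in> {1, 2} \<Longrightarrow> n i \<circ>\<^sub>L x 3 < 0" "\<And>i. i \<in> {1, 2} \<Longrightarrow> n i \<circ>\<^sub>L x 4 < 0"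
    by metis
  define e where "e = n 1 \<circ>\<^sub>L n 2"
  have nn: "n 1 \<circ>\<^sub>L n 1 = 1" "n 2 \<circ>\<^sub>L n 2 = 1" "n 1 \<circ>\<^sub>L n 2 = e" "n 2 \<circ>\<^sub>L n 1 = e"
    using n(1) by (auto simp: e_def lorentz_commute)
  have disj: "P 1 \<inter> P 2 = {}" and npar: "ideal_boundary (P 1) \<inter> ideal_boundary (P 2) = {}"
    using data by (auto simp: parallel_planes_def)
  have "\<not> \<bar>e\<bar> < 1"
  proof
    assume "\<bar>e\<bar> < 1"
    then obtain v where "v \<in> H3" "n 1 \<circ>\<^sub>L v = 0" "n 2 \<circ>\<^sub>L v = 0"
      using timelike_orthogonal_to_two[of "n 1" "n 2"] nn by auto
    then show False using disj n(2) by (auto simp: perp_def)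
  qed
  moreover have "\<bar>e\<bar> \<noteq> 1"
  proof
    assume e1: "\<bar>e\<bar> = 1"
    then have ee: "e * e = 1" by (auto simp: abs_if split: if_splits)
    \<comment> \<open>A null vector orthogonal to both normals. If it vanishes the planes coincide;
      otherwise, up to sign, it is a common ideal point.\<close>
    define z where "z = n 1 - e *\<^sub>R n 2"
    have z: "z \<circ>\<^sub>L z = 0" "n 1 \<circ>\<^sub>L z = 0" "n 2 \<circ>\<^sub>L z = 0"
      using ee by (simp_all add: z_def lorentz_simps nn)
    show False
    proof (cases "z = 0")
      case True
      then have n1: "n 1 = e *\<^sub>R n 2" by (simp add: z_def)
      have "perp (n 1) = perp (n 2)" using e1 by (auto simp: perp_def n1 lorentz_simps)
      then have "P 1 \<inter> H3 = {}" using disj n(2) by auto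
      moreover obtain v where "v \<in> H3" "v \<in> perp (n 1)"
        using flat_has_point[OF flat_perp, of "n 1"] nn by auto
      ultimately show False using n(2) by auto
    next
      case False
      have "z $ 1 \<noteq> 0"
      proof
        assume "z $ 1 = 0"
        then show False using z(1) False by (simp add: lorentz_self space_sq_eq_0_iff vec4_eq_iff)
      qed
      define w where "w = (if z $ 1 > 0 then z else - z)"
      have "positive_lightlike w" "n 1 \<circ>\<^sub>L w = 0" "n 2 \<circ>\<^sub>L w = 0"
        using z False \<open>z $ 1 \<noteq> 0\<close> by (auto simp: w_def positive_lightlike_def lorentz_simps)
      then show False using npar ideal_boundary_plane[of "n 1"] ideal_boundary_plane[of "n 2"] nn n(2) by auto
    qed
  qed
  ultimately have e1: "\<bar>e\<bar> > 1" by linarith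
  have "e * e > 1" using abs_square_less_1[of e] e1 abs_square_eq_1[of e]
    by (smt (verit) power2_eq_square)
  \<comment> \<open>The foot of the common perpendicular on plane \<open>i\<close> is a multiple of
    \<open>n j - e *\<^sub>R n i\<close>, and the inclusion of \<open>P i\<close> in
    \<open>H j\<close> makes the factor positive. The product of the two feet is then a positive
    multiple of \<open>e\<close>, and it is negative since both lie in \<open>H3\<close>.\<close>
  have foot: "\<exists>v\<in>H3. n i \<circ>\<^sub>L v = 0 \<and> (\<exists>r>0. v = r *\<^sub>R (n j - e *\<^sub>R n i))"
    if ij: "i \<in> {1, 2}" "j \<in> {1, 2}" "i \<noteq> j" for i j
  proof -
    have nij: "n i \<circ>\<^sub>L n i = 1" "n j \<circ>\<^sub>L n j = 1" "n i \<circ>\<^sub>L n j = e" "n j \<circ>\<^sub>L n i = e"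
      using ij nn by auto
    define w where "w = n j - e *\<^sub>R n i"
    have w: "w \<circ>\<^sub>L w = 1 - e * e" "n i \<circ>\<^sub>L w = 0" "n j \<circ>\<^sub>L w = 1 - e * e"
      by (simp_all add: w_def lorentz_simps nij)
    then have "w \<circ>\<^sub>L w < 0" using \<open>e * e > 1\<close> by simp
    then obtain r where r: "r \<noteq> 0" "r *\<^sub>R w \<in> H3" using timelike_scaled_in_H3 by blast
    have "r *\<^sub>R w \<in> P i" using n(2)[OF ij(1)] r(2) w(2) by (simp add: perp_def lorentz_simps)
    moreover have "P i \<subseteq> H j"
    proof -
      have "3 - j = i" using ij by auto
      then show ?thesis using data ij by metis
    qed
    ultimately have "r * (1 - e * e) \<le> 0"
      using n(3)[OF ij(2)] w(3) by (auto simp: half_def lorentz_simps)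
    then have "r > 0" using \<open>e * e > 1\<close> r(1) by (simp add: mult_le_0_iff)
    moreover have "n i \<circ>\<^sub>L (r *\<^sub>R w) = 0" using w(2) by (simp add: lorentz_simps)
    ultimately show ?thesis using r(2) unfolding w_def by blast
  qed
  obtain v r where v: "v \<in> H3" "r > 0" "v = r *\<^sub>R (n 2 - e *\<^sub>R n 1)" using foot[of 1 2] by auto
  obtain w s where w: "w \<in> H3" "s > 0" "w = s *\<^sub>R (n 1 - e *\<^sub>R n 2)" using foot[of 2 1] by auto
  have "v \<circ>\<^sub>L w = r * s * (e * (e * e - 1))"
    unfolding v(3) w(3) by (simp add: lorentz_simps nn algebra_simps)
  then have "r * s * (e * (e * e - 1)) < 0" using H3_neg[OF v(1) w(1)] by simp
  then have "e < 0" using v(2) w(2) \<open>e * e > 1\<close> by (simp add: mult_less_0_iff)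
  then have e: "e < -1" using e1 by simp
  define u where "u = (\<lambda>i :: nat. if i \<le> 2 then n i else x i)"
  have "x 3 \<circ>\<^sub>L x 4 < 0" using data lightlike_neg by blast
  then have "tet_frame u"
    using data n(1,4,5) e by unfold_locales (auto simp: u_def e_def)
  moreover have "\<And>i. i \<in> {1, 2} \<Longrightarrow> u i = n i" "u 3 = x 3" "u 4 = x 4" by (auto simp: u_def)
  ultimately show ?thesis using that n(2,3) by metis
qed

abbreviation idx :: "nat set" where "idx \<equiv> {1, 2, 3, 4}"

context tet_frame
begin

section \<open>Consequences of the sign pattern of the Gram matrix\<close>

lemma u_neg:
  assumes "p \<in> idx" "q \<in> idx" "p \<noteq> q"
  shows "u p \<circ>\<^sub>L u q < 0"
proof -
  have "u 1 \<circ>\<^sub>L u 2 < 0" using u12 by simp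
  then show ?thesis
    using assms u13 u14 u23 u24 u34
      lorentz_commute[of "u 2" "u 1"] lorentz_commute[of "u 3" "u 1"] lorentz_commute[of "u 4" "u 1"]
      lorentz_commute[of "u 3" "u 2"] lorentz_commute[of "u 4" "u 2"] lorentz_commute[of "u 4" "u 3"]
    by (elim insertE emptyE; simp)
qed

lemma u_light_sq: "u 3 \<circ>\<^sub>L u 3 = 0" "u 4 \<circ>\<^sub>L u 4 = 0"
  using light by (simp_all add: positive_lightlike_def)

lemma u_sq_nonneg: "p \<in> idx \<Longrightarrow> u p \<circ>\<^sub>L u p \<ge> 0"
  using unit u_light_sq by (elim insertE emptyE; simp)

lemma u_gram:
  assumes "p \<in> idx" "q \<in> idx" "p \<noteq> q"
  shows "(u p \<circ>\<^sub>L u p) * (u q \<circ>\<^sub>L u q) < (u p \<circ>\<^sub>L u q)\<^sup>2"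
proof -
  have pos: "(u p \<circ>\<^sub>L u q)\<^sup>2 > 0" using u_neg[OF assms] by simp
  have "\<bar>u 1 \<circ>\<^sub>L u 2\<bar> > 1" using u12 by simp
  then have "(u 1 \<circ>\<^sub>L u 2)\<^sup>2 > 1" using abs_le_square_iff[of "u 1 \<circ>\<^sub>L u 2" 1] by simp
  then have 12: "(u 1 \<circ>\<^sub>L u 2)\<^sup>2 > 1" "(u 2 \<circ>\<^sub>L u 1)\<^sup>2 > 1" by (simp_all add: lorentz_commute[of "u 2"])
  show ?thesis
  proof (cases "p \<in> {3, 4} \<or> q \<in> {3, 4}")
    case True
    then have "u p \<circ>\<^sub>L u p = 0 \<or> u q \<circ>\<^sub>L u q = 0" using u_light_sq by auto
    then show ?thesis using pos by auto
  next
    case False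
    then have "(p = 1 \<and> q = 2) \<or> (p = 2 \<and> q = 1)" using assms by auto
    then show ?thesis using 12 unit by auto
  qed
qed

text \<open>The Gram determinant of three of the vectors is negative: the product of the three mixed
  entries is negative, and \<open>a * b < x\<^sup>2\<close> lets \<open>c * x\<^sup>2\<close> absorb
  \<open>a * b * c\<close>.\<close>

lemma triple_independent:
  assumes "p \<in> idx" "q \<in> idx" "r \<in> idx" "p \<noteq> q" "p \<noteq> r" "q \<noteq> r"
    and 0: "\<alpha> *\<^sub>R u p + \<beta> *\<^sub>R u q + \<gamma> *\<^sub>R u r = 0"
  shows "\<alpha> = 0 \<and> \<beta> = 0 \<and> \<gamma> = 0"
proof -
  have main: "\<alpha> = 0"
    if pqr: "p \<in> idx" "q \<in> idx" "r \<in> idx" "p \<noteq> q" "p \<noteq> r" "q \<noteq> r"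
      and 0: "\<alpha> *\<^sub>R u p + \<beta> *\<^sub>R u q + \<gamma> *\<^sub>R u r = 0" for p q r \<alpha> \<beta> \<gamma>
  proof -
    define a b c where abc: "a = u p \<circ>\<^sub>L u p" "b = u q \<circ>\<^sub>L u q" "c = u r \<circ>\<^sub>L u r"
    define x y z where xyz: "x = u p \<circ>\<^sub>L u q" "y = u p \<circ>\<^sub>L u r" "z = u q \<circ>\<^sub>L u r"
    have E: "\<alpha> * a + \<beta> * x + \<gamma> * y = 0" "\<alpha> * x + \<beta> * b + \<gamma> * z = 0" "\<alpha> * y + \<beta> * z + \<gamma> * c = 0"
      using arg_cong[OF 0, of "\<lambda>w. w \<circ>\<^sub>L u p"] arg_cong[OF 0, of "\<lambda>w. w \<circ>\<^sub>L u q"]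
        arg_cong[OF 0, of "\<lambda>w. w \<circ>\<^sub>L u r"]
      by (simp_all add: lorentz_simps abc xyz lorentz_commute[of "u q" "u p"]
          lorentz_commute[of "u r" "u p"] lorentz_commute[of "u r" "u q"])
    \<comment> \<open>The Gram determinant; the next identity is Cramer's rule for
      \<open>\<alpha>\<close>.\<close>
    define D where "D = a * b * c + 2 * (x * y * z) - a * z\<^sup>2 - b * y\<^sup>2 - c * x\<^sup>2"
    have "\<alpha> * D = (b * c - z\<^sup>2) * (\<alpha> * a + \<beta> * x + \<gamma> * y) - (x * c - y * z) * (\<alpha> * x + \<beta> * b + \<gamma> * z)
        + (x * z - b * y) * (\<alpha> * y + \<beta> * z + \<gamma> * c)"
      by (simp add: D_def power2_eq_square algebra_simps)
    then have aD: "\<alpha> * D = 0" unfolding E by simp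
    have "a \<ge> 0" "b \<ge> 0" "c \<ge> 0" using u_sq_nonneg pqr by (simp_all add: abc)
    moreover have "a * b < x\<^sup>2" using u_gram[of p q] pqr by (simp add: abc xyz)
    moreover have "x < 0" "y < 0" "z < 0" using u_neg pqr by (simp_all add: xyz)
    ultimately have "a * b * c \<le> x\<^sup>2 * c" "a * z\<^sup>2 \<ge> 0" "b * y\<^sup>2 \<ge> 0" "x * y * z < 0"
      by (simp_all add: mult_right_mono mult_neg_neg mult_pos_neg)
    then have "D < 0" by (simp add: D_def mult.commute)
    then show ?thesis using aD by simp
  qed
  have "\<beta> *\<^sub>R u q + \<alpha> *\<^sub>R u p + \<gamma> *\<^sub>R u r = 0" "\<gamma> *\<^sub>R u r + \<alpha> *\<^sub>R u p + \<beta> *\<^sub>R u q = 0"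
    using 0 by (simp_all add: algebra_simps)
  then show ?thesis
    using main[of p q r \<alpha> \<beta> \<gamma>] main[of q p r \<beta> \<alpha> \<gamma>] main[of r p q \<gamma> \<alpha> \<beta>] assms by auto
qed

text \<open>A square of -1 needs a negative mixed term, so the coefficients have equal signs;
  pairing with a light-like vector, which is negative on \<open>H3\<close>, excludes that both are
  negative.\<close>

lemma line_point_coefficients:
  assumes pq: "p \<in> idx" "q \<in> idx" "p \<noteq> q" and v: "v \<in> H3" "v = \<alpha> *\<^sub>R u p + \<beta> *\<^sub>R u q"
  shows "\<alpha> > 0 \<and> \<beta> > 0"
proof -
  have "-1 = \<alpha>\<^sup>2 * (u p \<circ>\<^sub>L u p) + 2 * (\<alpha> * \<beta>) * (u p \<circ>\<^sub>L u q) + \<beta>\<^sup>2 * (u q \<circ>\<^sub>L u q)"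
    using H3_sq[OF v(1)]
    by (simp add: v(2) lorentz_simps lorentz_commute[of "u q" "u p"] power2_eq_square algebra_simps)
  moreover have "\<alpha>\<^sup>2 * (u p \<circ>\<^sub>L u p) \<ge> 0" "\<beta>\<^sup>2 * (u q \<circ>\<^sub>L u q) \<ge> 0"
    using u_sq_nonneg pq by simp_all
  ultimately have "(\<alpha> * \<beta>) * (u p \<circ>\<^sub>L u q) < 0" by linarith
  then have ab: "\<alpha> * \<beta> > 0" using u_neg[OF pq] by (simp add: mult_less_0_iff)
  \<comment> \<open>\<open>u 3\<close> is a uniform test vector: it pairs negatively with the other
    three and to 0 with itself.\<close>
  have "u p \<circ>\<^sub>L u 3 \<le> 0" "u q \<circ>\<^sub>L u 3 \<le> 0"
    using u_neg[of p 3] u_neg[of q 3] pq u_light_sq by (cases "p = 3"; cases "q = 3"; force)+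
  moreover have "\<alpha> * (u p \<circ>\<^sub>L u 3) + \<beta> * (u q \<circ>\<^sub>L u 3) < 0"
    using H3_lightlike_neg[OF v(1) light(1)] by (simp add: v(2) lorentz_simps)
  ultimately have "\<not> (\<alpha> < 0 \<and> \<beta> < 0)"
    by (smt (verit) mult_nonpos_nonpos)
  then show ?thesis using ab by (auto simp: zero_less_mult_iff)
qed

text \<open>Such a vector is orthogonal to a time-like vector, namely any point of the line spanned
  by the pair.\<close>

lemma orthogonal_to_pair_spacelike:
  assumes pq: "p \<in> idx" "q \<in> idx" "p \<noteq> q"
    and m: "m \<circ>\<^sub>L u p = 0" "m \<circ>\<^sub>L u q = 0" "m \<noteq> 0"
  shows "m \<circ>\<^sub>L m > 0"
proof -
  obtain v where v: "v \<in> span {u p, u q}" "v \<in> H3"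
    using flat_has_point[OF flat_span_2(1)[OF u_gram[OF pq]]] .
  then obtain \<alpha> \<beta> where "v = \<alpha> *\<^sub>R u p + \<beta> *\<^sub>R u q" by (auto simp: span_2)
  then have "m \<circ>\<^sub>L v = 0" using m by (simp add: lorentz_simps)
  then have "v \<circ>\<^sub>L m = 0" by (simp add: lorentz_commute)
  moreover have "v \<circ>\<^sub>L v < 0" using H3_sq[OF v(2)] by simp
  ultimately show ?thesis using orthogonal_to_timelike m(3) by blast
qed

text \<open>The four vectors are dependent because they share the normal \<open>m\<close>, and the
  coefficient of \<open>v\<close> cannot vanish because the other three are independent.\<close>

lemma decompose:
  assumes pqr: "p \<in> idx" "q \<in> idx" "r \<in> idx" "p \<noteq> q" "p \<noteq> r" "q \<noteq> r"
    and m: "m \<noteq> 0" "m \<circ>\<^sub>L u p = 0" "m \<circ>\<^sub>L u q = 0" "m \<circ>\<^sub>L u r = 0" "m \<circ>\<^sub>L v = 0"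
  obtains \<alpha> \<beta> \<gamma> where "v = \<alpha> *\<^sub>R u p + \<beta> *\<^sub>R u q + \<gamma> *\<^sub>R u r"
proof -
  have m': "u p \<circ>\<^sub>L m = 0" "u q \<circ>\<^sub>L m = 0" "u r \<circ>\<^sub>L m = 0" "v \<circ>\<^sub>L m = 0"
    using m by (simp_all add: lorentz_commute)
  obtain a b c d where rel: "a *\<^sub>R u p + b *\<^sub>R u q + c *\<^sub>R u r + d *\<^sub>R v = 0"
    "a \<noteq> 0 \<or> b \<noteq> 0 \<or> c \<noteq> 0 \<or> d \<noteq> 0"
    using orthogonal_dependent[OF m(1) m'] .
  have "d \<noteq> 0" using rel triple_independent[OF pqr, of a b c] by auto
  have "d *\<^sub>R v = - (a *\<^sub>R u p + b *\<^sub>R u q + c *\<^sub>R u r)"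
    unfolding eq_neg_iff_add_eq_0 using rel(1) by (simp only: add.commute[of "d *\<^sub>R v"])
  then have "(1 / d) *\<^sub>R (d *\<^sub>R v) = (1 / d) *\<^sub>R (- (a *\<^sub>R u p + b *\<^sub>R u q + c *\<^sub>R u r))" by simp
  then have "v = (- a / d) *\<^sub>R u p + (- b / d) *\<^sub>R u q + (- c / d) *\<^sub>R u r"
    using \<open>d \<noteq> 0\<close> by (simp add: scaleR_right_distrib scaleR_right_diff_distrib)
  then show ?thesis using that by blast
qed

text \<open>A nonzero \<open>v\<close> would be space-like, yet it lies in the span of vectors
  orthogonal to it and so is null.\<close>

lemma orthogonal_to_triple_zero:
  assumes pqr: "p \<in> idx" "q \<in> idx" "r \<in> idx" "p \<noteq> q" "p \<noteq> r" "q \<noteq> r"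
    and m: "m \<noteq> 0" "m \<circ>\<^sub>L u p = 0" "m \<circ>\<^sub>L u q = 0" "m \<circ>\<^sub>L u r = 0"
    and v: "m \<circ>\<^sub>L v = 0" "v \<circ>\<^sub>L u p = 0" "v \<circ>\<^sub>L u q = 0" "v \<circ>\<^sub>L u r = 0"
  shows "v = 0"
proof (rule ccontr)
  assume "v \<noteq> 0"
  then have "v \<circ>\<^sub>L v > 0" using orthogonal_to_pair_spacelike[OF pqr(1,2,4) v(2,3)] by blast
  moreover obtain \<alpha> \<beta> \<gamma> where eq: "v = \<alpha> *\<^sub>R u p + \<beta> *\<^sub>R u q + \<gamma> *\<^sub>R u r"
    using decompose[OF pqr m v(1)] .
  have "v \<circ>\<^sub>L v = 0" by (subst (2) eq) (simp add: lorentz_simps v)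
  ultimately show False by simp
qed

lemma normal_unique:
  assumes pqr: "p \<in> idx" "q \<in> idx" "r \<in> idx" "p \<noteq> q" "p \<noteq> r" "q \<noteq> r"
    and m: "m \<circ>\<^sub>L m = 1" "m \<circ>\<^sub>L u p = 0" "m \<circ>\<^sub>L u q = 0" "m \<circ>\<^sub>L u r = 0"
    and m': "m' \<circ>\<^sub>L m' = 1" "m' \<circ>\<^sub>L u p = 0" "m' \<circ>\<^sub>L u q = 0" "m' \<circ>\<^sub>L u r = 0"
  shows "perp m' = perp m"
proof -
  have "m \<noteq> 0" using m(1) by (auto simp: lorentz_simps)
  then have "m' - (m \<circ>\<^sub>L m') *\<^sub>R m = 0"
    by (rule orthogonal_to_triple_zero[OF pqr _ m(2-4)]) (simp_all add: lorentz_simps m m')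
  then obtain c where c: "m' = c *\<^sub>R m" by (metis eq_iff_diff_eq_0)
  then have "c \<noteq> 0" using m'(1) by (auto simp: lorentz_simps)
  then show ?thesis by (auto simp: perp_def c lorentz_simps)
qed

lemma complement_triple:
  assumes "i \<in> idx"
  obtains p q r where "idx - {i} = {p, q, r}" "p \<in> idx" "q \<in> idx" "r \<in> idx"
    "p \<noteq> q" "p \<noteq> r" "q \<noteq> r"
proof -
  consider "i = 1" | "i = 2" | "i = 3" | "i = 4" using assms by auto
  then show ?thesis
  proof cases
    case 1 then show ?thesis by (intro that[of 2 3 4]) auto
  next
    case 2 then show ?thesis by (intro that[of 1 3 4]) auto
  next
    case 3 then show ?thesis by (intro that[of 1 2 4]) auto
  next
    case 4 then show ?thesis by (intro that[of 1 2 3]) auto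
  qed
qed

text \<open>The weak inequality at \<open>u i\<close> covers the degenerate case, where
  \<open>m\<close> is orthogonal to all four vectors.\<close>

lemma side_normal_exists:
  assumes "i \<in> idx"
  obtains m where "m \<circ>\<^sub>L m = 1" "\<And>j. j \<in> idx - {i} \<Longrightarrow> m \<circ>\<^sub>L u j = 0" "m \<circ>\<^sub>L u i \<ge> 0"
proof -
  obtain p q r where pqr: "idx - {i} = {p, q, r}" "p \<in> idx" "q \<in> idx" "r \<in> idx"
    "p \<noteq> q" "p \<noteq> r" "q \<noteq> r" by (rule complement_triple[OF assms])
  obtain k where k: "k \<noteq> 0" "u p \<circ>\<^sub>L k = 0" "u q \<circ>\<^sub>L k = 0" "u r \<circ>\<^sub>L k = 0"
    by (rule common_normal_exists)
  have k': "k \<circ>\<^sub>L u p = 0" "k \<circ>\<^sub>L u q = 0" "k \<circ>\<^sub>L u r = 0" using k by (simp_all add: lorentz_commute)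
  have "k \<circ>\<^sub>L k > 0" using orthogonal_to_pair_spacelike[OF pqr(2,3,5) k'(1,2) k(1)] .
  then obtain c where c: "c > 0" "(c *\<^sub>R k) \<circ>\<^sub>L (c *\<^sub>R k) = 1" by (rule spacelike_normalize)
  define s :: real where "s = (if (c *\<^sub>R k) \<circ>\<^sub>L u i \<ge> 0 then 1 else -1)"
  show ?thesis
  proof
    show "(s *\<^sub>R c *\<^sub>R k) \<circ>\<^sub>L (s *\<^sub>R c *\<^sub>R k) = 1" using c(2) by (simp add: s_def lorentz_simps)
    show "(s *\<^sub>R c *\<^sub>R k) \<circ>\<^sub>L u j = 0" if "j \<in> idx - {i}" for j
      using that k' unfolding pqr(1) by (auto simp: lorentz_simps)
    show "(s *\<^sub>R c *\<^sub>R k) \<circ>\<^sub>L u i \<ge> 0" by (simp add: s_def lorentz_simps)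
  qed
qed

end

locale tet_model = tet_frame +
  fixes P H :: "nat \<Rightarrow> vec4 set" and x :: "nat \<Rightarrow> vec4"
  assumes P_eq: "\<And>i. i \<in> {1, 2} \<Longrightarrow> P i = plane (u i)"
    and H_eq: "\<And>i. i \<in> {1, 2} \<Longrightarrow> H i = half UNIV (- u i)"
    and x_eq: "x 3 = u 3" "x 4 = u 4"
begin

section \<open>The six joining lines and the side planes\<close>

definition line :: "nat \<Rightarrow> nat \<Rightarrow> vec4 set" where
  "line p q = span {u p, u q} \<inter> H3"

lemma line_commute: "line p q = line q p"
  by (simp add: line_def insert_commute)

lemma x_u: "j \<in> {3, 4} \<Longrightarrow> x j = u j" "j \<in> {3, 4} \<Longrightarrow> positive_lightlike (u j)"
  using x_eq light by auto

lemma unit_u: "i \<in> {1, 2} \<Longrightarrow> u i \<circ>\<^sub>L u i = 1"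
  using unit by auto

lemma common_perp_line:
  assumes "p \<in> {1, 2}" "q \<in> {1, 2}" "p \<noteq> q"
  shows "common_perp (P p) (P q) = line p q"
proof -
  have "1 < (u p \<circ>\<^sub>L u q)\<^sup>2" using u_gram[of p q] unit_u[OF assms(1)] unit_u[OF assms(2)] assms by auto
  then show ?thesis
    using common_perp_eq[OF unit_u[OF assms(1)] unit_u[OF assms(2)]] P_eq assms by (simp add: line_def)
qed

lemma perp_toward_line:
  assumes "i \<in> {1, 2}" "j \<in> {3, 4}"
  shows "perp_toward (P i) (x j) = line i j"
proof -
  have "u i \<circ>\<^sub>L u j \<noteq> 0" using u_neg[of i j] assms by force
  then show ?thesis
    using perp_toward_eq[OF unit_u[OF assms(1)] x_u(2)[OF assms(2)]] P_eq[OF assms(1)] x_u(1)[OF assms(2)]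
    by (simp add: line_def)
qed

lemma geodesic_joining_line:
  assumes "p \<in> {3, 4}" "q \<in> {3, 4}" "p \<noteq> q"
  shows "geodesic_joining (x p) (x q) = line p q"
proof -
  have "u p \<circ>\<^sub>L u q \<noteq> 0" using u_neg[of p q] assms by force
  then show ?thesis
    using geodesic_joining_eq[OF x_u(2)[OF assms(1)] x_u(2)[OF assms(2)]] x_u(1) assms by (simp add: line_def)
qed

lemma joining_line_eq:
  assumes "p \<in> idx" "q \<in> idx" "p \<noteq> q"
  shows "joining_line P x p q = line p q"
proof -
  have cases: "r \<le> 2 \<and> r \<in> {1, 2} \<or> \<not> r \<le> 2 \<and> r \<in> {3, 4}" if "r \<in> idx" for r
    using that by auto
  show ?thesis
    using cases[OF assms(1)] cases[OF assms(2)] common_perp_line[of p q] perp_toward_line[of p q]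
      perp_toward_line[of q p] geodesic_joining_line[of p q] assms(3) line_commute[of p q]
    unfolding joining_line_def by (elim disjE conjE) simp_all
qed

lemma line_flat: "p \<in> idx \<Longrightarrow> q \<in> idx \<Longrightarrow> p \<noteq> q \<Longrightarrow> flat 1 (span {u p, u q}) (line p q)"
  using flat_span_2(1)[OF u_gram] by (simp add: line_def)

lemma line_point:
  assumes "p \<in> idx" "q \<in> idx" "p \<noteq> q" "v \<in> line p q"
  obtains \<alpha> \<beta> where "v \<in> H3" "v = \<alpha> *\<^sub>R u p + \<beta> *\<^sub>R u q" "\<alpha> > 0" "\<beta> > 0"
  using assms line_point_coefficients[OF assms(1-3)] by (auto simp: line_def span_2)

lemma line_nonempty: "p \<in> idx \<Longrightarrow> q \<in> idx \<Longrightarrow> p \<noteq> q \<Longrightarrow> line p q \<noteq> {}"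
  using flat_has_point[OF line_flat] flatD(2)[OF line_flat] by (metis IntI empty_iff)

text \<open>For a unit normal, meeting a plane at right angles and containing an ideal point are the
  same linear condition, orthogonality to \<open>u j\<close>; three such conditions fix the normal
  up to sign.\<close>

lemma side_plane_eq:
  assumes i: "i \<in> idx" and m: "m \<circ>\<^sub>L m = 1" "\<And>j. j \<in> idx - {i} \<Longrightarrow> m \<circ>\<^sub>L u j = 0"
  shows "side_plane P x i = plane m"
proof -
  have cond: "(\<forall>j\<in>{1, 2} - {i}. orthogonal_planes (plane n) (P j)) \<and>
      (\<forall>j\<in>{3, 4} - {i}. x j \<in> ideal_boundary (plane n)) \<longleftrightarrow> (\<forall>j\<in>idx - {i}. n \<circ>\<^sub>L u j = 0)"
    if n: "n \<circ>\<^sub>L n = 1" for n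
  proof -
    have orth: "orthogonal_planes (plane n) (P j) \<longleftrightarrow> n \<circ>\<^sub>L u j = 0" if "j \<in> {1, 2}" for j
      using orthogonal_planes_iff[OF n unit_u[OF that]] P_eq[OF that] by simp
    have ideal: "x j \<in> ideal_boundary (plane n) \<longleftrightarrow> n \<circ>\<^sub>L u j = 0" if "j \<in> {3, 4}" for j
      using ideal_boundary_plane[of n] n x_u[OF that] by simp
    have split: "idx - {i} = ({1, 2} - {i}) \<union> ({3, 4} - {i})" by auto
    have "(\<forall>j\<in>{1, 2} - {i}. orthogonal_planes (plane n) (P j)) \<longleftrightarrow> (\<forall>j\<in>{1, 2} - {i}. n \<circ>\<^sub>L u j = 0)"
      using orth by blast
    moreover have "(\<forall>j\<in>{3, 4} - {i}. x j \<in> ideal_boundary (plane n)) \<longleftrightarrow> (\<forall>j\<in>{3, 4} - {i}. n \<circ>\<^sub>L u j = 0)"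
      using ideal by blast
    ultimately show ?thesis unfolding split ball_Un by blast
  qed
  obtain p q r where pqr: "idx - {i} = {p, q, r}" "p \<in> idx" "q \<in> idx" "r \<in> idx"
    "p \<noteq> q" "p \<noteq> r" "q \<noteq> r" by (rule complement_triple[OF i])
  show ?thesis
    unfolding side_plane_def
  proof (rule the_equality)
    have plane: "is_plane (plane m)" unfolding is_plane_iff using m(1) by blast
    have "\<forall>j\<in>idx - {i}. m \<circ>\<^sub>L u j = 0" using m(2) by blast
    from iffD2[OF cond[OF m(1)] this] plane
    show "is_plane (plane m) \<and> (\<forall>j\<in>{1, 2} - {i}. orthogonal_planes (plane m) (P j)) \<and>
        (\<forall>j\<in>{3, 4} - {i}. x j \<in> ideal_boundary (plane m))"
      by (rule conjI[rotated])
  next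
    fix Q assume Q: "is_plane Q \<and> (\<forall>j\<in>{1, 2} - {i}. orthogonal_planes Q (P j)) \<and>
        (\<forall>j\<in>{3, 4} - {i}. x j \<in> ideal_boundary Q)"
    have "is_plane Q" using Q by (rule conjunct1)
    then obtain n where n: "n \<circ>\<^sub>L n = 1" "Q = plane n" unfolding is_plane_iff by blast
    have all: "\<forall>j\<in>idx - {i}. n \<circ>\<^sub>L u j = 0"
      by (rule iffD1[OF cond[OF n(1)]]) (rule conjunct2[OF Q[unfolded n(2)]])
    have "n \<circ>\<^sub>L u j = 0 \<and> m \<circ>\<^sub>L u j = 0" if "j \<in> {p, q, r}" for j
      using all m(2) that unfolding pqr(1) by blast
    then have "perp n = perp m"
      using normal_unique[OF pqr(2-7) m(1) _ _ _ n(1)] by simp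
    then show "Q = plane m" using n(2) by simp
  qed
qed

lemma orthogonal_side_plane:
  assumes "i \<in> {1, 2}" "m \<circ>\<^sub>L m = 1"
  shows "orthogonal_planes (plane m) (P i) \<longleftrightarrow> m \<circ>\<^sub>L u i = 0"
  using orthogonal_planes_iff[OF assms(2) unit_u[OF assms(1)]] P_eq[OF assms(1)] by simp

section \<open>The common perpendicular of the two planes\<close>

definition X :: real where "X = - (u 1 \<circ>\<^sub>L u 2)"

text \<open>\<open>X\<close> and \<open>S\<close> are the hyperbolic cosine and sine of the distance
  between the planes.\<close>

definition S :: real where "S = sqrt (X\<^sup>2 - 1)"

text \<open>The component of \<open>u 2\<close> orthogonal to \<open>u 1\<close>, normalized to
  square -1; \<open>foot2\<close> is its mirror image under exchange of the planes.\<close>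

definition foot1 :: vec4 where
  "foot1 = (1 / S) *\<^sub>R (u 2 + X *\<^sub>R u 1)"

definition foot2 :: vec4 where
  "foot2 = (1 / S) *\<^sub>R (u 1 + X *\<^sub>R u 2)"

lemma X_gt_1: "X > 1" using u12 by (simp add: X_def)

lemma S_pos: "S > 0" and S_sq: "S * S = X * X - 1"
proof -
  have "X * X > 1 * 1" using X_gt_1 by (intro mult_strict_mono) auto
  then have "X\<^sup>2 - 1 > 0" by (simp add: power2_eq_square)
  then show "S > 0" "S * S = X * X - 1" by (simp_all add: S_def power2_eq_square)
qed

lemma S_cancel: "S * a = S * b \<longleftrightarrow> a = b"
  using S_pos by simp

lemma gram12: "u 1 \<circ>\<^sub>L u 2 = - X" "u 2 \<circ>\<^sub>L u 1 = - X"
  by (simp_all add: X_def lorentz_commute)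

lemma foot_eq: "S *\<^sub>R foot1 = u 2 + X *\<^sub>R u 1" "S *\<^sub>R foot2 = u 1 + X *\<^sub>R u 2"
  using S_pos by (simp_all add: foot1_def foot2_def)

lemma foot_gram:
  "foot1 \<circ>\<^sub>L foot1 = -1" "foot2 \<circ>\<^sub>L foot2 = -1" "foot1 \<circ>\<^sub>L foot2 = - X"
  "foot1 \<circ>\<^sub>L u 1 = 0" "foot2 \<circ>\<^sub>L u 2 = 0" "foot1 \<circ>\<^sub>L u 2 = - S" "foot2 \<circ>\<^sub>L u 1 = - S"
proof -
  have SS: "S\<^sup>2 = X * X - 1" using S_sq by (simp add: power2_eq_square)
  have l: "S * (foot1 \<circ>\<^sub>L v) = (u 2 + X *\<^sub>R u 1) \<circ>\<^sub>L v" "S * (foot2 \<circ>\<^sub>L v) = (u 1 + X *\<^sub>R u 2) \<circ>\<^sub>L v" for v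
    by (simp_all add: lorentz_scaleR_left flip: foot_eq)
  have "S * (foot1 \<circ>\<^sub>L u 1) = 0" "S * (foot2 \<circ>\<^sub>L u 2) = 0"
    unfolding l by (simp_all add: lorentz_simps gram12 unit)
  then show o: "foot1 \<circ>\<^sub>L u 1 = 0" "foot2 \<circ>\<^sub>L u 2 = 0" using S_pos by simp_all
  have "S * (foot1 \<circ>\<^sub>L u 2) = S * (- S)" "S * (foot2 \<circ>\<^sub>L u 1) = S * (- S)"
    unfolding l using S_sq by (simp_all add: lorentz_simps gram12 unit)
  then show s: "foot1 \<circ>\<^sub>L u 2 = - S" "foot2 \<circ>\<^sub>L u 1 = - S" by (simp_all only: S_cancel)
  have "S * (foot1 \<circ>\<^sub>L foot1) = S * (-1)" "S * (foot2 \<circ>\<^sub>L foot2) = S * (-1)" "S * (foot1 \<circ>\<^sub>L foot2) = S * (- X)"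
    unfolding l by (simp_all add: lorentz_simps o s lorentz_commute[of _ foot1] lorentz_commute[of _ foot2])
  then show "foot1 \<circ>\<^sub>L foot1 = -1" "foot2 \<circ>\<^sub>L foot2 = -1" "foot1 \<circ>\<^sub>L foot2 = - X"
    by (simp_all only: S_cancel)
qed

lemma foot_H3: "foot1 \<in> H3" "foot2 \<in> H3"
proof -
  have "S * (foot1 \<circ>\<^sub>L u 3) = (u 2 \<circ>\<^sub>L u 3) + X * (u 1 \<circ>\<^sub>L u 3)"
    "S * (foot2 \<circ>\<^sub>L u 3) = (u 1 \<circ>\<^sub>L u 3) + X * (u 2 \<circ>\<^sub>L u 3)"
    by (simp_all flip: lorentz_scaleR_left add: foot_eq) (simp_all add: lorentz_simps)
  moreover have "X * (u 1 \<circ>\<^sub>L u 3) < 0" "X * (u 2 \<circ>\<^sub>L u 3) < 0"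
    using X_gt_1 u13 u23 by (simp_all add: mult_pos_neg)
  ultimately have "S * (foot1 \<circ>\<^sub>L u 3) < 0" "S * (foot2 \<circ>\<^sub>L u 3) < 0" using u13 u23 by linarith+
  then have neg: "foot1 \<circ>\<^sub>L u 3 < 0" "foot2 \<circ>\<^sub>L u 3 < 0" using S_pos by (simp_all add: mult_less_0_iff)
  have l: "u 3 \<circ>\<^sub>L u 3 \<le> 0" "u 3 $ 1 > 0" using light by (simp_all add: positive_lightlike_def)
  have "foot1 $ 1 > 0" by (rule timelike_future[OF _ neg(1) l]) (simp add: foot_gram)
  then show "foot1 \<in> H3" by (simp add: H3_def foot_gram)
  have "foot2 $ 1 > 0" by (rule timelike_future[OF _ neg(2) l]) (simp add: foot_gram)
  then show "foot2 \<in> H3" by (simp add: H3_def foot_gram)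
qed

text \<open>\<open>l\<close> and \<open>k\<close> are the hyperbolic cosines of the distances of
  \<open>v\<close> and \<open>w\<close> to the feet. The translation carrying \<open>foot2\<close>
  to \<open>foot1\<close> moves \<open>w\<close> to \<open>w'\<close>, and
  \<open>- (v \<circ>\<^sub>L w)\<close> splits into \<open>- (v \<circ>\<^sub>L w')\<close>, at
  least 1, and \<open>l * k * (X - 1)\<close>, at least \<open>X - 1\<close>. Equality forces
  \<open>l = k = 1\<close>, which identifies the points with the feet.\<close>

lemma plane_distance_bound:
  assumes "v \<in> P 1" "w \<in> P 2"
  shows "X \<le> - (v \<circ>\<^sub>L w)" and "- (v \<circ>\<^sub>L w) = X \<Longrightarrow> v = foot1 \<and> w = foot2"
proof -
  have v: "v \<in> H3" "u 1 \<circ>\<^sub>L v = 0" "v \<circ>\<^sub>L u 1 = 0"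
    using assms(1) P_eq[of 1] by (auto simp: perp_def lorentz_commute)
  have w: "w \<in> H3" "u 2 \<circ>\<^sub>L w = 0" "w \<circ>\<^sub>L u 2 = 0"
    using assms(2) P_eq[of 2] by (auto simp: perp_def lorentz_commute)
  define l where "l = - (v \<circ>\<^sub>L foot1)"
  define k where "k = - (w \<circ>\<^sub>L foot2)"
  have l1: "l \<ge> 1" and k1: "k \<ge> 1"
    using H3_le(1)[OF v(1) foot_H3(1)] H3_le(1)[OF w(1) foot_H3(2)] by (simp_all add: l_def k_def)
  have vl: "v \<circ>\<^sub>L foot1 = - l" "foot1 \<circ>\<^sub>L v = - l" by (simp_all add: l_def lorentz_commute)
  have wk: "w \<circ>\<^sub>L foot2 = - k" "foot2 \<circ>\<^sub>L w = - k" by (simp_all add: k_def lorentz_commute)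
  have "v \<circ>\<^sub>L u 2 = S * (v \<circ>\<^sub>L foot1)" "S * (v \<circ>\<^sub>L foot2) = X * (v \<circ>\<^sub>L u 2)"
    by (simp_all flip: lorentz_scaleR_right add: foot_eq) (simp_all add: lorentz_simps v)
  then have "S * (v \<circ>\<^sub>L foot2) = S * (- X * l)" unfolding vl by simp
  then have vf2: "v \<circ>\<^sub>L foot2 = - X * l" by (simp only: S_cancel)
  have "w \<circ>\<^sub>L u 1 = S * (w \<circ>\<^sub>L foot2)" "S * (w \<circ>\<^sub>L foot1) = X * (w \<circ>\<^sub>L u 1)"
    by (simp_all flip: lorentz_scaleR_right add: foot_eq) (simp_all add: lorentz_simps w)
  then have "S * (w \<circ>\<^sub>L foot1) = S * (- X * k)" unfolding wk by simp
  then have wf1: "w \<circ>\<^sub>L foot1 = - X * k" by (simp only: S_cancel)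
  \<comment> \<open>Translating \<open>w\<close> along the common perpendicular from the second plane to the first.\<close>
  define w' where "w' = w - k *\<^sub>R foot2 + k *\<^sub>R foot1"
  have g: "foot1 \<circ>\<^sub>L w = - X * k" "foot2 \<circ>\<^sub>L foot1 = - X"
    using wf1 foot_gram(3) by (simp_all add: lorentz_commute)
  have ww: "w' \<circ>\<^sub>L w' = -1"
    by (simp add: w'_def lorentz_simps H3_sq[OF w(1)] foot_gram wk wf1 g algebra_simps)
  have wf: "w' \<circ>\<^sub>L foot1 = - k"
    by (simp add: w'_def lorentz_simps foot_gram wf1 g)
  have "w' $ 1 > 0"
    by (rule timelike_future[of w' foot1]) (use ww wf k1 foot_H3(1) in \<open>auto simp: H3_def\<close>)
  then have w'H: "w' \<in> H3" using ww by (simp add: H3_def)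
  define Z where "Z = l * k * (X - 1)"
  have eq: "- (v \<circ>\<^sub>L w) = - (v \<circ>\<^sub>L w') + Z"
    by (simp add: Z_def w'_def lorentz_simps vl vf2 algebra_simps)
  have vw': "- (v \<circ>\<^sub>L w') \<ge> 1" using H3_le(1)[OF v(1) w'H] by simp
  have lk: "l * k \<ge> 1" using mult_mono[of 1 l 1 k] l1 k1 by simp
  then have ZX: "Z \<ge> X - 1" unfolding Z_def using mult_right_mono[of 1 "l * k" "X - 1"] X_gt_1 by simp
  have "1 + (X - 1) \<le> - (v \<circ>\<^sub>L w') + Z" using vw' ZX by (rule add_mono)
  then show "X \<le> - (v \<circ>\<^sub>L w)" unfolding eq by simp
  assume "- (v \<circ>\<^sub>L w) = X"
  then have "X = - (v \<circ>\<^sub>L w') + Z" unfolding eq by simp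
  then have "Z \<le> 1 * (X - 1)" using vw' by simp
  then have "l * k \<le> 1" unfolding Z_def using X_gt_1 by (subst (asm) mult_le_cancel_right) simp
  moreover have "l * 1 \<le> l * k" "1 * k \<le> l * k"
    using l1 k1 by (auto intro!: mult_mono)
  ultimately have "l = 1 \<and> k = 1" using l1 k1 by linarith
  then show "v = foot1 \<and> w = foot2"
    using H3_le(2)[OF v(1) foot_H3(1)] H3_le(2)[OF w(1) foot_H3(2)] vl wk by simp
qed

lemma foot_in_plane: "foot1 \<in> P 1" "foot2 \<in> P 2"
  using P_eq foot_H3 foot_gram by (simp_all add: perp_def lorentz_commute[of "u 1"] lorentz_commute[of "u 2"])

lemma P_H3: "i \<in> {1, 2} \<Longrightarrow> v \<in> P i \<Longrightarrow> v \<in> H3"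
  using P_eq by blast

lemma plane_dist_eq: "plane_dist (P 1) (P 2) = arcosh X"
  unfolding plane_dist_def
proof (rule cInf_eq_minimum)
  have "dH foot1 foot2 = arcosh X" by (simp add: dH_def foot_gram)
  then show "arcosh X \<in> (\<lambda>(v, w). dH v w) ` (P 1 \<times> P 2)" using foot_in_plane by force
  fix d assume "d \<in> (\<lambda>(v, w). dH v w) ` (P 1 \<times> P 2)"
  then obtain v w where vw: "v \<in> P 1" "w \<in> P 2" "d = dH v w" by auto
  have "arcosh X \<ge> 0" "cosh (arcosh X) = X" using X_gt_1 by simp_all
  then show "arcosh X \<le> d"
    using dH_ge_iff[OF P_H3[OF _ vw(1)] P_H3[OF _ vw(2)], of "arcosh X"] plane_distance_bound(1)[OF vw(1,2)]
    by (simp add: vw(3))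
qed

lemma cosh_plane_dist: "cosh (plane_dist (P 1) (P 2)) = X"
  using X_gt_1 by (simp add: plane_dist_eq)

lemma shortest_arc_eq: "shortest_arc (P 1) (P 2) = geodesic_to foot1 foot2"
proof -
  have "p = foot1 \<and> q = foot2" if "p \<in> P 1" "q \<in> P 2" "dH p q = plane_dist (P 1) (P 2)" for p q
  proof -
    have "- (p \<circ>\<^sub>L q) = X"
      using cosh_dH[OF P_H3[OF _ that(1)] P_H3[OF _ that(2)]] cosh_plane_dist that(3) by simp
    then show ?thesis using plane_distance_bound(2)[OF that(1,2)] by blast
  qed
  moreover have "dH foot1 foot2 = plane_dist (P 1) (P 2)" by (simp add: plane_dist_eq dH_def foot_gram)
  ultimately show ?thesis
    unfolding shortest_arc_def using foot_in_plane by blast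
qed

section \<open>Edges and side half-spaces\<close>

lemma foot_in_span: "foot1 \<in> span {u 1, u 2}" "foot2 \<in> span {u 1, u 2}"
  unfolding foot1_def foot2_def by (intro span_scale span_add span_base; simp)+

lemma shortest_arc_subset: "shortest_arc (P 1) (P 2) \<subseteq> line 1 2"
  unfolding shortest_arc_eq line_def geodesic_to_def
  using foot_in_span by (auto intro!: span_add span_scale)

lemma perp_ray_subset:
  assumes "i \<in> {1, 2}" "j \<in> {3, 4}"
  shows "perp_ray (P i) (x j) \<subseteq> line i j" "perp_ray (P i) (x j) \<noteq> {}"
proof -
  have ij: "i \<in> idx" "j \<in> idx" "i \<noteq> j" using assms by auto
  have uj: "u j \<in> span {u i, u j}" "u i \<in> span {u i, u j}" by (simp_all add: span_base)
  show "perp_ray (P i) (x j) \<subseteq> line i j"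
    unfolding perp_ray_def perp_toward_line[OF assms] unfolding x_u(1)[OF assms(2)]
    using uj by (auto simp: line_def geodesic_to_def intro!: span_add span_scale)
  obtain p where p: "p \<in> span {u i, u j}" "p \<in> H3" "u i \<circ>\<^sub>L p = 0"
    using Lorentzian_point_on_hyperplane[OF line_flat[OF ij] uj(2)] unit_u[OF assms(1)] by auto
  have "p \<in> P i \<inter> perp_toward (P i) (x j)"
    using p P_eq[OF assms(1)] perp_toward_line[OF assms] by (simp add: perp_def line_def)
  moreover have "p \<in> geodesic_to p (x j)"
    unfolding geodesic_to_def using p(2) by (intro CollectI conjI exI[of _ 1] exI[of _ 0]) simp_all
  ultimately show "perp_ray (P i) (x j) \<noteq> {}" unfolding perp_ray_def by blast
qed

text \<open>The edges that select the side half-space \<open>i\<close> all lie on lines through the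
  object \<open>i\<close>, so their points have a positive coefficient at \<open>u i\<close>.
  Nonemptiness is what excludes the opposite half-space.\<close>

lemma opposite_edges_subset:
  assumes "i \<in> idx"
  shows "opposite_edges P x i \<subseteq> (\<Union>j\<in>idx - {i}. line i j)" "opposite_edges P x i \<noteq> {}"
proof -
  consider "i = 1" | "i = 2" | "i = 3" | "i = 4" using assms by auto
  then have "opposite_edges P x i \<subseteq> (\<Union>j\<in>idx - {i}. line i j) \<and> opposite_edges P x i \<noteq> {}"
  proof cases
    case 1
    have "opposite_edges P x i = shortest_arc (P 1) (P 2) \<union> perp_ray (P 1) (x 3) \<union> perp_ray (P 1) (x 4)"
      by (simp add: opposite_edges_def 1 shortest_arc_commute)
    then show ?thesis
      using shortest_arc_subset perp_ray_subset[of 1 3] perp_ray_subset[of 1 4] 1 by auto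
  next
    case 2
    have "opposite_edges P x i = shortest_arc (P 1) (P 2) \<union> perp_ray (P 2) (x 3) \<union> perp_ray (P 2) (x 4)"
      by (simp add: opposite_edges_def 2 flip: One_nat_def)
    then show ?thesis
      using shortest_arc_subset perp_ray_subset[of 2 3] perp_ray_subset[of 2 4] line_commute[of 1 2] 2 by auto
  next
    case 3
    have "opposite_edges P x i = line 1 3 \<union> line 2 3 \<union> line 3 4"
      using perp_toward_line[of 1 3] perp_toward_line[of 2 3] geodesic_joining_line[of 3 4]
      by (simp add: opposite_edges_def 3)
    then show ?thesis using line_nonempty[of 3 4] line_commute[of 3 1] line_commute[of 3 2] 3 by auto
  next
    case 4
    have "opposite_edges P x i = line 1 4 \<union> line 2 4 \<union> line 3 4"
      using perp_toward_line[of 1 4] perp_toward_line[of 2 4] geodesic_joining_line[of 3 4]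
      by (simp add: opposite_edges_def 4)
    then show ?thesis using line_nonempty[of 3 4] line_commute[of 4 1] line_commute[of 4 2] line_commute[of 4 3] 4 by auto
  qed
  then show "opposite_edges P x i \<subseteq> (\<Union>j\<in>idx - {i}. line i j)" "opposite_edges P x i \<noteq> {}" by auto
qed

lemma side_half_space_eq:
  assumes i: "i \<in> idx" and m: "m \<circ>\<^sub>L m = 1" "\<And>j. j \<in> idx - {i} \<Longrightarrow> m \<circ>\<^sub>L u j = 0" "m \<circ>\<^sub>L u i > 0"
  shows "side_half_space P x i = half UNIV m"
proof -
  have Q: "side_plane P x i = {v \<in> H3. m \<circ>\<^sub>L v = 0}"
    using side_plane_eq[OF i m(1,2)] by (auto simp: perp_def)
  have halves: "half_of H3 (side_plane P x i) K \<longleftrightarrow> K = half UNIV m \<or> K = half UNIV (- m)" for K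
    by (rule half_of_iff[OF flat_H3]) (use m(1) Q in auto)
  have pos: "v \<in> H3 \<and> m \<circ>\<^sub>L v > 0" if v: "v \<in> opposite_edges P x i" for v
  proof -
    obtain j where j: "j \<in> idx - {i}" "v \<in> line i j" using v opposite_edges_subset(1)[OF i] by blast
    then have ij: "j \<in> idx" "i \<noteq> j" by blast+
    obtain \<alpha> \<beta> where "v \<in> H3" "v = \<alpha> *\<^sub>R u i + \<beta> *\<^sub>R u j" "\<alpha> > 0"
      using line_point[OF i ij j(2)] by blast
    then show ?thesis using m(2)[OF j(1)] m(3) by (simp add: lorentz_simps)
  qed
  obtain v where v: "v \<in> opposite_edges P x i" using opposite_edges_subset(2)[OF i] by blast
  show ?thesis
    unfolding side_half_space_def halves
  proof (rule the_equality)
    show "(half UNIV m = half UNIV m \<or> half UNIV m = half UNIV (- m)) \<and> opposite_edges P x i \<subseteq> half UNIV m"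
      using pos by (auto simp: half_def less_imp_le)
    fix K assume K: "(K = half UNIV m \<or> K = half UNIV (- m)) \<and> opposite_edges P x i \<subseteq> K"
    then have "K \<noteq> half UNIV (- m)" using pos[OF v] v by (force simp: half_def lorentz_simps)
    then show "K = half UNIV m" using K by blast
  qed
qed

text \<open>In the degenerate case, all four vectors are orthogonal to \<open>m\<close>, and \<open>k\<close> is a normal,
  within the common plane, of the line joining the objects \<open>p\<close> and \<open>q\<close>. An object \<open>r \<le> 2\<close> is a
  line, whose position relative to this line is detected by the sign of a single product.\<close>

lemma side_of_object:
  assumes pqr: "p \<in> idx" "q \<in> idx" "r \<in> idx" "p \<noteq> q" "p \<noteq> r" "q \<noteq> r"
    and m: "m \<noteq> 0" "\<And>j. j \<in> idx \<Longrightarrow> m \<circ>\<^sub>L u j = 0"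
    and k: "m \<circ>\<^sub>L k = 0" "k \<circ>\<^sub>L u p = 0" "k \<circ>\<^sub>L u q = 0" "k \<circ>\<^sub>L u r > 0"
    and r: "r \<in> {1, 2}" and v: "v \<in> H3" "m \<circ>\<^sub>L v = 0" "u r \<circ>\<^sub>L v = 0"
  shows "k \<circ>\<^sub>L v > 0"
proof -
  have "k \<noteq> 0" using k(4) by (auto simp: lorentz_simps)
  then have kk: "k \<circ>\<^sub>L k > 0" using orthogonal_to_pair_spacelike[OF pqr(1,2,4) k(2,3)] by blast
  have mp: "m \<circ>\<^sub>L u p = 0" "m \<circ>\<^sub>L u q = 0" "m \<circ>\<^sub>L u r = 0" using m(2) pqr by blast+
  \<comment> \<open>The coordinate of \<open>v\<close> along \<open>k\<close>; since
    \<open>v - c *\<^sub>R k\<close> is orthogonal to \<open>k\<close>, its decomposition has no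
    \<open>u r\<close> term, and the claim becomes \<open>c > 0\<close>.\<close>
  define c where "c = (k \<circ>\<^sub>L v) / (k \<circ>\<^sub>L k)"
  have kv: "k \<circ>\<^sub>L v = c * (k \<circ>\<^sub>L k)" using kk by (simp add: c_def)
  obtain \<alpha> \<beta> \<gamma> where dec: "v - c *\<^sub>R k = \<alpha> *\<^sub>R u p + \<beta> *\<^sub>R u q + \<gamma> *\<^sub>R u r"
    by (rule decompose[OF pqr m(1) mp, of "v - c *\<^sub>R k"]) (use v(2) k(1) in \<open>simp add: lorentz_simps\<close>)
  have "k \<circ>\<^sub>L (v - c *\<^sub>R k) = \<gamma> * (k \<circ>\<^sub>L u r)" unfolding dec by (simp add: lorentz_simps k)
  then have "\<gamma> = 0" using k(4) kv by (simp add: lorentz_simps)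
  then have v_eq: "v = \<alpha> *\<^sub>R u p + \<beta> *\<^sub>R u q + c *\<^sub>R k" using dec by (simp add: algebra_simps)
  have G: "u p \<circ>\<^sub>L u q < 0" "u q \<circ>\<^sub>L u p < 0" "u r \<circ>\<^sub>L u p < 0" "u r \<circ>\<^sub>L u q < 0"
    using u_neg pqr by auto
  have k': "u p \<circ>\<^sub>L k = 0" "u q \<circ>\<^sub>L k = 0" "u r \<circ>\<^sub>L k > 0" using k by (simp_all add: lorentz_commute)
  have "-1 = \<alpha>\<^sup>2 * (u p \<circ>\<^sub>L u p) + 2 * (\<alpha> * \<beta>) * (u p \<circ>\<^sub>L u q) + \<beta>\<^sup>2 * (u q \<circ>\<^sub>L u q) + c\<^sup>2 * (k \<circ>\<^sub>L k)"
    using H3_sq[OF v(1)]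
    by (simp add: v_eq lorentz_simps k k' lorentz_commute[of "u q" "u p"] power2_eq_square algebra_simps)
  moreover have "\<alpha>\<^sup>2 * (u p \<circ>\<^sub>L u p) \<ge> 0" "\<beta>\<^sup>2 * (u q \<circ>\<^sub>L u q) \<ge> 0" "c\<^sup>2 * (k \<circ>\<^sub>L k) \<ge> 0"
    using u_sq_nonneg pqr kk by simp_all
  ultimately have "(\<alpha> * \<beta>) * (u p \<circ>\<^sub>L u q) < 0" by linarith
  then have ab: "\<alpha> * \<beta> > 0" using G(1) by (simp add: mult_less_0_iff)
  \<comment> \<open>As \<open>r\<close> numbers a plane, at least one of \<open>p\<close> and
    \<open>q\<close> numbers an ideal point; pairing \<open>v\<close> with that light-like vector
    leaves a single term and reveals its sign.\<close>
  have "\<alpha> > 0 \<or> \<beta> > 0"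
  proof (cases "q \<in> {3, 4}")
    case True
    then have q: "positive_lightlike (u q)" "u q \<circ>\<^sub>L u q = 0" using x_u(2) u_light_sq by auto
    then have "\<alpha> * (u p \<circ>\<^sub>L u q) < 0"
      using H3_lightlike_neg[OF v(1) q(1)] by (simp add: v_eq lorentz_simps k)
    then show ?thesis using G(1) by (simp add: mult_less_0_iff)
  next
    case False
    then have "p \<in> {3, 4}" using pqr r by auto
    then have p: "positive_lightlike (u p)" "u p \<circ>\<^sub>L u p = 0" using x_u(2) u_light_sq by auto
    then have "\<beta> * (u q \<circ>\<^sub>L u p) < 0"
      using H3_lightlike_neg[OF v(1) p(1)] by (simp add: v_eq lorentz_simps k)
    then show ?thesis using G(2) by (simp add: mult_less_0_iff)
  qed
  then have "\<alpha> > 0" "\<beta> > 0" using ab by (auto simp: zero_less_mult_iff)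
  \<comment> \<open>In \<open>u r \<circ>\<^sub>L v = 0\<close> the first two terms are negative, so
    the \<open>k\<close> term must be positive.\<close>
  then have "\<alpha> * (u r \<circ>\<^sub>L u p) < 0" "\<beta> * (u r \<circ>\<^sub>L u q) < 0" using G by (simp_all add: mult_pos_neg)
  moreover have "\<alpha> * (u r \<circ>\<^sub>L u p) + \<beta> * (u r \<circ>\<^sub>L u q) + c * (u r \<circ>\<^sub>L k) = 0"
    using v(3) by (simp add: v_eq lorentz_simps)
  ultimately have "c * (u r \<circ>\<^sub>L k) > 0" by linarith
  then have "c > 0" using k'(3) by (simp add: zero_less_mult_iff)
  then show ?thesis using kv kk by simp
qed

lemma line_in_plane:
  assumes pqr: "p \<in> idx" "q \<in> idx" "r \<in> idx" "p \<noteq> q" "p \<noteq> r" "q \<noteq> r"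
    and m: "m \<noteq> 0" "\<And>j. j \<in> idx \<Longrightarrow> m \<circ>\<^sub>L u j = 0"
    and k: "k \<circ>\<^sub>L u p = 0" "k \<circ>\<^sub>L u q = 0" "k \<circ>\<^sub>L u r \<noteq> 0"
  shows "line p q = {v \<in> plane m. k \<circ>\<^sub>L v = 0}"
proof
  show "line p q \<subseteq> {v \<in> plane m. k \<circ>\<^sub>L v = 0}"
    using m(2)[OF pqr(1)] m(2)[OF pqr(2)] k by (auto simp: line_def span_2 perp_def lorentz_simps)
  show "{v \<in> plane m. k \<circ>\<^sub>L v = 0} \<subseteq> line p q"
  proof
    fix v assume v: "v \<in> {v \<in> plane m. k \<circ>\<^sub>L v = 0}"
    obtain \<alpha> \<beta> \<gamma> where dec: "v = \<alpha> *\<^sub>R u p + \<beta> *\<^sub>R u q + \<gamma> *\<^sub>R u r"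
      by (rule decompose[OF pqr m(1) m(2)[OF pqr(1)] m(2)[OF pqr(2)] m(2)[OF pqr(3)], of v])
        (use v in \<open>simp add: perp_def\<close>)
    have "k \<circ>\<^sub>L v = 0" using v by blast
    then have "\<gamma> = 0" using k by (simp add: dec lorentz_simps)
    then have "v \<in> span {u p, u q}" unfolding span_2 using dec by auto
    then show "v \<in> line p q" using v by (simp add: line_def)
  qed
qed

text \<open>Lines and ideal points obey the same rule: the sign of \<open>k\<close> at
  \<open>u r\<close> selects exactly one half-plane. This uniqueness evaluates both the
  \<open>THE\<close> in \<open>edge_half_plane\<close> and the quantifiers in
  \<open>separates\<close>.\<close>

lemma object_in_half_iff:
  assumes pqr: "p \<in> idx" "q \<in> idx" "r \<in> idx" "p \<noteq> q" "p \<noteq> r" "q \<noteq> r"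
    and m: "m \<circ>\<^sub>L m = 1" "\<And>j. j \<in> idx \<Longrightarrow> m \<circ>\<^sub>L u j = 0"
    and k: "m \<circ>\<^sub>L k = 0" "k \<circ>\<^sub>L u p = 0" "k \<circ>\<^sub>L u q = 0" "k \<circ>\<^sub>L u r > 0"
  shows "object_in_half P x (plane m) (line p q) h r \<longleftrightarrow> h = half (perp m) k"
proof -
  have m0: "m \<noteq> 0" using m(1) by (auto simp: lorentz_simps)
  have "k \<noteq> 0" using k(4) by (auto simp: lorentz_simps)
  then have kk: "k \<circ>\<^sub>L k > 0" using orthogonal_to_pair_spacelike[OF pqr(1,2,4) k(2,3)] by blast
  have fl: "flat 2 (perp m) (plane m)" using m(1) by (intro flat_perp) simp
  have kp: "k \<in> perp m" using k(1) by (simp add: perp_def)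
  have kn: "- k \<in> perp m" "(- k) \<circ>\<^sub>L (- k) > 0" using k(1) kk by (simp_all add: perp_def lorentz_simps)
  have L: "line p q = {v \<in> plane m. k \<circ>\<^sub>L v = 0}"
    by (rule line_in_plane[OF pqr m0 m(2) k(2,3)]) (use k(4) in simp_all)
  then have L': "line p q = {v \<in> plane m. (- k) \<circ>\<^sub>L v = 0}" by (simp add: lorentz_simps)
  have halves: "half_of (plane m) (line p q) h \<longleftrightarrow> h = half (perp m) k \<or> h = half (perp m) (- k)"
    by (rule half_of_iff[OF fl kp kk L])
  show ?thesis
  proof (cases "r \<le> 2")
    case True
    then have r: "r \<in> {1, 2}" using pqr(3) by auto
    have side: "k \<circ>\<^sub>L v > 0" if "v \<in> P r \<inter> (plane m)" for v
      using side_of_object[OF pqr m0 m(2) k r, of v] that P_eq[OF r] by (auto simp: perp_def)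
    obtain v where "v \<in> H3" "m \<circ>\<^sub>L v = 0" "u r \<circ>\<^sub>L v = 0"
      using timelike_orthogonal_to_two[OF m(1) unit_u[OF r]] m(2)[OF pqr(3)] by auto
    then have v: "v \<in> P r \<inter> (plane m)" using P_eq[OF r] by (auto simp: perp_def)
    have "P r \<inter> (plane m) \<subseteq> half (perp m) k" using side by (force simp: half_def)
    moreover have "\<not> P r \<inter> (plane m) \<subseteq> half (perp m) (- k)"
    proof
      assume "P r \<inter> (plane m) \<subseteq> half (perp m) (- k)"
      then have "v \<in> half (perp m) (- k)" using v by blast
      then show False using side[OF v] by (simp add: half_def lorentz_simps)
    qed
    ultimately show ?thesis using halves True unfolding object_in_half_def by auto
  next
    case False
    then have r: "r \<in> {3, 4}" using pqr(3) by auto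
    have "half_ideal_boundary (plane m) (line p q) (half (perp m) k)
        = {y. positive_lightlike y \<and> y \<in> perp m \<and> 0 \<le> k \<circ>\<^sub>L y}"
      by (rule half_ideal_boundary_eq[OF fl kp kk L])
    then have "x r \<in> half_ideal_boundary (plane m) (line p q) (half (perp m) k)"
      using x_u[OF r] m(2)[OF pqr(3)] k(4) by (simp add: perp_def)
    moreover have "half_ideal_boundary (plane m) (line p q) (half (perp m) (- k))
        = {y. positive_lightlike y \<and> y \<in> perp m \<and> 0 \<le> (- k) \<circ>\<^sub>L y}"
      by (rule half_ideal_boundary_eq[OF fl kn L'])
    then have "x r \<notin> half_ideal_boundary (plane m) (line p q) (half (perp m) (- k))"
      using x_u[OF r] k(4) by (simp add: lorentz_simps)
    ultimately show ?thesis using halves False unfolding object_in_half_def by auto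
  qed
qed

text \<open>\<open>separates\<close> compares half-planes as sets, so opposite signs have to be seen
  to give different sets; a point pushed off the line tells them apart.\<close>

lemma half_neq_opposite:
  assumes "m \<circ>\<^sub>L m = 1" "m \<circ>\<^sub>L k = 0" "k \<circ>\<^sub>L k > 0"
  shows "half (perp m) k \<noteq> half (perp m) (- k)"
proof -
  have fl: "flat 2 (perp m) (plane m)" using assms(1) by (intro flat_perp) simp
  have kp: "k \<in> perp m" using assms(2) by (simp add: perp_def)
  obtain v where v: "v \<in> perp m" "v \<in> H3" "k \<circ>\<^sub>L v = 0"
    using Lorentzian_point_on_hyperplane[OF fl kp assms(3)] .
  have "push k v 1 \<in> H3" "k \<circ>\<^sub>L push k v 1 = 1 * (k \<circ>\<^sub>L k)"
    using push(1,2)[OF v(2,3) assms(3)] by blast+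
  moreover have "push k v 1 \<in> perp m" using push(3)[OF v(2,3) assms(3) subspace_perp v(1) kp] .
  ultimately have "push k v 1 \<in> half (perp m) k" "push k v 1 \<notin> half (perp m) (- k)"
    using assms(3) by (simp_all add: half_def lorentz_simps)
  then show ?thesis by blast
qed

text \<open>The sign is normalized at \<open>u r\<close>, so that the sign at \<open>u s\<close>
  alone records whether the line separates \<open>r\<close> from \<open>s\<close>. Neither product
  can vanish, as \<open>k\<close> would then be orthogonal to \<open>m\<close> and to three of the
  vectors.\<close>

lemma line_normal:
  assumes pqrs: "{p, q, r, s} = idx" "p \<noteq> q" "p \<noteq> r" "p \<noteq> s" "q \<noteq> r" "q \<noteq> s" "r \<noteq> s"
    and m: "m \<circ>\<^sub>L m = 1" "\<And>j. j \<in> idx \<Longrightarrow> m \<circ>\<^sub>L u j = 0"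
  obtains k where "m \<circ>\<^sub>L k = 0" "k \<circ>\<^sub>L u p = 0" "k \<circ>\<^sub>L u q = 0" "k \<circ>\<^sub>L u r > 0" "k \<circ>\<^sub>L u s \<noteq> 0" "k \<circ>\<^sub>L k > 0"
proof -
  have i: "p \<in> idx" "q \<in> idx" "r \<in> idx" "s \<in> idx" using pqrs(1) by blast+
  have m0: "m \<noteq> 0" using m(1) by (auto simp: lorentz_simps)
  obtain k0 where k0: "k0 \<noteq> 0" "m \<circ>\<^sub>L k0 = 0" "u p \<circ>\<^sub>L k0 = 0" "u q \<circ>\<^sub>L k0 = 0"
    by (rule common_normal_exists)
  then have k0': "k0 \<circ>\<^sub>L u p = 0" "k0 \<circ>\<^sub>L u q = 0" by (simp_all add: lorentz_commute)
  have nz: "k0 \<circ>\<^sub>L u j \<noteq> 0" if j: "j \<in> idx" "p \<noteq> j" "q \<noteq> j" for j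
    using orthogonal_to_triple_zero[OF i(1,2) j(1) pqrs(2) j(2,3) m0 m(2)[OF i(1)] m(2)[OF i(2)]
        m(2)[OF j(1)] k0(2) k0'] k0(1) by blast
  have kk: "k0 \<circ>\<^sub>L k0 > 0" by (rule orthogonal_to_pair_spacelike[OF i(1,2) pqrs(2) k0' k0(1)])
  define k where "k = (if k0 \<circ>\<^sub>L u r > 0 then k0 else - k0)"
  show ?thesis
  proof
    show "m \<circ>\<^sub>L k = 0" "k \<circ>\<^sub>L u p = 0" "k \<circ>\<^sub>L u q = 0" "k \<circ>\<^sub>L k > 0"
      using k0 k0' kk by (simp_all add: k_def lorentz_simps)
    show "k \<circ>\<^sub>L u r > 0" "k \<circ>\<^sub>L u s \<noteq> 0"
      using nz[OF i(3) pqrs(3,5)] nz[OF i(4) pqrs(4,6)] by (auto simp: k_def lorentz_simps)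
  qed
qed

text \<open>The common normal forces a relation, and a vanishing coefficient would leave a relation
  among three independent vectors.\<close>

lemma linear_relation:
  assumes m: "m \<circ>\<^sub>L m = 1" "\<And>j. j \<in> idx \<Longrightarrow> m \<circ>\<^sub>L u j = 0"
  obtains c :: "nat \<Rightarrow> real" where "(\<Sum>j\<in>idx. c j *\<^sub>R u j) = 0" "\<forall>j\<in>idx. c j \<noteq> 0"
proof -
  have m0: "m \<noteq> 0" using m(1) by (auto simp: lorentz_simps)
  have o: "u 1 \<circ>\<^sub>L m = 0" "u 2 \<circ>\<^sub>L m = 0" "u 3 \<circ>\<^sub>L m = 0" "u 4 \<circ>\<^sub>L m = 0"
    using m(2) by (simp_all add: lorentz_commute)
  obtain a b c d where rel: "a *\<^sub>R u 1 + b *\<^sub>R u 2 + c *\<^sub>R u 3 + d *\<^sub>R u 4 = 0"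
    "a \<noteq> 0 \<or> b \<noteq> 0 \<or> c \<noteq> 0 \<or> d \<noteq> 0"
    using orthogonal_dependent[OF m0 o] .
  define C where "C = (\<lambda>j :: nat. if j = 1 then a else if j = 2 then b else if j = 3 then c else d)"
  have C: "C 1 = a" "C 2 = b" "C 3 = c" "C 4 = d" by (simp_all add: C_def)
  have "a \<noteq> 0" using rel triple_independent[of 2 3 4 b c d] by auto
  moreover have "b \<noteq> 0" using rel triple_independent[of 1 3 4 a c d] by auto
  moreover have "c \<noteq> 0" using rel triple_independent[of 1 2 4 a b d] by auto
  moreover have "d \<noteq> 0" using rel triple_independent[of 1 2 3 a b c] by auto
  ultimately show ?thesis using rel(1) C by (intro that[of C]) (auto simp: algebra_simps)
qed

section \<open>The sign pattern of the relation in the degenerate case\<close>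

context
  fixes m :: vec4 and c :: "nat \<Rightarrow> real"
  assumes m_unit: "m \<circ>\<^sub>L m = 1" and m_perp: "\<And>j. j \<in> idx \<Longrightarrow> m \<circ>\<^sub>L u j = 0"
    and rel: "(\<Sum>j\<in>idx. c j *\<^sub>R u j) = 0" and c_nz: "\<And>j. j \<in> idx \<Longrightarrow> c j \<noteq> 0"
begin

lemma rel_dot: "c 1 * (v \<circ>\<^sub>L u 1) + c 2 * (v \<circ>\<^sub>L u 2) + c 3 * (v \<circ>\<^sub>L u 3) + c 4 * (v \<circ>\<^sub>L u 4) = 0"
  using arg_cong[OF rel, of "\<lambda>w. v \<circ>\<^sub>L w"] by (simp add: lorentz_simps)

text \<open>Pairing the relation with \<open>u 3\<close> and \<open>u 4\<close>, whose squares vanish, excludes three equal signs.\<close>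

lemma no_three_positive:
  assumes "s \<noteq> 0" "p \<in> idx" "q \<in> idx" "r \<in> idx" "p \<noteq> q" "p \<noteq> r" "q \<noteq> r"
  shows "\<not> (s * c p > 0 \<and> s * c q > 0 \<and> s * c r > 0)"
proof -
  \<comment> \<open>The factor \<open>s\<close> serves to exclude three negative coefficients as
    well, by taking it to be -1.\<close>
  define C where "C = (\<lambda>j. s * c j)"
  have dot: "C 1 * (v \<circ>\<^sub>L u 1) + C 2 * (v \<circ>\<^sub>L u 2) + C 3 * (v \<circ>\<^sub>L u 3) + C 4 * (v \<circ>\<^sub>L u 4) = 0" for v
  proof -
    have "C 1 * (v \<circ>\<^sub>L u 1) + C 2 * (v \<circ>\<^sub>L u 2) + C 3 * (v \<circ>\<^sub>L u 3) + C 4 * (v \<circ>\<^sub>L u 4)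
       = s * (c 1 * (v \<circ>\<^sub>L u 1) + c 2 * (v \<circ>\<^sub>L u 2) + c 3 * (v \<circ>\<^sub>L u 3) + c 4 * (v \<circ>\<^sub>L u 4))"
      by (simp add: C_def algebra_simps)
    then show ?thesis using rel_dot[of v] by simp
  qed
  have neg: "C j * (u i \<circ>\<^sub>L u j) < 0" if "C j > 0" "i \<in> idx" "j \<in> idx" "i \<noteq> j" for i j
    using that u_neg by (simp add: mult_pos_neg)
  have a: "\<not> (C 1 > 0 \<and> C 2 > 0 \<and> C 3 > 0)"
    using dot[of "u 4"] neg[of 1 4] neg[of 2 4] neg[of 3 4] u_light_sq by auto
  have b: "\<not> (C 1 > 0 \<and> C 2 > 0 \<and> C 4 > 0)"
    using dot[of "u 3"] neg[of 1 3] neg[of 2 3] neg[of 4 3] u_light_sq by auto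
  \<comment> \<open>Pairing with a unit normal has a nonzero diagonal term, so it gives no
    contradiction at once; it makes the fourth coefficient positive, which leads back to case
    \<open>a\<close>.\<close>
  have "C 1 > 0" if "C 2 > 0" "C 3 > 0" "C 4 > 0"
    using that dot[of "u 1"] neg[of 2 1] neg[of 3 1] neg[of 4 1] unit by auto
  moreover have "C 2 > 0" if "C 1 > 0" "C 3 > 0" "C 4 > 0"
    using that dot[of "u 2"] neg[of 1 2] neg[of 3 2] neg[of 4 2] unit by auto
  ultimately have d: "\<not> (C 2 > 0 \<and> C 3 > 0 \<and> C 4 > 0)" "\<not> (C 1 > 0 \<and> C 3 > 0 \<and> C 4 > 0)"
    using a by blast+
  have "\<not> (C p > 0 \<and> C q > 0 \<and> C r > 0)"
    using assms(2-) by (elim insertE emptyE; hypsubst; use a b d in blast)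
  then show ?thesis by (simp add: C_def)
qed

text \<open>With three equal signs excluded, a pair of equal signs leaves the opposite sign to the
  other two coefficients.\<close>

lemma balanced:
  assumes "{p, q, r, s} = idx" "p \<noteq> q" "p \<noteq> r" "p \<noteq> s" "q \<noteq> r" "q \<noteq> s" "r \<noteq> s"
    and "c r * c s > 0"
  shows "c p * c r < 0"
proof -
  have i: "p \<in> idx" "r \<in> idx" "s \<in> idx" using assms(1) by blast+
  then have nz: "c p \<noteq> 0" "c r \<noteq> 0" "c s \<noteq> 0" using c_nz by blast+
  have "\<not> (c p > 0 \<and> c r > 0 \<and> c s > 0)" "\<not> (c p < 0 \<and> c r < 0 \<and> c s < 0)"
    using no_three_positive[of 1 p r s] no_three_positive[of "-1" p r s] i assms(3,4,7) by auto
  then show ?thesis using nz assms(8) by (auto simp: zero_less_mult_iff mult_less_0_iff)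
qed

text \<open>Pairing the relation with \<open>k\<close> kills the terms of \<open>p\<close> and
  \<open>q\<close>, so the contributions of \<open>r\<close> and \<open>s\<close> cancel.\<close>

lemma relation_sign:
  assumes pqrs: "{p, q, r, s} = idx" "p \<noteq> q" "p \<noteq> r" "p \<noteq> s" "q \<noteq> r" "q \<noteq> s" "r \<noteq> s"
    and k: "k \<circ>\<^sub>L u p = 0" "k \<circ>\<^sub>L u q = 0" "k \<circ>\<^sub>L u r > 0"
  shows "k \<circ>\<^sub>L u s > 0 \<longleftrightarrow> c r * c s < 0"
proof -
  have nz: "c r \<noteq> 0" "c s \<noteq> 0" using c_nz pqrs(1) by blast+
  have "(\<Sum>j\<in>{p, q, r, s}. c j * (k \<circ>\<^sub>L u j)) = 0"
    unfolding pqrs(1) using rel_dot[of k] by simp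
  then have "c r * (k \<circ>\<^sub>L u r) + c s * (k \<circ>\<^sub>L u s) = 0" using pqrs(2-) k by simp
  then have "k \<circ>\<^sub>L u r = - (c s * (k \<circ>\<^sub>L u s) / c r)" using nz by (simp add: field_simps)
  then have "c r * c s * (k \<circ>\<^sub>L u s) = - ((c r)\<^sup>2 * (k \<circ>\<^sub>L u r))"
    using nz by (simp add: power2_eq_square)
  moreover have "(c r)\<^sup>2 * (k \<circ>\<^sub>L u r) > 0" using k(3) nz by simp
  ultimately have "(c r * c s) * (k \<circ>\<^sub>L u s) < 0" by linarith
  then have "(c r * c s > 0 \<and> k \<circ>\<^sub>L u s < 0) \<or> (c r * c s < 0 \<and> k \<circ>\<^sub>L u s > 0)"
    unfolding mult_less_0_iff[of "c r * c s"] .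
  then show ?thesis by linarith
qed

text \<open>Each of \<open>r\<close> and \<open>s\<close> determines its half-plane, so separation
  means that \<open>k\<close> has opposite signs at the two, which the relation turns into equal
  signs of their coefficients.\<close>

lemma separates_iff:
  assumes pqrs: "{p, q, r, s} = idx" "p \<noteq> q" "p \<noteq> r" "p \<noteq> s" "q \<noteq> r" "q \<noteq> s" "r \<noteq> s"
  shows "separates P x (plane m) (joining_line P x p q) r s \<longleftrightarrow> c r * c s > 0"
proof -
  have i: "p \<in> idx" "q \<in> idx" "r \<in> idx" "s \<in> idx" using pqrs(1) by blast+
  obtain k where k: "m \<circ>\<^sub>L k = 0" "k \<circ>\<^sub>L u p = 0" "k \<circ>\<^sub>L u q = 0" "k \<circ>\<^sub>L u r > 0" "k \<circ>\<^sub>L u s \<noteq> 0" "k \<circ>\<^sub>L k > 0"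
    by (rule line_normal[OF pqrs m_unit m_perp])
  have r: "object_in_half P x (plane m) (line p q) h r \<longleftrightarrow> h = half (perp m) k" for h
    by (rule object_in_half_iff[OF i(1,2,3) pqrs(2,3,5) m_unit m_perp k(1-4)])
  have sign: "k \<circ>\<^sub>L u s > 0 \<longleftrightarrow> c r * c s < 0" by (rule relation_sign[OF pqrs k(2,3,4)])
  have nz: "c r * c s \<noteq> 0" using c_nz i by simp
  show ?thesis
  proof (cases "k \<circ>\<^sub>L u s > 0")
    case True
    have s: "object_in_half P x (plane m) (line p q) h s \<longleftrightarrow> h = half (perp m) k" for h
      by (rule object_in_half_iff[OF i(1,2,4) pqrs(2,4,6) m_unit m_perp k(1-3) True])
    have "\<not> c r * c s > 0" using sign True by linarith
    then show ?thesis unfolding separates_def joining_line_eq[OF i(1,2) pqrs(2)] r s by blast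
  next
    case False
    then have neg: "(- k) \<circ>\<^sub>L u s > 0" using k(5) by (simp add: lorentz_simps)
    have k': "m \<circ>\<^sub>L (- k) = 0" "(- k) \<circ>\<^sub>L u p = 0" "(- k) \<circ>\<^sub>L u q = 0" using k by (simp_all add: lorentz_simps)
    have s: "object_in_half P x (plane m) (line p q) h s \<longleftrightarrow> h = half (perp m) (- k)" for h
      by (rule object_in_half_iff[OF i(1,2,4) pqrs(2,4,6) m_unit m_perp k' neg])
    have "\<not> c r * c s < 0" using sign False by blast
    then have "c r * c s > 0" using nz by linarith
    then show ?thesis
      unfolding separates_def joining_line_eq[OF i(1,2) pqrs(2)] r s
      using half_neq_opposite[OF m_unit k(1,6)] by blast
  qed
qed

text \<open>Coefficients of opposite signs put \<open>r\<close> and \<open>s\<close> on the same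
  side of the line. The normal \<open>k\<close> is then nonnegative on all four vectors, hence on
  every positive combination of two of them.\<close>

lemma edge_half_plane_contains:
  assumes pqrs: "{p, q, r, s} = idx" "p \<noteq> q" "p \<noteq> r" "p \<noteq> s" "q \<noteq> r" "q \<noteq> s" "r \<noteq> s"
    and opp: "c r * c s < 0"
    and v: "a \<in> idx" "b \<in> idx" "a \<noteq> b" "v \<in> line a b"
  shows "v \<in> edge_half_plane P x (plane m) p q"
proof -
  have i: "p \<in> idx" "q \<in> idx" "r \<in> idx" "s \<in> idx" using pqrs(1) by blast+
  obtain k where k: "m \<circ>\<^sub>L k = 0" "k \<circ>\<^sub>L u p = 0" "k \<circ>\<^sub>L u q = 0" "k \<circ>\<^sub>L u r > 0" "k \<circ>\<^sub>L u s \<noteq> 0" "k \<circ>\<^sub>L k > 0"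
    by (rule line_normal[OF pqrs m_unit m_perp])
  have ks: "k \<circ>\<^sub>L u s > 0" using relation_sign[OF pqrs k(2,3,4)] opp by blast
  have r: "object_in_half P x (plane m) (line p q) h r \<longleftrightarrow> h = half (perp m) k" for h
    by (rule object_in_half_iff[OF i(1,2,3) pqrs(2,3,5) m_unit m_perp k(1-4)])
  have s: "object_in_half P x (plane m) (line p q) h s \<longleftrightarrow> h = half (perp m) k" for h
    by (rule object_in_half_iff[OF i(1,2,4) pqrs(2,4,6) m_unit m_perp k(1-3) ks])
  have "{p, q, r, s} - {p, q} = {r, s}" using pqrs(2-) by auto
  then have "idx - {p, q} = {r, s}" unfolding pqrs(1) .
  then have "edge_half_plane P x (plane m) p q = half (perp m) k"
    unfolding edge_half_plane_def joining_line_eq[OF i(1,2) pqrs(2)] by (simp add: r s)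
  moreover have "v \<in> half (perp m) k"
  proof -
    obtain \<alpha> \<beta> where ab: "v \<in> H3" "v = \<alpha> *\<^sub>R u a + \<beta> *\<^sub>R u b" "\<alpha> > 0" "\<beta> > 0"
      by (rule line_point[OF v])
    have "k \<circ>\<^sub>L u j \<ge> 0" if "j \<in> idx" for j
    proof -
      have "j \<in> {p, q, r, s}" using that pqrs(1) by blast
      then show ?thesis using k ks by auto
    qed
    then show ?thesis
      using ab m_perp[OF v(1)] m_perp[OF v(2)] v(1,2) by (simp add: half_def perp_def lorentz_simps)
  qed
  ultimately show ?thesis by simp
qed

text \<open>Guarantees that the numbering chosen by \<open>SOME\<close> has the separation
  property.\<close>

lemma good_numbering_exists: "\<exists>\<sigma>. good_numbering P x (plane m) \<sigma>"
proof -
  have ex: "\<exists>\<sigma>. good_numbering P x (plane m) \<sigma>"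
    if pqrs: "{p, q, r, s} = idx" "p \<noteq> q" "p \<noteq> r" "p \<noteq> s" "q \<noteq> r" "q \<noteq> s" "r \<noteq> s" "c r * c s > 0" for p q r s
  proof -
    \<comment> \<open>The line joins the objects numbered 1 and 3, so \<open>p\<close> and
      \<open>q\<close> take these places and the separated \<open>r\<close> and \<open>s\<close>
      take 2 and 4.\<close>
    define \<sigma> where "\<sigma> = (\<lambda>j :: nat. if j = 1 then p else if j = 2 then r else if j = 3 then q else s)"
    have \<sigma>: "\<sigma> 1 = p" "\<sigma> 2 = r" "\<sigma> 3 = q" "\<sigma> 4 = s" by (simp_all add: \<sigma>_def)
    have "inj_on \<sigma> idx" using pqrs by (simp add: \<sigma>)
    moreover have "\<sigma> ` idx = {p, r, q, s}" by (simp add: \<sigma>)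
    moreover have "{p, r, q, s} = {p, q, r, s}" by blast
    ultimately have "bij_betw \<sigma> idx idx" using pqrs(1) unfolding bij_betw_def by simp
    then have "good_numbering P x (plane m) \<sigma>"
      unfolding good_numbering_def \<sigma> using separates_iff[OF pqrs(1-7)] pqrs(8) by blast
    then show ?thesis by blast
  qed
  have nz: "c 1 \<noteq> 0" "c 2 \<noteq> 0" "c 3 \<noteq> 0" using c_nz by auto
  \<comment> \<open>Of three nonzero coefficients two have the same sign; these two become the
    separated objects.\<close>
  have "c 1 * c 2 > 0 \<or> c 1 * c 3 > 0 \<or> c 2 * c 3 > 0"
    using nz by (auto simp: zero_less_mult_iff)
  then show ?thesis
  proof (elim disjE)
    assume "c 1 * c 2 > 0" then show ?thesis by (intro ex[of 3 4 1 2]) auto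
  next
    assume "c 1 * c 3 > 0" then show ?thesis by (intro ex[of 2 4 1 3]) auto
  next
    assume "c 2 * c 3 > 0" then show ?thesis by (intro ex[of 1 4 2 3]) auto
  qed
qed

text \<open>The numbering is arbitrary among the good ones. Separation gives equal signs to the
  objects numbered 2 and 4, and balance gives the opposite sign to 1 and 3. Each of the four cyclic
  edges joins objects of unlike sign, so the remaining two are also unlike and lie on one side of
  it.\<close>

lemma in_edge_half_planes:
  assumes \<sigma>: "good_numbering P x (plane m) \<sigma>"
    and v: "a \<in> idx" "b \<in> idx" "a \<noteq> b" "v \<in> line a b"
    and e: "(e, f) \<in> {(1, 2), (2, 3), (3, 4), (1, 4)}"
  shows "v \<in> edge_half_plane P x (plane m) (\<sigma> e) (\<sigma> f)"
proof -
  define p q r s where pqrs_def: "p = \<sigma> 1" "q = \<sigma> 3" "r = \<sigma> 2" "s = \<sigma> 4"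
  have bij: "bij_betw \<sigma> idx idx" and sep: "separates P x (plane m) (joining_line P x p q) r s"
    using \<sigma> by (simp_all add: good_numbering_def pqrs_def)
  have inj: "inj_on \<sigma> idx" and im: "\<sigma> ` idx = idx" using bij by (simp_all add: bij_betw_def)
  have ne: "p \<noteq> q" "p \<noteq> r" "p \<noteq> s" "q \<noteq> r" "q \<noteq> s" "r \<noteq> s"
    using inj unfolding pqrs_def inj_on_def by (force+)
  have all: "{p, q, r, s} = idx" using im unfolding pqrs_def by auto
  have rs: "c r * c s > 0" using separates_iff[OF all ne] sep by blast
  have perm: "{q, p, r, s} = idx" "{p, q, s, r} = idx" "{q, p, s, r} = idx" using all by blast+
  have sr: "c s * c r > 0" using rs by (simp add: mult.commute)
  have pr: "c p * c r < 0" by (rule balanced[OF all ne rs])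
  have qr: "c q * c r < 0" by (rule balanced[OF perm(1)]) (use ne rs in auto)
  have ps: "c p * c s < 0" by (rule balanced[OF perm(2)]) (use ne sr in auto)
  have qs: "c q * c s < 0" by (rule balanced[OF perm(3)]) (use ne sr in auto)
  have edges: "{p, r, q, s} = idx" "{r, q, p, s} = idx" "{q, s, p, r} = idx" "{p, s, q, r} = idx"
    using all by blast+
  have 1: "v \<in> edge_half_plane P x (plane m) p r"
    by (rule edge_half_plane_contains[OF edges(1) _ _ _ _ _ _ qs v]) (use ne in auto)
  have 2: "v \<in> edge_half_plane P x (plane m) r q"
    by (rule edge_half_plane_contains[OF edges(2) _ _ _ _ _ _ ps v]) (use ne in auto)
  have 3: "v \<in> edge_half_plane P x (plane m) q s"
    by (rule edge_half_plane_contains[OF edges(3) _ _ _ _ _ _ pr v]) (use ne in auto)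
  have 4: "v \<in> edge_half_plane P x (plane m) p s"
    by (rule edge_half_plane_contains[OF edges(4) _ _ _ _ _ _ qr v]) (use ne in auto)
  show ?thesis using e 1 2 3 4 unfolding pqrs_def by auto
qed

end

text \<open>The side faces contain all points of the six lines, so only membership in
  \<open>H 1\<close> and \<open>H 2\<close> has to be supplied.\<close>

lemma in_trunc_tet:
  assumes ab: "a \<in> idx" "b \<in> idx" "a \<noteq> b" "v \<in> line a b" and vH: "v \<in> H 1" "v \<in> H 2"
  shows "v \<in> trunc_tet P H x"
proof -
  obtain \<alpha> \<beta> where v: "v \<in> H3" "v = \<alpha> *\<^sub>R u a + \<beta> *\<^sub>R u b" "\<alpha> > 0" "\<beta> > 0"
    by (rule line_point[OF ab])
  show ?thesis
  proof (cases "orthogonal_planes (side_plane P x 1) (P 1)")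
    case False
    have "v \<in> side_half_space P x i" if i: "i \<in> idx" for i
    proof -
      obtain n where n: "n \<circ>\<^sub>L n = 1" "\<And>j. j \<in> idx - {i} \<Longrightarrow> n \<circ>\<^sub>L u j = 0" "n \<circ>\<^sub>L u i \<ge> 0"
        by (rule side_normal_exists[OF i]) blast
      \<comment> \<open>A zero product would make \<open>n\<close> normal to all four vectors, which
        is the degenerate case.\<close>
      have "n \<circ>\<^sub>L u i \<noteq> 0"
      proof
        assume 0: "n \<circ>\<^sub>L u i = 0"
        have all: "n \<circ>\<^sub>L u j = 0" if "j \<in> idx" for j
          using 0 n(2)[of j] that by (cases "j = i") auto
        then have "side_plane P x 1 = plane n" by (intro side_plane_eq n(1)) auto
        then show False using False orthogonal_side_plane[OF _ n(1), of 1] all by simp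
      qed
      then have pos: "n \<circ>\<^sub>L u i > 0" using n(3) by simp
      have "n \<circ>\<^sub>L u j \<ge> 0" if "j \<in> idx" for j
        using n(2)[of j] n(3) that by (cases "j = i") auto
      then have "v \<in> half UNIV n" using v ab(1,2) by (simp add: half_def lorentz_simps)
      then show ?thesis using side_half_space_eq[OF i n(1,2) pos] by simp
    qed
    then show ?thesis using vH False unfolding trunc_tet_def by auto
  next
    case True
    have 1: "1 \<in> idx" by simp
    obtain n where n: "n \<circ>\<^sub>L n = 1" "\<And>j. j \<in> idx - {1} \<Longrightarrow> n \<circ>\<^sub>L u j = 0" "n \<circ>\<^sub>L u 1 \<ge> 0"
      by (rule side_normal_exists[OF 1]) blast
    have Q: "side_plane P x 1 = plane n" by (rule side_plane_eq[OF 1 n(1,2)])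
    have "n \<circ>\<^sub>L u 1 = 0" using True orthogonal_side_plane[OF _ n(1), of 1] Q by simp
    then have all: "n \<circ>\<^sub>L u j = 0" if "j \<in> idx" for j
      using n(2)[of j] that by (cases "j = 1") auto
    obtain c where c: "(\<Sum>j\<in>idx. c j *\<^sub>R u j) = 0" "\<forall>j\<in>idx. c j \<noteq> 0"
      by (rule linear_relation[OF n(1) all])
    note c = c(1) c(2)[rule_format]
    define \<sigma> where "\<sigma> = (SOME \<sigma>. good_numbering P x (plane n) \<sigma>)"
    have "good_numbering P x (plane n) \<sigma>"
      unfolding \<sigma>_def by (rule someI_ex[OF good_numbering_exists[OF n(1) all c]])
    note edge = in_edge_half_planes[OF n(1) all c this ab]
    have vQ: "v \<in> plane n"
      using v all[OF ab(1)] all[OF ab(2)] by (simp add: perp_def lorentz_simps)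
    show ?thesis
      using True edge[of 1 2] edge[of 2 3] edge[of 3 4] edge[of 1 4] vQ vH
      unfolding trunc_tet_def Q Let_def \<sigma>_def[symmetric] by simp
  qed
qed

end

section \<open>Arc-length parametrizations\<close>

text \<open>After subtracting \<open>g 0\<close> the map preserves products, and comparison with its
  value at 1, which serves as \<open>e\<close>, gives linearity. The form \<open>e * e = 1\<close>
  avoids splitting into orientations later.\<close>

lemma isometry_real_affine:
  fixes g :: "real \<Rightarrow> real"
  assumes "\<And>s t. \<bar>g s - g t\<bar> = \<bar>s - t\<bar>"
  obtains e where "e * e = 1" "\<forall>s. g s = e * s + g 0"
proof
  define f where "f = (\<lambda>s. g s - g 0)"
  have sq: "(f s - f t) * (f s - f t) = (s - t) * (s - t)" for s t
    using arg_cong[OF assms[of s t], of "\<lambda>r. r * r"] by (simp add: f_def)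
  have f0: "f 0 = 0" by (simp add: f_def)
  have self: "f s * f s = s * s" for s using sq[of s 0] f0 by simp
  \<comment> \<open>Polarization of the squared distances.\<close>
  have "f s * f t = s * t" for s t
    using sq[of s t] self[of s] self[of t] by (simp add: algebra_simps)
  from this[of _ 1] have prod: "f s * f 1 = s" for s by simp
  show e: "f 1 * f 1 = 1" using prod[of 1] .
  show "\<forall>s. g s = f 1 * s + g 0"
  proof
    fix s
    have "f 1 * s = f 1 * (f s * f 1)" by (simp add: prod)
    also have "\<dots> = (f 1 * f 1) * f s" by (simp only: mult_ac)
    also have "\<dots> = f s" by (simp add: e)
    finally show "g s = f 1 * s + g 0" by (simp add: f_def)
  qed
qed

text \<open>The unit-speed geodesic through \<open>p\<close> when \<open>n\<close> is a unit tangent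
  vector at \<open>p\<close>.\<close>

definition geo :: "vec4 \<Rightarrow> vec4 \<Rightarrow> real \<Rightarrow> vec4" where
  "geo p n s = cosh s *\<^sub>R p + sinh s *\<^sub>R n"

lemma geo_lorentz: "geo p n s \<circ>\<^sub>L w = cosh s * (p \<circ>\<^sub>L w) + sinh s * (n \<circ>\<^sub>L w)"
  by (simp add: geo_def lorentz_simps)

context
  fixes p n :: vec4
  assumes p: "p \<in> H3" and n: "n \<circ>\<^sub>L n = 1" and pn: "p \<circ>\<^sub>L n = 0"
begin

lemma geo_geo: "geo p n s \<circ>\<^sub>L geo p n t = - cosh (s - t)"
proof -
  have "n \<circ>\<^sub>L p = 0" using pn by (simp add: lorentz_commute)
  then show ?thesis by (simp add: geo_def lorentz_simps H3_sq[OF p] n pn cosh_diff)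
qed

lemma geo_H3: "geo p n s \<in> H3"
proof -
  have sq: "geo p n s \<circ>\<^sub>L geo p n s = -1" by (simp add: geo_geo)
  have "n \<circ>\<^sub>L p = 0" using pn by (simp add: lorentz_commute)
  then have neg: "geo p n s \<circ>\<^sub>L p < 0" by (simp add: geo_lorentz H3_sq[OF p])
  have "geo p n s $ 1 > 0"
    by (rule timelike_future[OF _ neg]) (use sq p in \<open>simp_all add: H3_def\<close>)
  then show ?thesis using sq by (simp add: H3_def)
qed

lemma dH_geo: "dH (geo p n s) (geo p n t) = \<bar>s - t\<bar>"
  by (subst dH_eq_iff[OF geo_H3 geo_H3]) (simp_all add: geo_geo)

lemma range_geo: "range (geo p n) = span {p, n} \<inter> H3"
proof
  show "range (geo p n) \<subseteq> span {p, n} \<inter> H3"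
  proof
    fix v assume "v \<in> range (geo p n)"
    then obtain s where "v = geo p n s" by blast
    moreover have "geo p n s \<in> span {p, n}" unfolding geo_def span_2 by blast
    ultimately show "v \<in> span {p, n} \<inter> H3" using geo_H3 by blast
  qed
  show "span {p, n} \<inter> H3 \<subseteq> range (geo p n)"
  proof
    fix v assume v: "v \<in> span {p, n} \<inter> H3"
    then obtain \<alpha> \<beta> where eq: "v = \<alpha> *\<^sub>R p + \<beta> *\<^sub>R n" by (auto simp: span_2)
    have np: "n \<circ>\<^sub>L p = 0" using pn by (simp add: lorentz_commute)
    have vH: "v \<in> H3" using v by blast
    have "\<alpha>\<^sup>2 = 1 + \<beta>\<^sup>2"
      using H3_sq[OF vH] by (simp add: eq lorentz_simps H3_sq[OF p] n pn np power2_eq_square)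
    moreover have "\<alpha> > 0" using H3_neg[OF vH p] by (simp add: eq lorentz_simps H3_sq[OF p] np)
    moreover define s where "s = arsinh \<beta>"
    moreover have "(cosh s)\<^sup>2 = 1 + \<beta>\<^sup>2" by (simp add: s_def cosh_square_eq)
    ultimately have "cosh s = \<alpha>" by (metis cosh_real_nonneg less_imp_le power2_eq_imp_eq)
    then have "v = geo p n s" by (simp add: geo_def eq s_def)
    then show "v \<in> range (geo p n)" by blast
  qed
qed

text \<open>Two arc-length parametrizations of one line differ by an isometry of the real
  line.\<close>

lemma arclength_param_geo:
  assumes "arclength_param (span {p, n} \<inter> H3) \<gamma>"
  obtains e c where "e * e = 1" "\<And>s. \<gamma> s = geo p n (e * s + c)"
proof -
  have "\<forall>s. \<exists>r. \<gamma> s = geo p n r"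
    using assms range_geo unfolding arclength_param_def by (metis rangeI imageE)
  then obtain g where g: "\<And>s. \<gamma> s = geo p n (g s)" by metis
  have "\<bar>g s - g t\<bar> = \<bar>s - t\<bar>" for s t
    using assms dH_geo[of "g s" "g t"] g unfolding arclength_param_def by simp
  then obtain e where "e * e = 1" "\<forall>s. g s = e * s + g 0" by (rule isometry_real_affine)
  then show ?thesis using that[of e "g 0"] g by metis
qed

end

section \<open>The distance function\<close>

definition distance_fun :: "real \<Rightarrow> real \<Rightarrow> real \<Rightarrow> real \<Rightarrow> real \<times> real \<Rightarrow> real" where
  "distance_fun \<alpha> \<beta> s3 s4 = (\<lambda>(s, t). \<alpha> * exp t * cosh (s - s3) + \<beta> * exp (- t) * cosh (s - s4))"

lemma distance_fun_differentiable: "\<exists>f'. (distance_fun \<alpha> \<beta> s3 s4 has_derivative f') (at z)"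
  unfolding distance_fun_def cosh_field_def split_beta
  by (rule exI) (rule derivative_intros | simp)+

lemma distance_fun_partials:
  assumes "(distance_fun \<alpha> \<beta> s3 s4 has_derivative (\<lambda>_. 0)) (at (s, t))"
  shows "\<alpha> * exp t * sinh (s - s3) + \<beta> * exp (- t) * sinh (s - s4) = 0"
    and "\<alpha> * exp t * cosh (s - s3) - \<beta> * exp (- t) * cosh (s - s4) = 0"
proof -
  have "((\<lambda>r. (r, t)) has_derivative (\<lambda>h. (h, 0))) (at s)"
    "((\<lambda>r. (s, r)) has_derivative (\<lambda>h. (0, h))) (at t)"
    by (auto intro!: derivative_eq_intros)
  from has_derivative_compose[OF this(1) assms] has_derivative_compose[OF this(2) assms]
  have "((\<lambda>r. distance_fun \<alpha> \<beta> s3 s4 (r, t)) has_field_derivative 0) (at s)"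
    "((\<lambda>r. distance_fun \<alpha> \<beta> s3 s4 (s, r)) has_field_derivative 0) (at t)"
    by (simp_all add: has_field_derivative_def lambda_zero)
  moreover have "((\<lambda>r. distance_fun \<alpha> \<beta> s3 s4 (r, t)) has_field_derivative
      \<alpha> * exp t * sinh (s - s3) + \<beta> * exp (- t) * sinh (s - s4)) (at s)"
    unfolding distance_fun_def by (auto intro!: derivative_eq_intros)
  moreover have "((\<lambda>r. distance_fun \<alpha> \<beta> s3 s4 (s, r)) has_field_derivative
      \<alpha> * exp t * cosh (s - s3) - \<beta> * exp (- t) * cosh (s - s4)) (at t)"
    unfolding distance_fun_def by (auto intro!: derivative_eq_intros)
  ultimately show "\<alpha> * exp t * sinh (s - s3) + \<beta> * exp (- t) * sinh (s - s4) = 0"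
    "\<alpha> * exp t * cosh (s - s3) - \<beta> * exp (- t) * cosh (s - s4) = 0"
    using DERIV_unique by blast+
qed

context
  fixes \<alpha> \<beta> s3 s4 :: real
  assumes pos: "\<alpha> > 0" "\<beta> > 0"
begin

text \<open>The midpoint makes the two hyperbolic cosines equal, and
  \<open>exp (2 * t) = \<beta> / \<alpha>\<close> then makes the two summands equal.\<close>

definition crit :: "real \<times> real" where
  "crit = ((s3 + s4) / 2, ln (\<beta> / \<alpha>) / 2)"

lemma exp_crit: "\<alpha> * exp (snd crit) = sqrt (\<alpha> * \<beta>)" "\<beta> * exp (- snd crit) = sqrt (\<alpha> * \<beta>)"
proof -
  have e2: "(exp (snd crit))\<^sup>2 = \<beta> / \<alpha>"
    using pos by (simp add: crit_def power2_eq_square flip: exp_add)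
  have "(\<alpha> * exp (snd crit))\<^sup>2 = \<alpha> * \<beta>" using pos unfolding power_mult_distrib e2 by (simp add: power2_eq_square)
  then show 1: "\<alpha> * exp (snd crit) = sqrt (\<alpha> * \<beta>)" using pos by (simp add: real_sqrt_unique)
  have "(\<beta> * exp (- snd crit))\<^sup>2 = \<alpha> * \<beta>"
    using pos unfolding power_mult_distrib exp_minus power_inverse e2 by (simp add: power2_eq_square)
  then show "\<beta> * exp (- snd crit) = sqrt (\<alpha> * \<beta>)" using pos by (simp add: real_sqrt_unique)
qed

lemma distance_fun_crit: "distance_fun \<alpha> \<beta> s3 s4 crit = 2 * sqrt (\<alpha> * \<beta>) * cosh ((s3 - s4) / 2)"
proof -
  have half: "(s3 + s4) / 2 - s3 = - ((s3 - s4) / 2)" "(s3 + s4) / 2 - s4 = (s3 - s4) / 2"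
    by (simp_all add: field_simps)
  have "distance_fun \<alpha> \<beta> s3 s4 crit = \<alpha> * exp (snd crit) * cosh (fst crit - s3) + \<beta> * exp (- snd crit) * cosh (fst crit - s4)"
    by (simp add: distance_fun_def split_beta)
  also have "\<dots> = sqrt (\<alpha> * \<beta>) * cosh ((s3 + s4) / 2 - s3) + sqrt (\<alpha> * \<beta>) * cosh ((s3 + s4) / 2 - s4)"
    unfolding exp_crit by (simp add: crit_def)
  also have "\<dots> = 2 * sqrt (\<alpha> * \<beta>) * cosh ((s3 - s4) / 2)" unfolding half cosh_minus by simp
  finally show ?thesis .
qed

text \<open>AM-GM in \<open>t\<close>, then \<open>cosh x * cosh y = (cosh (x + y) + cosh (x - y)) / 2\<close>.\<close>

lemma distance_fun_min: "distance_fun \<alpha> \<beta> s3 s4 crit \<le> distance_fun \<alpha> \<beta> s3 s4 (s, t)"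
proof -
  define p where "p = \<alpha> * exp t * cosh (s - s3)"
  define q where "q = \<beta> * exp (- t) * cosh (s - s4)"
  define w where "w = cosh ((s3 - s4) / 2)"
  have pq: "p > 0" "q > 0" using pos by (simp_all add: p_def q_def)
  have "exp t * exp (- t) = 1" by (simp flip: exp_add)
  then have "p * q = \<alpha> * \<beta> * (cosh (s - s3) * cosh (s - s4))"
    by (simp add: p_def q_def mult_ac)
  moreover have "w\<^sup>2 \<le> cosh (s - s3) * cosh (s - s4)"
  proof -
    have sum: "(s - s3) + (s - s4) = 2 * (s - (s3 + s4) / 2)" "(s - s3) - (s - s4) = 2 * (- ((s3 - s4) / 2))"
      by (simp_all add: field_simps)
    have "2 * (cosh (s - s3) * cosh (s - s4)) = cosh ((s - s3) + (s - s4)) + cosh ((s - s3) - (s - s4))"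
      unfolding cosh_add cosh_diff by simp
    moreover have "cosh ((s - s3) - (s - s4)) = 2 * w\<^sup>2 - 1"
      unfolding sum(2) cosh_double_cosh w_def cosh_minus by simp
    ultimately show ?thesis using cosh_real_ge_1[of "(s - s3) + (s - s4)"] by linarith
  qed
  ultimately have "\<alpha> * \<beta> * w\<^sup>2 \<le> p * q" using pos by simp
  then have "sqrt (\<alpha> * \<beta> * w\<^sup>2) \<le> sqrt (p * q)" by (rule real_sqrt_le_mono)
  moreover have "sqrt (\<alpha> * \<beta> * w\<^sup>2) = sqrt (\<alpha> * \<beta>) * w" by (simp add: real_sqrt_mult w_def)
  moreover have "2 * sqrt (p * q) \<le> p + q" using arith_geo_mean_sqrt[of p q] pq by simp
  ultimately have "2 * (sqrt (\<alpha> * \<beta>) * w) \<le> p + q" by linarith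
  then show ?thesis unfolding distance_fun_crit by (simp add: distance_fun_def p_def q_def w_def)
qed

text \<open>Criticality of \<open>crit\<close> follows from minimality. Uniqueness comes from
  combining the partial derivatives so that only \<open>s\<close> remains, and then comparing the
  two exponentials.\<close>

lemma distance_fun_critical_iff:
  "critical_point (distance_fun \<alpha> \<beta> s3 s4) z \<longleftrightarrow> z = crit"
proof
  assume "z = crit"
  moreover obtain f' where f': "(distance_fun \<alpha> \<beta> s3 s4 has_derivative f') (at z)"
    using distance_fun_differentiable by blast
  ultimately have "f' = (\<lambda>_. 0)"
    using distance_fun_min by (intro differential_zero_maxmin[OF _ open_UNIV f']) auto
  then show "critical_point (distance_fun \<alpha> \<beta> s3 s4) z" using f' by (simp add: critical_point_def)
next
  assume cr: "critical_point (distance_fun \<alpha> \<beta> s3 s4) z"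
  obtain s t where z: "z = (s, t)" by (cases z)
  define p where "p = \<alpha> * exp t"
  define q where "q = \<beta> * exp (- t)"
  have pq: "p > 0" "q > 0" using pos by (simp_all add: p_def q_def)
  have E: "p * sinh (s - s3) + q * sinh (s - s4) = 0" "p * cosh (s - s3) - q * cosh (s - s4) = 0"
    using distance_fun_partials[of \<alpha> \<beta> s3 s4 s t] cr unfolding critical_point_def z p_def q_def by simp_all
  \<comment> \<open>The multipliers \<open>cosh (s - s4)\<close> and \<open>sinh (s - s4)\<close>
    eliminate \<open>q\<close> and leave the addition formula for \<open>sinh\<close>.\<close>
  have "p * sinh ((s - s3) + (s - s4)) = cosh (s - s4) * (p * sinh (s - s3) + q * sinh (s - s4))
      + sinh (s - s4) * (p * cosh (s - s3) - q * cosh (s - s4))"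
    unfolding sinh_add by (simp add: algebra_simps)
  also have "\<dots> = 0" unfolding E by simp
  finally have "sinh ((s - s3) + (s - s4)) = 0" using pq by simp
  then have "(s - s3) + (s - s4) = 0" by (simp only: sinh_real_zero_iff)
  then have s: "s = (s3 + s4) / 2" and neg: "s - s3 = - (s - s4)" by simp_all
  have "(p - q) * cosh (s - s4) = 0" using E(2) unfolding neg cosh_minus by (simp add: algebra_simps)
  then have "p = q" by simp
  then have "\<alpha> * exp t * exp t = \<beta> * (exp (- t) * exp t)" by (simp add: p_def q_def)
  also have "exp (- t) * exp t = 1" by (simp flip: exp_add)
  finally have "exp t * exp t = \<beta> / \<alpha>" using pos by (simp add: field_simps)
  then have "exp (2 * t) = \<beta> / \<alpha>" by (simp flip: exp_add)
  then have "2 * t = ln (\<beta> / \<alpha>)" by (metis ln_exp)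
  then show "z = crit" by (simp add: z s crit_def)
qed

end

text \<open>The chain rule. The converse for an invertible substitution is obtained by applying it
  to the inverse substitution.\<close>

lemma critical_point_affine:
  fixes f :: "real \<times> real \<Rightarrow> real"
  assumes "critical_point f (a * s + b, c * t + d)"
  shows "critical_point (\<lambda>(s, t). f (a * s + b, c * t + d)) (s, t)"
proof -
  have "((\<lambda>z. (a * fst z + b, c * snd z + d)) has_derivative (\<lambda>h. (a * fst h, c * snd h))) (at (s, t))"
    by (auto intro!: derivative_eq_intros)
  from has_derivative_compose[OF this, of f "\<lambda>_. 0"] assms
  show ?thesis by (simp add: critical_point_def case_prod_unfold)
qed

lemma critical_point_scaled:
  fixes f :: "real \<times> real \<Rightarrow> real"
  assumes "K \<noteq> 0"
  shows "critical_point (\<lambda>z. f z / K) z \<longleftrightarrow> critical_point f z"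
proof -
  have scale: "critical_point (\<lambda>z. g z * c) z" if "critical_point g z" for g :: "real \<times> real \<Rightarrow> real" and c
    using has_derivative_mult_left[OF that[unfolded critical_point_def], of c] by (simp add: critical_point_def)
  show ?thesis using scale[of f "1 / K"] scale[of "\<lambda>z. f z / K" K] assms by auto
qed

section \<open>The explicit formula\<close>

fun T_cosh :: "real \<times> real \<times> real \<times> real \<times> real \<times> real \<Rightarrow> real" where
  "T_cosh (x, y, a, b, c, d) = 1 / (2 * sqrt y) *
     (sqrt (((x * a + c) / sqrt (x\<^sup>2 - 1) - a) * ((x * b + d) / sqrt (x\<^sup>2 - 1) + b)) +
      sqrt (((x * a + c) / sqrt (x\<^sup>2 - 1) + a) * ((x * b + d) / sqrt (x\<^sup>2 - 1) - b)))"

text \<open>A form of the numerator in which the symmetry and monotonicity are visible.\<close>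

definition T_num :: "real \<Rightarrow> real \<Rightarrow> real \<Rightarrow> real \<Rightarrow> real \<Rightarrow> real" where
  "T_num x a b c d = a * b + c * d + x * (a * d + b * c)
     + sqrt ((a\<^sup>2 + c\<^sup>2 + 2 * x * a * c) * (b\<^sup>2 + d\<^sup>2 + 2 * x * b * d))"

text \<open>Square the sum of the two roots: both the sum and the product of the radicands become
  polynomial once powers of \<open>S\<close> are cleared, because \<open>S\<close> has square
  \<open>x\<^sup>2 - 1\<close>.\<close>

lemma T_cosh_eq:
  assumes "x > 1" "y > 0" "a > 0" "b > 0" "c > 0" "d > 0"
  shows "T_cosh (x, y, a, b, c, d) = sqrt (T_num x a b c d / (2 * y * (x\<^sup>2 - 1)))"
proof -
  define S where "S = sqrt (x\<^sup>2 - 1)"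
  have x2: "x\<^sup>2 - 1 > 0" using assms(1) by (simp add: one_less_power)
  have S: "S > 0" "S\<^sup>2 = x\<^sup>2 - 1" using x2 by (simp_all add: S_def)
  have Sx: "S < x" by (rule power2_less_imp_less) (use S(2) assms(1) in auto)
  define A where "A = (x * a + c) / S"
  define B where "B = (x * b + d) / S"
  have SA: "S * A = x * a + c" "S * B = x * b + d" using S by (simp_all add: A_def B_def)
  have "S * a < x * a" "S * b < x * b" using Sx assms by simp_all
  then have "S * a < S * A" "S * b < S * B" unfolding SA using assms(5,6) by linarith+
  then have AB: "a < A" "b < B" using S(1) by simp_all
  define U where "U = (A - a) * (B + b)"
  define V where "V = (A + a) * (B - b)"
  have UV: "U \<ge> 0" "V \<ge> 0" using AB assms by (simp_all add: U_def V_def)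
  define g where "g = a * b + c * d + x * (a * d + b * c)"
  define h where "h = (a\<^sup>2 + c\<^sup>2 + 2 * x * a * c) * (b\<^sup>2 + d\<^sup>2 + 2 * x * b * d)"
  have "S\<^sup>2 * (U + V) = 2 * ((S * A) * (S * B) - S\<^sup>2 * (a * b))"
    by (simp add: U_def V_def power2_eq_square algebra_simps)
  also have "\<dots> = 2 * g" unfolding SA S(2) g_def by (simp add: power2_eq_square algebra_simps)
  finally have sum: "S\<^sup>2 * (U + V) = 2 * g" .
  \<comment> \<open>The four factors are regrouped into the differences of squares of
    \<open>A\<close> and \<open>a\<close> and of \<open>B\<close> and \<open>b\<close>.\<close>
  have "(S\<^sup>2)\<^sup>2 * (U * V) = ((S * A)\<^sup>2 - S\<^sup>2 * a\<^sup>2) * ((S * B)\<^sup>2 - S\<^sup>2 * b\<^sup>2)"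
    by (simp add: U_def V_def power2_eq_square algebra_simps)
  also have "\<dots> = h" unfolding SA S(2) h_def by (simp add: power2_eq_square algebra_simps)
  finally have h: "(S\<^sup>2)\<^sup>2 * (U * V) = h" .
  have prod: "sqrt h = S\<^sup>2 * (sqrt U * sqrt V)"
    unfolding h[symmetric] real_sqrt_mult real_sqrt_abs by simp
  define t where "t = 1 / (2 * sqrt y) * (sqrt U + sqrt V)"
  have t_eq: "T_cosh (x, y, a, b, c, d) = t" by (simp add: t_def U_def V_def A_def B_def S_def)
  have "t * (2 * sqrt y) = sqrt U + sqrt V" using assms(2) by (simp add: t_def)
  then have "(t * (2 * sqrt y))\<^sup>2 = U + V + 2 * (sqrt U * sqrt V)"
    using UV by (simp add: power2_sum)
  then have "t\<^sup>2 * (4 * y) = U + V + 2 * (sqrt U * sqrt V)"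
    using assms(2) by (simp add: power_mult_distrib)
  then have "S\<^sup>2 * (t\<^sup>2 * (4 * y)) = S\<^sup>2 * (U + V) + 2 * (S\<^sup>2 * (sqrt U * sqrt V))"
    by (simp add: algebra_simps)
  also have "\<dots> = 2 * T_num x a b c d"
    unfolding sum prod[symmetric] T_num_def g_def[symmetric] h_def[symmetric] by simp
  finally have t2: "t\<^sup>2 = T_num x a b c d / (2 * y * (x\<^sup>2 - 1))"
    using assms(2) x2 unfolding S(2) by (simp add: field_simps)
  have "t \<ge> 0" using UV assms(2) by (simp add: t_def)
  then show ?thesis unfolding t_eq using t2 by (simp add: real_sqrt_unique)
qed

lemma T_num_symmetric:
  "T_num x b a d c = T_num x a b c d" "T_num x c d a b = T_num x a b c d" "T_num x d c b a = T_num x a b c d"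
  by (simp_all add: T_num_def algebra_simps)

lemma T_num_strict_mono:
  assumes "x > 1" "a > 0" "b > 0" "c > 0" "d > 0" "a < a'"
  shows "T_num x a b c d < T_num x a' b c d"
proof -
  have "a * b < a' * b" using assms by simp
  moreover have "x * (a * d + b * c) \<le> x * (a' * d + b * c)" using assms by simp
  moreover have "a\<^sup>2 + c\<^sup>2 + 2 * x * a * c \<le> a'\<^sup>2 + c\<^sup>2 + 2 * x * a' * c"
    using assms by (intro add_mono mult_mono power_mono) auto
  then have "(a\<^sup>2 + c\<^sup>2 + 2 * x * a * c) * (b\<^sup>2 + d\<^sup>2 + 2 * x * b * d)
      \<le> (a'\<^sup>2 + c\<^sup>2 + 2 * x * a' * c) * (b\<^sup>2 + d\<^sup>2 + 2 * x * b * d)"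
    using assms by (intro mult_right_mono) auto
  then have "sqrt ((a\<^sup>2 + c\<^sup>2 + 2 * x * a * c) * (b\<^sup>2 + d\<^sup>2 + 2 * x * b * d))
      \<le> sqrt ((a'\<^sup>2 + c\<^sup>2 + 2 * x * a' * c) * (b\<^sup>2 + d\<^sup>2 + 2 * x * b * d))"
    by (rule real_sqrt_le_mono)
  ultimately show ?thesis unfolding T_num_def by linarith
qed

lemma T_cosh_symmetric:
  assumes "x > 1" "y > 0" "a > 0" "b > 0" "c > 0" "d > 0"
  shows "T_cosh (x, y, b, a, d, c) = T_cosh (x, y, a, b, c, d)"
    "T_cosh (x, y, c, d, a, b) = T_cosh (x, y, a, b, c, d)"
    "T_cosh (x, y, d, c, b, a) = T_cosh (x, y, a, b, c, d)"
  using assms by (simp_all add: T_cosh_eq T_num_symmetric del: T_cosh.simps)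

lemma T_cosh_strict_mono:
  assumes "x > 1" "y > 0" "a > 0" "b > 0" "c > 0" "d > 0" "a < a'"
  shows "T_cosh (x, y, a, b, c, d) < T_cosh (x, y, a', b, c, d)"
proof -
  have "x\<^sup>2 - 1 > 0" using assms(1) by (simp add: one_less_power)
  then have "T_num x a b c d / (2 * y * (x\<^sup>2 - 1)) < T_num x a' b c d / (2 * y * (x\<^sup>2 - 1))"
    using T_num_strict_mono[OF assms(1,3-7)] assms(2) by (intro divide_strict_right_mono) auto
  then show ?thesis using assms by (simp add: T_cosh_eq del: T_cosh.simps)
qed

definition T_fun :: "real \<times> real \<times> real \<times> real \<times> real \<times> real \<Rightarrow> real" where
  "T_fun q = arcosh (T_cosh q)"

text \<open>The explicit formula as a function of the distances themselves, witnessing that the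
  minimum depends on nothing else.\<close>

definition M_fun :: "real \<Rightarrow> real \<Rightarrow> real \<Rightarrow> real \<Rightarrow> real \<Rightarrow> real \<Rightarrow> real" where
  "M_fun l h13 h14 h23 h24 d34 = T_cosh (cosh l, exp d34, exp h13, exp h14, exp h23, exp h24)"

section \<open>The configuration\<close>

context tet_model
begin

lemma plane_horoball_params:
  assumes "i \<in> {1, 2}" "j \<in> {3, 4}"
  shows "exp (plane_horoball_dist (P i) (x j)) = - (u i \<circ>\<^sub>L u j)"
proof -
  have "u i \<circ>\<^sub>L u j < 0" using u_neg[of i j] assms by force
  then show ?thesis
    using exp_plane_horoball_dist[OF unit_u[OF assms(1)] x_u(2)[OF assms(2)]] P_eq[OF assms(1)] x_u(1)[OF assms(2)]
    by simp
qed

lemma horoball_param: "exp (horoball_dist (x 3) (x 4)) = - (u 3 \<circ>\<^sub>L u 4) / 2"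
  using exp_horoball_dist[OF light u34] x_eq by simp

lemma tet_params_eq:
  "tet_params P x = (X, - (u 3 \<circ>\<^sub>L u 4) / 2, - (u 1 \<circ>\<^sub>L u 3), - (u 1 \<circ>\<^sub>L u 4), - (u 2 \<circ>\<^sub>L u 3), - (u 2 \<circ>\<^sub>L u 4))"
  by (simp add: tet_params_def cosh_plane_dist horoball_param plane_horoball_params)

section \<open>The geodesic joining the ideal points\<close>

definition Y :: real where "Y = sqrt (- (2 * (u 3 \<circ>\<^sub>L u 4)))"
text \<open>The point of the geodesic at equal signed distance from the two horoballs;
  \<open>dir\<close> is the unit tangent there, pointing to \<open>u 3\<close>. In this
  parametrization the light-like vectors have coefficients \<open>exp t / Y\<close> and
  \<open>exp (- t) / Y\<close>.\<close>

definition mid :: vec4 where "mid = (1 / Y) *\<^sub>R (u 3 + u 4)"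
definition dir :: vec4 where "dir = (1 / Y) *\<^sub>R (u 3 - u 4)"

lemma Y: "Y > 0" "Y * Y = - (2 * (u 3 \<circ>\<^sub>L u 4))"
  using u34 by (simp_all add: Y_def)

lemma mid_dir: "mid \<in> H3" "dir \<circ>\<^sub>L dir = 1" "mid \<circ>\<^sub>L dir = 0"
proof -
  have c: "u 4 \<circ>\<^sub>L u 3 = u 3 \<circ>\<^sub>L u 4" by (rule lorentz_commute)
  have "(1 / Y) * (1 / Y) * (u 3 \<circ>\<^sub>L u 4) = (u 3 \<circ>\<^sub>L u 4) / (Y * Y)" by simp
  also have "\<dots> = - 1 / 2" unfolding Y(2) using u34 by simp
  finally have r: "(1 / Y) * (1 / Y) * (u 3 \<circ>\<^sub>L u 4) = - 1 / 2" .
  have "mid \<circ>\<^sub>L mid = 2 * ((1 / Y) * (1 / Y) * (u 3 \<circ>\<^sub>L u 4))"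
    by (simp add: mid_def lorentz_simps u_light_sq c)
  then have mm: "mid \<circ>\<^sub>L mid = -1" unfolding r by simp
  have "dir \<circ>\<^sub>L dir = - 2 * ((1 / Y) * (1 / Y) * (u 3 \<circ>\<^sub>L u 4))"
    by (simp add: dir_def lorentz_simps u_light_sq c)
  then show "dir \<circ>\<^sub>L dir = 1" unfolding r by simp
  show "mid \<circ>\<^sub>L dir = 0" by (simp add: mid_def dir_def lorentz_simps u_light_sq c)
  have "mid $ 1 > 0" using light Y(1) by (simp add: mid_def positive_lightlike_def add_pos_pos)
  then show "mid \<in> H3" using mm by (simp add: H3_def)
qed

lemma line34: "line 3 4 = span {mid, dir} \<inter> H3"
  unfolding line_def[symmetric]
proof -
  have fl: "flat 1 (span {u 3, u 4}) (line 3 4)" by (rule line_flat) auto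
  have "(mid \<circ>\<^sub>L mid) * (dir \<circ>\<^sub>L dir) < (mid \<circ>\<^sub>L dir)\<^sup>2" using mid_dir H3_sq[of mid] by simp
  moreover have "mid \<in> span {u 3, u 4}" "dir \<in> span {u 3, u 4}"
    unfolding mid_def dir_def by (intro span_scale span_add span_diff span_base; simp)+
  ultimately show "line 3 4 = span {mid, dir} \<inter> H3" by (rule flat_span_2(2)[OF _ fl])
qed

text \<open>The inward normal \<open>- u 1\<close> is the unit tangent of the common perpendicular
  at \<open>foot1\<close>, pointing to the second plane; \<open>foot2\<close> has parameter
  \<open>ell\<close>.\<close>

lemma foot_dir: "(- u 1) \<circ>\<^sub>L (- u 1) = 1" "foot1 \<circ>\<^sub>L (- u 1) = 0"
  using unit foot_gram by (simp_all add: lorentz_simps)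

lemma line12: "line 1 2 = span {foot1, - u 1} \<inter> H3"
proof -
  have fl: "flat 1 (span {u 1, u 2}) (line 1 2)" by (rule line_flat) auto
  have "(foot1 \<circ>\<^sub>L foot1) * ((- u 1) \<circ>\<^sub>L (- u 1)) < (foot1 \<circ>\<^sub>L (- u 1))\<^sup>2" using foot_dir foot_gram by simp
  moreover have "foot1 \<in> span {u 1, u 2}" by (rule foot_in_span)
  moreover have "- u 1 \<in> span {u 1, u 2}" by (intro span_neg span_base) simp
  ultimately show ?thesis by (rule flat_span_2(2)[OF _ fl])
qed

lemmas geo12 = geo_H3[OF foot_H3(1) foot_dir] range_geo[OF foot_H3(1) foot_dir, folded line12]
lemmas geo34 = geo_H3[OF mid_dir] range_geo[OF mid_dir, folded line34]

lemma hyperbolic_polar: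
  fixes A a :: real
  assumes "0 < a" "a < A"
  obtains \<alpha> s where "\<alpha> > 0" "A = \<alpha> * cosh s" "a = \<alpha> * sinh s" "s > 0"
proof -
  have "a * a < A * A" using assms by (intro mult_strict_mono) auto
  define \<alpha> where "\<alpha> = sqrt (A * A - a * a)"
  have \<alpha>: "\<alpha> > 0" "\<alpha> * \<alpha> = A * A - a * a" using \<open>a * a < A * A\<close> by (simp_all add: \<alpha>_def)
  define s where "s = arsinh (a / \<alpha>)"
  have a: "a = \<alpha> * sinh s" using \<alpha> by (simp add: s_def)
  have "(\<alpha> * cosh s)\<^sup>2 = A\<^sup>2"
    unfolding power_mult_distrib cosh_square_eq using \<alpha>(2) a by (simp add: power2_eq_square algebra_simps)
  then have "\<alpha> * cosh s = A" by (rule power2_eq_imp_eq) (use \<alpha> assms in auto)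
  then have "A = \<alpha> * cosh s" ..
  moreover have "s > 0" using \<alpha> assms by (simp add: s_def)
  ultimately show ?thesis using that \<alpha>(1) a by blast
qed

lemma S_lt_X: "S < X"
proof -
  show ?thesis by (rule power2_less_imp_less) (use S_sq X_gt_1 in \<open>auto simp: power2_eq_square\<close>)
qed

text \<open>The right-hand quotient is the one in the explicit formula. The strict inequality makes
  the pair of products expressible in hyperbolic polar coordinates.\<close>

lemma foot1_light:
  assumes "j \<in> {3, 4}"
  shows "- (foot1 \<circ>\<^sub>L u j) = (X * - (u 1 \<circ>\<^sub>L u j) + - (u 2 \<circ>\<^sub>L u j)) / S" "- (u 1 \<circ>\<^sub>L u j) < - (foot1 \<circ>\<^sub>L u j)"
proof -
  have neg: "u 1 \<circ>\<^sub>L u j < 0" "u 2 \<circ>\<^sub>L u j < 0" using u_neg[of 1 j] u_neg[of 2 j] assms by force+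
  have eq: "S * - (foot1 \<circ>\<^sub>L u j) = X * - (u 1 \<circ>\<^sub>L u j) + - (u 2 \<circ>\<^sub>L u j)"
    using arg_cong[OF foot_eq(1), of "\<lambda>w. w \<circ>\<^sub>L u j"] by (simp add: lorentz_simps)
  then show "- (foot1 \<circ>\<^sub>L u j) = (X * - (u 1 \<circ>\<^sub>L u j) + - (u 2 \<circ>\<^sub>L u j)) / S"
    using S_pos by (simp add: field_simps)
  have "S * - (u 1 \<circ>\<^sub>L u j) < X * - (u 1 \<circ>\<^sub>L u j)" using S_lt_X neg by (intro mult_strict_right_mono) auto
  then have "S * - (u 1 \<circ>\<^sub>L u j) < S * - (foot1 \<circ>\<^sub>L u j)" using eq neg(2) by linarith
  then show "- (u 1 \<circ>\<^sub>L u j) < - (foot1 \<circ>\<^sub>L u j)" using S_pos by (simp only: mult_less_cancel_left_pos)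
qed

lemma distance_geo:
  assumes A: "- (foot1 \<circ>\<^sub>L u 3) = \<alpha> * cosh s3" "- (u 1 \<circ>\<^sub>L u 3) = \<alpha> * sinh s3"
    and B: "- (foot1 \<circ>\<^sub>L u 4) = \<beta> * cosh s4" "- (u 1 \<circ>\<^sub>L u 4) = \<beta> * sinh s4"
  shows "- (geo foot1 (- u 1) s \<circ>\<^sub>L geo mid dir t) = distance_fun \<alpha> \<beta> s3 s4 (s, t) / Y"
proof -
  have AB: "foot1 \<circ>\<^sub>L u 3 = - (\<alpha> * cosh s3)" "u 1 \<circ>\<^sub>L u 3 = - (\<alpha> * sinh s3)"
    "foot1 \<circ>\<^sub>L u 4 = - (\<beta> * cosh s4)" "u 1 \<circ>\<^sub>L u 4 = - (\<beta> * sinh s4)"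
    using A B by linarith+
  have g: "geo mid dir t = (1 / Y) *\<^sub>R (exp t *\<^sub>R u 3 + exp (- t) *\<^sub>R u 4)"
  proof -
    have "geo mid dir t = (1 / Y) *\<^sub>R ((cosh t + sinh t) *\<^sub>R u 3 + (cosh t - sinh t) *\<^sub>R u 4)"
      by (simp add: geo_def mid_def dir_def algebra_simps)
    then show ?thesis by (simp only: cosh_plus_sinh cosh_minus_sinh)
  qed
  have 3: "- (geo foot1 (- u 1) s \<circ>\<^sub>L u 3) = \<alpha> * cosh (s - s3)"
    by (simp add: geo_lorentz lorentz_simps cosh_diff AB algebra_simps)
  have 4: "- (geo foot1 (- u 1) s \<circ>\<^sub>L u 4) = \<beta> * cosh (s - s4)"
    by (simp add: geo_lorentz lorentz_simps cosh_diff AB algebra_simps)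
  have "- (geo foot1 (- u 1) s \<circ>\<^sub>L geo mid dir t)
      = (exp t * - (geo foot1 (- u 1) s \<circ>\<^sub>L u 3) + exp (- t) * - (geo foot1 (- u 1) s \<circ>\<^sub>L u 4)) / Y"
    by (simp add: g lorentz_simps algebra_simps diff_divide_distrib add_divide_distrib)
  then show ?thesis unfolding 3 4 by (simp add: distance_fun_def mult_ac)
qed

text \<open>The distance between the planes, as the length of the arc from \<open>foot1\<close> to
  \<open>foot2\<close>.\<close>

definition ell :: real where "ell = arsinh S"

lemma ell: "sinh ell = S" "cosh ell = X"
proof -
  show "sinh ell = S" by (simp add: ell_def)
  then have "(cosh ell)\<^sup>2 = X\<^sup>2" unfolding cosh_square_eq using S_sq by (simp add: power2_eq_square)
  then show "cosh ell = X" by (rule power2_eq_imp_eq) (use X_gt_1 in auto)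
qed

text \<open>\<open>s\<close> is the parameter of the projection of the ideal point to the common
  perpendicular. It is positive because \<open>u 1\<close> pairs negatively with \<open>u j\<close>,
  and below \<open>ell\<close> because \<open>u 2\<close> does.\<close>

lemma light_polar:
  assumes "j \<in> {3, 4}"
  obtains \<alpha> s where "\<alpha> > 0" "- (foot1 \<circ>\<^sub>L u j) = \<alpha> * cosh s" "- (u 1 \<circ>\<^sub>L u j) = \<alpha> * sinh s"
    "0 < s" "s < ell"
proof -
  have neg: "u 1 \<circ>\<^sub>L u j < 0" "u 2 \<circ>\<^sub>L u j < 0" using u_neg[of 1 j] u_neg[of 2 j] assms by force+
  obtain \<alpha> s where p: "\<alpha> > 0" "- (foot1 \<circ>\<^sub>L u j) = \<alpha> * cosh s" "- (u 1 \<circ>\<^sub>L u j) = \<alpha> * sinh s" "s > 0"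
    using hyperbolic_polar[of "- (u 1 \<circ>\<^sub>L u j)" "- (foot1 \<circ>\<^sub>L u j)"] foot1_light(2)[OF assms] neg(1) by auto
  have "S * - (foot1 \<circ>\<^sub>L u j) = X * - (u 1 \<circ>\<^sub>L u j) + - (u 2 \<circ>\<^sub>L u j)"
    using foot1_light(1)[OF assms] S_pos by simp
  then have "\<alpha> * (S * cosh s - X * sinh s) > 0" using neg(2) unfolding p(2,3) by (simp add: algebra_simps)
  then have "S * cosh s - X * sinh s > 0" using p(1) by (simp add: zero_less_mult_iff)
  \<comment> \<open>\<open>S\<close> and \<open>X\<close> are \<open>sinh ell\<close> and
    \<open>cosh ell\<close>, so the bracket is a subtraction formula.\<close>
  then have "sinh (ell - s) > 0" unfolding sinh_diff ell .
  then have "s < ell" by simp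
  then show ?thesis by (rule that[OF p])
qed

text \<open>The hyperbolic form of spherical interpolation: the weights
  \<open>sinh (ell - s) / S\<close> and \<open>sinh s / S\<close> are nonnegative between the
  feet.\<close>

lemma arc_point:
  assumes "0 \<le> s" "s \<le> ell"
  obtains \<mu> \<nu> where "\<mu> \<ge> 0" "\<nu> \<ge> 0" "geo foot1 (- u 1) s = \<mu> *\<^sub>R foot1 + \<nu> *\<^sub>R foot2"
proof
  show "sinh (ell - s) / S \<ge> 0" "sinh s / S \<ge> 0" using assms S_pos by simp_all
  have "S *\<^sub>R (foot2 - X *\<^sub>R foot1) = (u 1 + X *\<^sub>R u 2) - X *\<^sub>R (u 2 + X *\<^sub>R u 1)"
    by (simp add: foot_eq[symmetric] algebra_simps)
  also have "\<dots> = (- (X * X - 1)) *\<^sub>R u 1" by (simp add: algebra_simps)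
  finally have "S *\<^sub>R (foot2 - X *\<^sub>R foot1) = S *\<^sub>R (S *\<^sub>R (- u 1))" by (simp add: S_sq[symmetric])
  then have "foot2 - X *\<^sub>R foot1 = S *\<^sub>R (- u 1)"
    unfolding scaleR_cancel_left using S_pos by (elim disjE) simp_all
  then have u1: "S *\<^sub>R (- u 1) = foot2 - X *\<^sub>R foot1" by (rule sym)
  have "geo foot1 (- u 1) s = cosh s *\<^sub>R foot1 + (sinh s / S) *\<^sub>R (S *\<^sub>R (- u 1))"
    using S_pos by (simp add: geo_def)
  also have "\<dots> = (cosh s - X * sinh s / S) *\<^sub>R foot1 + (sinh s / S) *\<^sub>R foot2"
    unfolding u1 by (simp add: algebra_simps)
  also have "cosh s - X * sinh s / S = sinh (ell - s) / S"
    using S_pos by (simp add: sinh_diff ell field_simps)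
  finally show "geo foot1 (- u 1) s = (sinh (ell - s) / S) *\<^sub>R foot1 + (sinh s / S) *\<^sub>R foot2" .
qed

lemma arc_in_trunc_tet:
  assumes "0 \<le> s" "s \<le> ell"
  shows "geo foot1 (- u 1) s \<in> shortest_arc (P 1) (P 2)" "geo foot1 (- u 1) s \<in> trunc_tet P H x"
proof -
  obtain \<mu> \<nu> where mn: "\<mu> \<ge> 0" "\<nu> \<ge> 0" "geo foot1 (- u 1) s = \<mu> *\<^sub>R foot1 + \<nu> *\<^sub>R foot2"
    by (rule arc_point[OF assms])
  have H: "geo foot1 (- u 1) s \<in> H3" by (rule geo12(1))
  then show "geo foot1 (- u 1) s \<in> shortest_arc (P 1) (P 2)"
    unfolding shortest_arc_eq geodesic_to_def using mn by blast
  have "u 1 \<circ>\<^sub>L foot2 = - S" "u 2 \<circ>\<^sub>L foot1 = - S" "u 1 \<circ>\<^sub>L foot1 = 0" "u 2 \<circ>\<^sub>L foot2 = 0"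
    using foot_gram by (simp_all add: lorentz_commute)
  then have "geo foot1 (- u 1) s \<in> H 1" "geo foot1 (- u 1) s \<in> H 2"
    using H_eq[of 1] H_eq[of 2] H mn S_pos by (simp_all add: half_def lorentz_simps)
  moreover have "geo foot1 (- u 1) s \<in> line 1 2" using geo12(2) by blast
  ultimately show "geo foot1 (- u 1) s \<in> trunc_tet P H x" by (intro in_trunc_tet[of 1 2]) auto
qed

lemma line34_in_trunc_tet:
  assumes "v \<in> line 3 4"
  shows "v \<in> trunc_tet P H x"
proof -
  obtain \<alpha> \<beta> where v: "v \<in> H3" "v = \<alpha> *\<^sub>R u 3 + \<beta> *\<^sub>R u 4" "\<alpha> > 0" "\<beta> > 0"
    using line_point[of 3 4 v] assms by auto
  have "\<alpha> * (u i \<circ>\<^sub>L u 3) + \<beta> * (u i \<circ>\<^sub>L u 4) \<le> 0" if "i \<in> {1, 2}" for i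
    using that v(3,4) u13 u14 u23 u24 by (auto intro!: add_nonpos_nonpos mult_nonneg_nonpos)
  then have "v \<in> H 1" "v \<in> H 2"
    using H_eq[of 1] H_eq[of 2] v(1) by (simp_all add: half_def v(2) lorentz_simps)
  then show ?thesis using assms by (intro in_trunc_tet[of 3 4]) auto
qed

text \<open>In polar coordinates each factor under the roots is an exponential: the sums and
  differences are \<open>\<alpha>\<close> times \<open>exp s3\<close> or \<open>exp (- s3)\<close>,
  and \<open>\<beta>\<close> times \<open>exp s4\<close> or \<open>exp (- s4)\<close>. The two roots
  are then \<open>sqrt (\<alpha> * \<beta>)\<close> times reciprocal exponentials, whose sum is a
  hyperbolic cosine.\<close>

lemma minimum_value:
  assumes pos: "\<alpha> > 0" "\<beta> > 0"
    and A: "- (foot1 \<circ>\<^sub>L u 3) = \<alpha> * cosh s3" "- (u 1 \<circ>\<^sub>L u 3) = \<alpha> * sinh s3"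
    and B: "- (foot1 \<circ>\<^sub>L u 4) = \<beta> * cosh s4" "- (u 1 \<circ>\<^sub>L u 4) = \<beta> * sinh s4"
  shows "distance_fun \<alpha> \<beta> s3 s4 (crit \<alpha> \<beta> s3 s4) / Y = T_cosh (tet_params P x)"
proof -
  \<comment> \<open>The denominator \<open>2 * sqrt y\<close> of the formula is the normalization of
    the geodesic between the ideal points.\<close>
  have Y2: "2 * sqrt (- (u 3 \<circ>\<^sub>L u 4) / 2) = Y"
  proof -
    have "Y = sqrt (2\<^sup>2 * (- (u 3 \<circ>\<^sub>L u 4) / 2))" by (simp add: Y_def)
    then show ?thesis unfolding real_sqrt_mult by simp
  qed
  have root: "sqrt (\<alpha> * exp (- p) * (\<beta> * exp q)) = sqrt (\<alpha> * \<beta>) * exp ((q - p) / 2)" for p q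
  proof -
    have "(exp ((q - p) / 2))\<^sup>2 = exp (- p) * exp q"
      by (simp add: power2_eq_square flip: exp_add)
    then have eq: "\<alpha> * exp (- p) * (\<beta> * exp q) = \<alpha> * \<beta> * (exp ((q - p) / 2))\<^sup>2" by simp
    show ?thesis unfolding eq real_sqrt_mult real_sqrt_abs by simp
  qed
  have "\<alpha> * cosh s3 - \<alpha> * sinh s3 = \<alpha> * exp (- s3)" "\<beta> * cosh s4 + \<beta> * sinh s4 = \<beta> * exp s4"
    "\<alpha> * cosh s3 + \<alpha> * sinh s3 = \<alpha> * exp (- (- s3))" "\<beta> * cosh s4 - \<beta> * sinh s4 = \<beta> * exp (- s4)"
    by (simp_all flip: cosh_plus_sinh cosh_minus_sinh add: algebra_simps)
  note e = this
  have q: "(X * (\<alpha> * sinh s3) + - (u 2 \<circ>\<^sub>L u 3)) / S = \<alpha> * cosh s3"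
    "(X * (\<beta> * sinh s4) + - (u 2 \<circ>\<^sub>L u 4)) / S = \<beta> * cosh s4"
    using foot1_light(1)[of 3] foot1_light(1)[of 4] unfolding A B by simp_all
  have "T_cosh (tet_params P x) = 1 / Y *
      (sqrt ((\<alpha> * cosh s3 - \<alpha> * sinh s3) * (\<beta> * cosh s4 + \<beta> * sinh s4)) +
       sqrt ((\<alpha> * cosh s3 + \<alpha> * sinh s3) * (\<beta> * cosh s4 - \<beta> * sinh s4)))"
    unfolding tet_params_eq T_cosh.simps S_def[symmetric] Y2 A(2) B(2) q ..
  also have "\<dots> = 1 / Y * (sqrt (\<alpha> * \<beta>) * (exp ((s4 - s3) / 2) + exp (- ((s4 - s3) / 2))))"
    unfolding e root by (simp add: algebra_simps diff_divide_distrib)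
  also have "exp ((s4 - s3) / 2) + exp (- ((s4 - s3) / 2)) = 2 * cosh ((s4 - s3) / 2)"
    by (simp add: cosh_field_def)
  also have "cosh ((s4 - s3) / 2) = cosh ((s3 - s4) / 2)"
    by (metis cosh_minus minus_diff_eq minus_divide_left)
  finally show ?thesis unfolding distance_fun_crit[OF pos] by simp
qed

lemma transversal:
  assumes \<gamma>12: "arclength_param (common_perp (P 1) (P 2)) \<gamma>12"
    and \<gamma>34: "arclength_param (geodesic_joining (x 3) (x 4)) \<gamma>34"
    and D: "D = (\<lambda>(s, t). cosh (dH (\<gamma>12 s) (\<gamma>34 t)))"
  shows "\<exists>s0 t0.
      (\<forall>p. critical_point D p \<longleftrightarrow> p = (s0, t0)) \<and>
      (\<forall>p. D (s0, t0) \<le> D p) \<and>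
      D (s0, t0) = M_fun (plane_dist (P 1) (P 2))
         (plane_horoball_dist (P 1) (x 3)) (plane_horoball_dist (P 1) (x 4))
         (plane_horoball_dist (P 2) (x 3)) (plane_horoball_dist (P 2) (x 4))
         (horoball_dist (x 3) (x 4)) \<and>
      \<gamma>12 s0 \<in> trunc_tet P H x \<and> \<gamma>34 t0 \<in> trunc_tet P H x \<and>
      is_transversal (shortest_arc (P 1) (P 2)) (geodesic_joining (x 3) (x 4)) (\<gamma>12 s0) (\<gamma>34 t0) \<and>
      T_fun (tet_params P x) = dH (\<gamma>12 s0) (\<gamma>34 t0) \<and>
      D (s0, t0) = cosh (T_fun (tet_params P x))"
proof -
  have l12: "common_perp (P 1) (P 2) = span {foot1, - u 1} \<inter> H3"
    using common_perp_line[of 1 2] line12 by simp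
  have l34: "geodesic_joining (x 3) (x 4) = line 3 4" using geodesic_joining_line[of 3 4] by simp
  obtain e1 c1 where g1: "e1 * e1 = 1" "\<And>s. \<gamma>12 s = geo foot1 (- u 1) (e1 * s + c1)"
    using arclength_param_geo[OF foot_H3(1) foot_dir \<gamma>12[unfolded l12]] by metis
  obtain e2 c2 where g2: "e2 * e2 = 1" "\<And>t. \<gamma>34 t = geo mid dir (e2 * t + c2)"
    using arclength_param_geo[OF mid_dir \<gamma>34[unfolded l34 line34]] by metis
  obtain \<alpha> s3 where p3: "\<alpha> > 0" "- (foot1 \<circ>\<^sub>L u 3) = \<alpha> * cosh s3" "- (u 1 \<circ>\<^sub>L u 3) = \<alpha> * sinh s3"
    "0 < s3" "s3 < ell" using light_polar[of 3] by auto
  obtain \<beta> s4 where p4: "\<beta> > 0" "- (foot1 \<circ>\<^sub>L u 4) = \<beta> * cosh s4" "- (u 1 \<circ>\<^sub>L u 4) = \<beta> * sinh s4"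
    "0 < s4" "s4 < ell" using light_polar[of 4] by auto
  define G where "G = (\<lambda>z. distance_fun \<alpha> \<beta> s3 s4 z / Y)"
  have cosh_G: "cosh (dH (geo foot1 (- u 1) s) (geo mid dir t)) = G (s, t)" for s t
    using cosh_dH[OF geo12(1) geo34(1)] distance_geo[OF p3(2,3) p4(2,3)] by (simp add: G_def)
  define c where "c = crit \<alpha> \<beta> s3 s4"
  have G_crit: "critical_point G z \<longleftrightarrow> z = c" for z
    using critical_point_scaled[of Y] distance_fun_critical_iff[OF p3(1) p4(1)] Y(1)
    by (simp add: G_def c_def)
  have G_min: "G c \<le> G (s, t)" for s t
    using distance_fun_min[OF p3(1) p4(1)] Y(1) by (simp add: G_def c_def divide_right_mono)
  have G_val: "G c = T_cosh (tet_params P x)"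
    unfolding G_def c_def by (rule minimum_value[OF p3(1) p4(1) p3(2,3) p4(2,3)])
  have D_G: "D = (\<lambda>(s, t). G (e1 * s + c1, e2 * t + c2))" unfolding D g1(2) g2(2) cosh_G ..
  \<comment> \<open>As \<open>e1\<close> and \<open>e2\<close> are their own inverses, the affine
    substitutions can be undone; this transfers critical points in both directions.\<close>
  have undo: "e1 * (e1 * r + k) = r + e1 * k" "e2 * (e2 * r + k) = r + e2 * k" for r k
    using g1(1) g2(1) by (simp_all add: distrib_left flip: mult.assoc)
  have G_D: "G = (\<lambda>(s, t). D (e1 * s + - (e1 * c1), e2 * t + - (e2 * c2)))"
    using g1(1) g2(1) by (auto simp: D_G distrib_left right_diff_distrib simp flip: mult.assoc)
  define s0 where "s0 = e1 * (fst c - c1)"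
  define t0 where "t0 = e2 * (snd c - c2)"
  have st0: "e1 * s0 + c1 = fst c" "e2 * t0 + c2 = snd c"
    using g1(1) g2(1) by (simp_all add: s0_def t0_def flip: mult.assoc)
  have crit_D: "critical_point D p \<longleftrightarrow> p = (s0, t0)" for p
  proof
    obtain s t where p: "p = (s, t)" by (cases p)
    assume "critical_point D p"
    then have "critical_point D (e1 * (e1 * s + c1) + - (e1 * c1), e2 * (e2 * t + c2) + - (e2 * c2))"
      unfolding p undo by simp
    from critical_point_affine[OF this]
    have "critical_point G (e1 * s + c1, e2 * t + c2)" unfolding G_D[symmetric] .
    then have "e1 * s + c1 = fst c" "e2 * t + c2 = snd c" unfolding G_crit by (metis fst_conv, metis snd_conv)
    then have "e1 * (e1 * s) = s0" "e2 * (e2 * t) = t0" by (simp_all add: s0_def t0_def)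
    then show "p = (s0, t0)" using undo[of s 0] undo(2)[of t 0] by (simp add: p)
  next
    assume p: "p = (s0, t0)"
    have "critical_point G (e1 * s0 + c1, e2 * t0 + c2)" unfolding st0 G_crit by simp
    from critical_point_affine[OF this] show "critical_point D p" unfolding D_G p .
  qed
  have D_val: "D (s0, t0) = G c" unfolding D_G by (simp add: st0)
  have D_min: "D (s0, t0) \<le> D p" for p
    using G_min unfolding D_val by (simp add: D_G case_prod_unfold)
  \<comment> \<open>As the midpoint of two parameters between 0 and \<open>ell\<close>, it belongs
    to the edge between the feet.\<close>
  have "fst c = (s3 + s4) / 2" by (simp add: c_def crit_def[OF p3(1) p4(1)])
  then have range: "0 \<le> fst c" "fst c \<le> ell" using p3 p4 by simp_all
  have pts: "\<gamma>12 s0 = geo foot1 (- u 1) (fst c)" "\<gamma>34 t0 = geo mid dir (snd c)" unfolding g1(2) g2(2) st0 by simp_all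
  have d0: "cosh (dH (\<gamma>12 s0) (\<gamma>34 t0)) = G c" unfolding pts cosh_G by simp
  have nonneg: "dH (\<gamma>12 s0) (\<gamma>34 t0) \<ge> 0" unfolding pts by (rule dH_nonneg[OF geo12(1) geo34(1)])
  have on34: "\<gamma>34 t0 \<in> line 3 4" unfolding pts using geo34(2) by blast
  have T: "T_fun (tet_params P x) = dH (\<gamma>12 s0) (\<gamma>34 t0)"
    using arcosh_cosh_real[OF nonneg] unfolding d0 G_val T_fun_def .
  have "is_transversal (shortest_arc (P 1) (P 2)) (geodesic_joining (x 3) (x 4)) (\<gamma>12 s0) (\<gamma>34 t0)"
    unfolding is_transversal_def l34
  proof (intro conjI ballI)
    show "\<gamma>12 s0 \<in> shortest_arc (P 1) (P 2)" unfolding pts by (rule arc_in_trunc_tet(1)[OF range])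
    show "\<gamma>34 t0 \<in> line 3 4" by (rule on34)
    \<comment> \<open>The minimum was taken over the whole lines, so it is in particular a minimum
      over the edge.\<close>
    fix v w assume "v \<in> shortest_arc (P 1) (P 2)" "w \<in> line 3 4"
    then have "v \<in> range (geo foot1 (- u 1))" "w \<in> range (geo mid dir)"
      using shortest_arc_subset unfolding geo12(2) geo34(2) by blast+
    then obtain s t where vw: "v = geo foot1 (- u 1) s" "w = geo mid dir t" by blast
    have "cosh (dH (\<gamma>12 s0) (\<gamma>34 t0)) \<le> cosh (dH v w)" unfolding d0 vw cosh_G by (rule G_min)
    then show "dH (\<gamma>12 s0) (\<gamma>34 t0) \<le> dH v w"
      using cosh_real_nonneg_le_iff[OF nonneg dH_nonneg[OF geo12(1) geo34(1)]] unfolding vw by blast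
  qed
  moreover have "D (s0, t0) = cosh (T_fun (tet_params P x))" unfolding T d0 D_val ..
  moreover have "\<gamma>12 s0 \<in> trunc_tet P H x" unfolding pts by (rule arc_in_trunc_tet(2)[OF range])
  moreover have "\<gamma>34 t0 \<in> trunc_tet P H x" by (rule line34_in_trunc_tet[OF on34])
  ultimately show ?thesis
    using crit_D D_min T D_val[unfolded G_val] unfolding M_fun_def tet_params_def by blast
qed

text \<open>The value is the hyperbolic cosine of a distance in this configuration. The bound is
  what lets \<open>arcosh\<close> be inverted and be strictly increasing on realized
  parameters.\<close>

lemma T_cosh_ge_1: "T_cosh (tet_params P x) \<ge> 1"
proof -
  have l12: "common_perp (P 1) (P 2) = range (geo foot1 (- u 1))"
    using common_perp_line[of 1 2] geo12(2) by simp
  have l34: "geodesic_joining (x 3) (x 4) = range (geo mid dir)"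
    using geodesic_joining_line[of 3 4] geo34(2) by simp
  have "arclength_param (common_perp (P 1) (P 2)) (geo foot1 (- u 1))"
    "arclength_param (geodesic_joining (x 3) (x 4)) (geo mid dir)"
    using dH_geo[OF foot_H3(1) foot_dir] dH_geo[OF mid_dir] by (simp_all add: arclength_param_def l12 l34)
  from transversal[OF this refl]
  have "\<exists>z. M_fun (plane_dist (P 1) (P 2))
     (plane_horoball_dist (P 1) (x 3)) (plane_horoball_dist (P 1) (x 4))
     (plane_horoball_dist (P 2) (x 3)) (plane_horoball_dist (P 2) (x 4))
     (horoball_dist (x 3) (x 4)) = cosh z" by metis
  then show ?thesis unfolding M_fun_def tet_params_def using cosh_real_ge_1 by metis
qed

lemma tet_params_pos:
  assumes "tet_params P x = (\<xi>, y, a, b, c, d)"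
  shows "\<xi> > 1" "y > 0" "a > 0" "b > 0" "c > 0" "d > 0"
  using assms X_gt_1 u13 u14 u23 u24 u34 unfolding tet_params_eq by auto

end

lemma tet_model_exists:
  assumes "tet_data P H x"
  obtains u where "tet_model u P H x"
proof -
  obtain u where u: "tet_frame u" "\<And>i. i \<in> {1, 2} \<Longrightarrow> P i = plane (u i)"
    "\<And>i. i \<in> {1, 2} \<Longrightarrow> H i = half UNIV (- u i)" "x 3 = u 3" "x 4 = u 4"
    using tet_frame_exists[OF assms] by metis
  then have "tet_model u P H x" by (intro tet_model.intro tet_model_axioms.intro)
  then show ?thesis using that by blast
qed

section \<open>Realized parameters, symmetry and monotonicity\<close>

lemma realized_paramsD:
  assumes "(x, y, a, b, c, d) \<in> realized_params"
  shows "x > 1" "y > 0" "a > 0" "b > 0" "c > 0" "d > 0" "T_cosh (x, y, a, b, c, d) \<ge> 1"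
proof -
  obtain P H z where z: "tet_data P H z" "tet_params P z = (x, y, a, b, c, d)"
    using assms unfolding realized_params_def by force
  obtain u where "tet_model u P H z" by (rule tet_model_exists[OF z(1)])
  then interpret tet_model u P H z .
  show "x > 1" "y > 0" "a > 0" "b > 0" "c > 0" "d > 0" using tet_params_pos[OF z(2)] by blast+
  show "T_cosh (x, y, a, b, c, d) \<ge> 1" using T_cosh_ge_1 z(2) by simp
qed

text \<open>Renumbering horoballs or planes realizes the permuted parameters, so the symmetry claim
  includes that its domain is invariant.\<close>

lemma tet_data_swap_horoballs:
  assumes "tet_data P H x"
  shows "tet_data P H (x(3 := x 4, 4 := x 3))"
  using assms unfolding tet_data_def by auto

lemma tet_data_swap_planes:
  assumes "tet_data P H x"
  shows "tet_data (P(1 := P 2, 2 := P 1)) (H(1 := H 2, 2 := H 1)) x"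
  using assms unfolding tet_data_def parallel_planes_def by (auto simp: Int_commute simp flip: One_nat_def)

text \<open>The definition treats the two horoballs differently; symmetry is read off from the
  explicit value.\<close>

lemma horoball_dist_commute:
  assumes "tet_data P H x"
  shows "horoball_dist (x 4) (x 3) = horoball_dist (x 3) (x 4)"
proof -
  have l: "positive_lightlike (x 3)" "positive_lightlike (x 4)" "ideal_point (x 3) \<noteq> ideal_point (x 4)"
    using assms by (auto simp: tet_data_def)
  have neg: "x 3 \<circ>\<^sub>L x 4 < 0" "x 4 \<circ>\<^sub>L x 3 < 0"
    using lightlike_neg[OF l] by (simp_all add: lorentz_commute)
  have "exp (horoball_dist (x 4) (x 3)) = exp (horoball_dist (x 3) (x 4))"
    unfolding exp_horoball_dist[OF l(1,2) neg(1)] exp_horoball_dist[OF l(2,1) neg(2)]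
    by (simp add: lorentz_commute)
  then show ?thesis by simp
qed

lemma realized_params_swap:
  assumes "(x, y, a, b, c, d) \<in> realized_params"
  shows "(x, y, b, a, d, c) \<in> realized_params" "(x, y, c, d, a, b) \<in> realized_params"
proof -
  obtain P H z where z: "tet_data P H z" "tet_params P z = (x, y, a, b, c, d)"
    using assms unfolding realized_params_def by force
  have "tet_params P (z(3 := z 4, 4 := z 3)) = (x, y, b, a, d, c)"
    using z(2) horoball_dist_commute[OF z(1)] by (simp add: tet_params_def)
  then show "(x, y, b, a, d, c) \<in> realized_params"
    unfolding realized_params_def using tet_data_swap_horoballs[OF z(1)] by force
  have "tet_params (P(1 := P 2, 2 := P 1)) z = (x, y, c, d, a, b)"
    using z(2) plane_dist_commute[of "P 1" "P 2"] by (simp add: tet_params_def)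
  then show "(x, y, c, d, a, b) \<in> realized_params"
    unfolding realized_params_def using tet_data_swap_planes[OF z(1)] by force
qed

lemma T_strict_mono:
  assumes p: "(x, y, a, b, c, d) \<in> realized_params" and p': "(x, y, a', b, c, d) \<in> realized_params"
    and "a < a'"
  shows "T_fun (x, y, a, b, c, d) < T_fun (x, y, a', b, c, d)"
  unfolding T_fun_def
  by (rule arcosh_real_strict_mono[OF realized_paramsD(7)[OF p] T_cosh_strict_mono])
    (use realized_paramsD(1-6)[OF p] assms(3) in blast)+

lemma T_symmetric:
  assumes "(x, y, a, b, c, d) \<in> realized_params"
    and "q \<in> {(x, y, b, a, d, c), (x, y, c, d, a, b), (x, y, d, c, b, a)}"
  shows "q \<in> realized_params" "T_fun q = T_fun (x, y, a, b, c, d)"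
proof -
  have "(x, y, d, c, b, a) \<in> realized_params"
    using realized_params_swap(2)[OF realized_params_swap(1)[OF assms(1)]] .
  then show "q \<in> realized_params" using realized_params_swap[OF assms(1)] assms(2) by blast
  have "T_cosh q = T_cosh (x, y, a, b, c, d)"
    using T_cosh_symmetric[OF realized_paramsD(1-6)[OF assms(1)]] assms(2) by (elim insertE emptyE; simp only:)
  then show "T_fun q = T_fun (x, y, a, b, c, d)" by (simp only: T_fun_def)
qed

text \<open>The double transpositions act transitively on the four parameters, so monotonicity in
  the first carries over to the others.\<close>

lemma T_strict_mono_all:
  assumes p: "(x, y, a, b, c, d) \<in> realized_params"
  shows "(x, y, a, b', c, d) \<in> realized_params \<Longrightarrow> b < b' \<Longrightarrow>
      T_fun (x, y, a, b, c, d) < T_fun (x, y, a, b', c, d)"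
    and "(x, y, a, b, c', d) \<in> realized_params \<Longrightarrow> c < c' \<Longrightarrow>
      T_fun (x, y, a, b, c, d) < T_fun (x, y, a, b, c', d)"
    and "(x, y, a, b, c, d') \<in> realized_params \<Longrightarrow> d < d' \<Longrightarrow>
      T_fun (x, y, a, b, c, d) < T_fun (x, y, a, b, c, d')"
proof -
  note sym = T_symmetric[of x y] and swap = realized_params_swap[of x y]
  show "T_fun (x, y, a, b, c, d) < T_fun (x, y, a, b', c, d)"
    if q: "(x, y, a, b', c, d) \<in> realized_params" "b < b'"
    using T_strict_mono[OF swap(1)[OF p] swap(1)[OF q(1)] q(2)]
      sym(2)[OF swap(1)[OF p] insertI1] sym(2)[OF swap(1)[OF q(1)] insertI1] by (simp only:)
  have c: "T_fun (x, y, a, b, c, d) < T_fun (x, y, a, b, c', d)"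
    if q: "(x, y, a, b, c', d) \<in> realized_params" "c < c'" and p: "(x, y, a, b, c, d) \<in> realized_params"
    for a b c c' d
    using T_strict_mono[OF swap(2)[OF p] swap(2)[OF q(1)] q(2)]
      sym(2)[OF swap(2)[OF p] insertI2[OF insertI1]] sym(2)[OF swap(2)[OF q(1)] insertI2[OF insertI1]]
    by (simp only:)
  then show "T_fun (x, y, a, b, c, d) < T_fun (x, y, a, b, c', d)"
    if "(x, y, a, b, c', d) \<in> realized_params" "c < c'" using that p by blast
  show "T_fun (x, y, a, b, c, d) < T_fun (x, y, a, b, c, d')"
    if q: "(x, y, a, b, c, d') \<in> realized_params" "d < d'"
    using c[OF swap(1)[OF q(1)] q(2) swap(1)[OF p]]
      sym(2)[OF swap(1)[OF p] insertI1] sym(2)[OF swap(1)[OF q(1)] insertI1] by (simp only:)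
qed

text \<open>Choosing \<open>M\<close> and \<open>T\<close> ahead of all configurations is what
  expresses dependence on the listed distances alone.\<close>

theorem proposition4p6:
  "\<exists>(M :: real \<Rightarrow> real \<Rightarrow> real \<Rightarrow> real \<Rightarrow> real \<Rightarrow> real \<Rightarrow> real)
    (T :: real \<times> real \<times> real \<times> real \<times> real \<times> real \<Rightarrow> real).
    (\<forall>P H x \<gamma>12 \<gamma>34 D.
       tet_data P H x \<and>
       arclength_param (common_perp (P 1) (P 2)) \<gamma>12 \<and>
       arclength_param (geodesic_joining (x 3) (x 4)) \<gamma>34 \<and>
       D = (\<lambda>(s, t). cosh (dH (\<gamma>12 s) (\<gamma>34 t))) \<longrightarrow>
       (\<exists>s0 t0.
          (\<forall>p. critical_point D p \<longleftrightarrow> p = (s0, t0)) \<and>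
          (\<forall>p. D (s0, t0) \<le> D p) \<and>
          D (s0, t0) = M (plane_dist (P 1) (P 2))
             (plane_horoball_dist (P 1) (x 3)) (plane_horoball_dist (P 1) (x 4))
             (plane_horoball_dist (P 2) (x 3)) (plane_horoball_dist (P 2) (x 4))
             (horoball_dist (x 3) (x 4)) \<and>
          \<gamma>12 s0 \<in> trunc_tet P H x \<and> \<gamma>34 t0 \<in> trunc_tet P H x \<and>
          is_transversal (shortest_arc (P 1) (P 2)) (geodesic_joining (x 3) (x 4)) (\<gamma>12 s0) (\<gamma>34 t0) \<and>
          T (tet_params P x) = dH (\<gamma>12 s0) (\<gamma>34 t0) \<and>
          D (s0, t0) = cosh (T (tet_params P x)))) \<and>
    (\<forall>x y a b c d. (x, y, a, b, c, d) \<in> realized_params \<longrightarrow>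
       (\<forall>a'. (x, y, a', b, c, d) \<in> realized_params \<and> a < a' \<longrightarrow>
          T (x, y, a, b, c, d) < T (x, y, a', b, c, d)) \<and>
       (\<forall>b'. (x, y, a, b', c, d) \<in> realized_params \<and> b < b' \<longrightarrow>
          T (x, y, a, b, c, d) < T (x, y, a, b', c, d)) \<and>
       (\<forall>c'. (x, y, a, b, c', d) \<in> realized_params \<and> c < c' \<longrightarrow>
          T (x, y, a, b, c, d) < T (x, y, a, b, c', d)) \<and>
       (\<forall>d'. (x, y, a, b, c, d') \<in> realized_params \<and> d < d' \<longrightarrow>
          T (x, y, a, b, c, d) < T (x, y, a, b, c, d')) \<and>
       (\<forall>q \<in> {(x, y, b, a, d, c), (x, y, c, d, a, b), (x, y, d, c, b, a)}.
          q \<in> realized_params \<and> T q = T (x, y, a, b, c, d)) \<and>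
       cosh (T (x, y, a, b, c, d)) =
         1 / (2 * sqrt y) *
         (sqrt (((x * a + c) / sqrt (x\<^sup>2 - 1) - a) * ((x * b + d) / sqrt (x\<^sup>2 - 1) + b)) +
          sqrt (((x * a + c) / sqrt (x\<^sup>2 - 1) + a) * ((x * b + d) / sqrt (x\<^sup>2 - 1) - b))))"
proof (rule exI[of _ M_fun], rule exI[of _ T_fun], (rule conjI; intro allI impI), goal_cases)
  case (1 P H x \<gamma>12 \<gamma>34 D)
  then obtain u where "tet_model u P H x" using tet_model_exists by blast
  with 1 show ?case by (elim conjE) (rule tet_model.transversal)
next
  case (2 x y a b c d)
  note p = this
  show ?case
  proof (intro conjI allI impI ballI)
    show "T_fun (x, y, a, b, c, d) < T_fun (x, y, a', b, c, d)"
      if "(x, y, a', b, c, d) \<in> realized_params \<and> a < a'" for a'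
      using T_strict_mono[OF p] that by blast
    show "T_fun (x, y, a, b, c, d) < T_fun (x, y, a, b', c, d)"
      if "(x, y, a, b', c, d) \<in> realized_params \<and> b < b'" for b'
      using T_strict_mono_all(1)[OF p] that by blast
    show "T_fun (x, y, a, b, c, d) < T_fun (x, y, a, b, c', d)"
      if "(x, y, a, b, c', d) \<in> realized_params \<and> c < c'" for c'
      using T_strict_mono_all(2)[OF p] that by blast
    show "T_fun (x, y, a, b, c, d) < T_fun (x, y, a, b, c, d')"
      if "(x, y, a, b, c, d') \<in> realized_params \<and> d < d'" for d'
      using T_strict_mono_all(3)[OF p] that by blast
    show "q \<in> realized_params" "T_fun q = T_fun (x, y, a, b, c, d)"
      if "q \<in> {(x, y, b, a, d, c), (x, y, c, d, a, b), (x, y, d, c, b, a)}" for q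
      using T_symmetric[OF p that] by blast+
    show "cosh (T_fun (x, y, a, b, c, d)) = 1 / (2 * sqrt y) *
         (sqrt (((x * a + c) / sqrt (x\<^sup>2 - 1) - a) * ((x * b + d) / sqrt (x\<^sup>2 - 1) + b)) +
          sqrt (((x * a + c) / sqrt (x\<^sup>2 - 1) + a) * ((x * b + d) / sqrt (x\<^sup>2 - 1) - b)))"
      using cosh_arcosh_real[OF realized_paramsD(7)[OF p]] unfolding T_fun_def T_cosh.simps .
  qed
qed

end
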